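(* Let $\mathbb{E}$ be a regular Gumm category such that any fiber $Pt_Y\mathbb{E}$ satisfies Axiom $\ast$. Suppose, in addition, that these fibers admit diagonal punctuations. Then, given any split epimorphism $(f,s): X\rightleftarrows Y$, its diagonal punctuation in $Pt_Y\mathbb{E}$, i.e. the pushout $\omega_f: R[f]\to Dp[f]$, $\theta_f:Y\to Dp[f]$ of the diagonal $s_0^f:X\to R[f]$ along $f$, with $\psi_f:Dp[f]\to Y$ the retraction of $\theta_f$ determined by $\psi_f\omega_f=f d_0^f$, produces with $(\psi_f,\theta_f)$ the universal abelian split epimorphism associated with $(f,s)$. Moreover, the full subcategory $AbPt_Y\mathbb{E}\subset Pt_Y\mathbb{E}$ of abelian split epimorphisms above $Y$ is stable under monomorphisms.
   Context: All categories are finitely complete. A Gumm category is a finitely complete category satisfying the Shifting Lemma: for any equivalence relations $R,S,T$ on an object $X$ with $R\cap S\subset T$ and any generalized elements $x,y,x',y'$ of $X$ with $xSy$, $x'Sy'$, $xRx'$, $yRy'$, if $xTx'$ then $yTy'$. $Pt_Y\mathbb{E}$ is the (pointed) category of split epimorphisms with codomain $Y$ and given section, with morphisms the maps over $Y$ commuting with the sections. $R[f]$ is the kernel equivalence relation of $f$, with projections $d_0^f,d_1^f$. In a category, the diagonal punctuation of an object $X$ is the pushout of the diagonal $s_0^X:X\to X\times X$ along the terminal map $X\to 1$; in $Pt_Y\mathbb{E}$, for the object $(f,s)$, this is the pushout of $s_0^f:X\to R[f]$ along $f:X\to Y$. For equivalence relations $R,T$ on an object $W$: $R\square T$ is the object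 of quadruples $(x,y,t,z)$ with $xRy$, $tRz$, $xTt$, $yTz$; $R\times_1T$ is the object of triples $(x,y,z)$ with $xRyTz$; $\zeta_{R,T}:R\square T\to R\times_1T$ is $(x,y,t,z)\mapsto(x,y,z)$. A relation $(f,g):W\rightarrowtail X\times Z$ is difunctional when $R[f]\cap R[g]=\Delta_W$ and $\zeta_{R[f],R[g]}$ is an isomorphism. In a pointed category, a relation $(f,g):W\rightarrowtail X\times Z$ is right punctual when $g$ has a section $t$ with $ft=0$. A pointed category satisfies Axiom $\ast$ when, for any right punctual difunctional relation $(\pi_0^X,\pi_1^Z):W\rightarrowtail X\times Z$ and any equivalence relation $T$ on $W$, the map $\zeta_{R[\pi_0^X],T}: R[\pi_0^X]\square T\to R[\pi_0^X]\times_1T$ is an extremal epimorphism. A split epimorphism $(f,s):X\rightleftarrows Y$ in a Gumm category is abelian when there is a morphism $d:R[f]\to X$ over $Y$ with $d(x,x)=sf(x)$ and $d(x,sf(x))=x$ (it is then unique and is the difference of a unique internal abelian group structure in $Pt_Y\mathbb{E}$). $(\psi,\theta)$ is the universal abelian split epimorphism associated with $(f,s)$ when it is abelian and there is a morphism $(f,s)\to(\psi,\theta)$ in $Pt_Y\mathbb{E}$ through which any morphism from $(f,s)$ to an abelian split epimorphism above $Y$ factors uniquely. Stability under monomorphisms means: if $(f',s')\to(f,s)$ is a monomorphism in $Pt_Y\mathbb{E}$ and $(f,s)$ is abelian, so is $(f',s')$. *)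

theory Defs
  imports Main
begin

section \<open>Categories\<close>

text \<open>The sets of objects and arrows are explicit; the operations are only meaningful on them.\<close>

record ('o, 'a) cat =
  Obj :: "'o set"
  Arr :: "'a set"
  Dom :: "'a \<Rightarrow> 'o"
  Cod :: "'a \<Rightarrow> 'o"
  Id :: "'o \<Rightarrow> 'a"
  Comp :: "'a \<Rightarrow> 'a \<Rightarrow> 'a" (infixr "\<cdot>\<index>" 70)

definition hom :: "('o, 'a) cat \<Rightarrow> 'o \<Rightarrow> 'o \<Rightarrow> 'a set" where
  "hom C X Y = {f \<in> Arr C. Dom C f = X \<and> Cod C f = Y}"

definition category :: "('o, 'a) cat \<Rightarrow> bool" where
  "category C \<longleftrightarrow>
     (\<forall>f\<in>Arr C. Dom C f \<in> Obj C \<and> Cod C f \<in> Obj C) \<and>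
     (\<forall>X\<in>Obj C. Id C X \<in> hom C X X) \<and>
     (\<forall>X Y Z f g. f \<in> hom C X Y \<longrightarrow> g \<in> hom C Y Z \<longrightarrow> g \<cdot>\<^bsub>C\<^esub> f \<in> hom C X Z) \<and>
     (\<forall>X Y f. f \<in> hom C X Y \<longrightarrow> f \<cdot>\<^bsub>C\<^esub> Id C X = f \<and> Id C Y \<cdot>\<^bsub>C\<^esub> f = f) \<and>
     (\<forall>X Y Z W f g h. f \<in> hom C X Y \<longrightarrow> g \<in> hom C Y Z \<longrightarrow> h \<in> hom C Z W \<longrightarrow>
        h \<cdot>\<^bsub>C\<^esub> (g \<cdot>\<^bsub>C\<^esub> f) = (h \<cdot>\<^bsub>C\<^esub> g) \<cdot>\<^bsub>C\<^esub> f)"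

definition is_mono :: "('o, 'a) cat \<Rightarrow> 'a \<Rightarrow> bool" where
  "is_mono C m \<longleftrightarrow> m \<in> Arr C \<and>
     (\<forall>U. \<forall>u\<in>hom C U (Dom C m). \<forall>v\<in>hom C U (Dom C m). m \<cdot>\<^bsub>C\<^esub> u = m \<cdot>\<^bsub>C\<^esub> v \<longrightarrow> u = v)"

definition is_epi :: "('o, 'a) cat \<Rightarrow> 'a \<Rightarrow> bool" where
  "is_epi C e \<longleftrightarrow> e \<in> Arr C \<and>
     (\<forall>U. \<forall>u\<in>hom C (Cod C e) U. \<forall>v\<in>hom C (Cod C e) U. u \<cdot>\<^bsub>C\<^esub> e = v \<cdot>\<^bsub>C\<^esub> e \<longrightarrow> u = v)"

definition is_iso :: "('o, 'a) cat \<Rightarrow> 'a \<Rightarrow> bool" where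
  "is_iso C f \<longleftrightarrow> f \<in> Arr C \<and>
     (\<exists>g\<in>hom C (Cod C f) (Dom C f). g \<cdot>\<^bsub>C\<^esub> f = Id C (Dom C f) \<and> f \<cdot>\<^bsub>C\<^esub> g = Id C (Cod C f))"

definition is_extremal_epi :: "('o, 'a) cat \<Rightarrow> 'a \<Rightarrow> bool" where
  "is_extremal_epi C e \<longleftrightarrow> is_epi C e \<and>
     (\<forall>m g. is_mono C m \<longrightarrow> g \<in> hom C (Dom C e) (Dom C m) \<longrightarrow> m \<cdot>\<^bsub>C\<^esub> g = e \<longrightarrow> is_iso C m)"


section \<open>Limits and colimits\<close>

text \<open>
  Finite completeness: every diagram indexed by a finite directed graph (vertices V, edges A)
  has a limit. Diagrams indexed by finite categories are a special case. Up to isomorphism of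
  graphs, vertices and edges may be taken to be natural numbers.
\<close>

definition is_diagram ::
  "('o, 'a) cat \<Rightarrow> nat set \<Rightarrow> nat set \<Rightarrow> (nat \<Rightarrow> nat) \<Rightarrow> (nat \<Rightarrow> nat) \<Rightarrow>
   (nat \<Rightarrow> 'o) \<Rightarrow> (nat \<Rightarrow> 'a) \<Rightarrow> bool" where
  "is_diagram C V A src tgt D F \<longleftrightarrow>
     (\<forall>v\<in>V. D v \<in> Obj C) \<and>
     (\<forall>a\<in>A. src a \<in> V \<and> tgt a \<in> V \<and> F a \<in> hom C (D (src a)) (D (tgt a)))"

definition is_cone ::
  "('o, 'a) cat \<Rightarrow> nat set \<Rightarrow> nat set \<Rightarrow> (nat \<Rightarrow> nat) \<Rightarrow> (nat \<Rightarrow> nat) \<Rightarrow>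
   (nat \<Rightarrow> 'o) \<Rightarrow> (nat \<Rightarrow> 'a) \<Rightarrow> 'o \<Rightarrow> (nat \<Rightarrow> 'a) \<Rightarrow> bool" where
  "is_cone C V A src tgt D F L p \<longleftrightarrow>
     L \<in> Obj C \<and> (\<forall>v\<in>V. p v \<in> hom C L (D v)) \<and>
     (\<forall>a\<in>A. F a \<cdot>\<^bsub>C\<^esub> p (src a) = p (tgt a))"

definition is_limit ::
  "('o, 'a) cat \<Rightarrow> nat set \<Rightarrow> nat set \<Rightarrow> (nat \<Rightarrow> nat) \<Rightarrow> (nat \<Rightarrow> nat) \<Rightarrow>
   (nat \<Rightarrow> 'o) \<Rightarrow> (nat \<Rightarrow> 'a) \<Rightarrow> 'o \<Rightarrow> (nat \<Rightarrow> 'a) \<Rightarrow> bool" where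
  "is_limit C V A src tgt D F L p \<longleftrightarrow>
     is_cone C V A src tgt D F L p \<and>
     (\<forall>U q. is_cone C V A src tgt D F U q \<longrightarrow>
        (\<exists>!h. h \<in> hom C U L \<and> (\<forall>v\<in>V. p v \<cdot>\<^bsub>C\<^esub> h = q v)))"

definition finitely_complete :: "('o, 'a) cat \<Rightarrow> bool" where
  "finitely_complete C \<longleftrightarrow> category C \<and>
     (\<forall>V A src tgt D F. finite V \<longrightarrow> finite A \<longrightarrow> is_diagram C V A src tgt D F \<longrightarrow>
        (\<exists>L p. is_limit C V A src tgt D F L p))"

definition is_terminal :: "('o, 'a) cat \<Rightarrow> 'o \<Rightarrow> bool" where
  "is_terminal C T \<longleftrightarrow> T \<in> Obj C \<and> (\<forall>X\<in>Obj C. \<exists>!t. t \<in> hom C X T)"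

definition is_initial :: "('o, 'a) cat \<Rightarrow> 'o \<Rightarrow> bool" where
  "is_initial C I \<longleftrightarrow> I \<in> Obj C \<and> (\<forall>X\<in>Obj C. \<exists>!i. i \<in> hom C I X)"

definition is_product :: "('o, 'a) cat \<Rightarrow> 'o \<Rightarrow> 'o \<Rightarrow> 'a \<Rightarrow> 'a \<Rightarrow> bool" where
  "is_product C X Y p0 p1 \<longleftrightarrow>
     p0 \<in> hom C (Dom C p0) X \<and> p1 \<in> hom C (Dom C p0) Y \<and>
     (\<forall>U. \<forall>u\<in>hom C U X. \<forall>v\<in>hom C U Y.
        \<exists>!h. h \<in> hom C U (Dom C p0) \<and> p0 \<cdot>\<^bsub>C\<^esub> h = u \<and> p1 \<cdot>\<^bsub>C\<^esub> h = v)"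

definition is_pullback :: "('o, 'a) cat \<Rightarrow> 'a \<Rightarrow> 'a \<Rightarrow> 'a \<Rightarrow> 'a \<Rightarrow> bool" where
  "is_pullback C f g p q \<longleftrightarrow>
     f \<in> Arr C \<and> g \<in> hom C (Dom C g) (Cod C f) \<and>
     p \<in> hom C (Dom C p) (Dom C f) \<and> q \<in> hom C (Dom C p) (Dom C g) \<and>
     f \<cdot>\<^bsub>C\<^esub> p = g \<cdot>\<^bsub>C\<^esub> q \<and>
     (\<forall>U. \<forall>u\<in>hom C U (Dom C f). \<forall>v\<in>hom C U (Dom C g). f \<cdot>\<^bsub>C\<^esub> u = g \<cdot>\<^bsub>C\<^esub> v \<longrightarrow>
        (\<exists>!h. h \<in> hom C U (Dom C p) \<and> p \<cdot>\<^bsub>C\<^esub> h = u \<and> q \<cdot>\<^bsub>C\<^esub> h = v))"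

definition is_pushout :: "('o, 'a) cat \<Rightarrow> 'a \<Rightarrow> 'a \<Rightarrow> 'a \<Rightarrow> 'a \<Rightarrow> bool" where
  "is_pushout C f g p q \<longleftrightarrow>
     f \<in> Arr C \<and> g \<in> hom C (Dom C f) (Cod C g) \<and>
     p \<in> hom C (Cod C f) (Cod C p) \<and> q \<in> hom C (Cod C g) (Cod C p) \<and>
     p \<cdot>\<^bsub>C\<^esub> f = q \<cdot>\<^bsub>C\<^esub> g \<and>
     (\<forall>U. \<forall>u\<in>hom C (Cod C f) U. \<forall>v\<in>hom C (Cod C g) U. u \<cdot>\<^bsub>C\<^esub> f = v \<cdot>\<^bsub>C\<^esub> g \<longrightarrow>
        (\<exists>!h. h \<in> hom C (Cod C p) U \<and> h \<cdot>\<^bsub>C\<^esub> p = u \<and> h \<cdot>\<^bsub>C\<^esub> q = v))"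

definition is_coequalizer :: "('o, 'a) cat \<Rightarrow> 'a \<Rightarrow> 'a \<Rightarrow> 'a \<Rightarrow> bool" where
  "is_coequalizer C u v q \<longleftrightarrow>
     u \<in> Arr C \<and> v \<in> hom C (Dom C u) (Cod C u) \<and> q \<in> hom C (Cod C u) (Cod C q) \<and>
     q \<cdot>\<^bsub>C\<^esub> u = q \<cdot>\<^bsub>C\<^esub> v \<and>
     (\<forall>Z. \<forall>w\<in>hom C (Cod C u) Z. w \<cdot>\<^bsub>C\<^esub> u = w \<cdot>\<^bsub>C\<^esub> v \<longrightarrow>
        (\<exists>!h. h \<in> hom C (Cod C q) Z \<and> h \<cdot>\<^bsub>C\<^esub> q = w))"

definition is_regular_epi :: "('o, 'a) cat \<Rightarrow> 'a \<Rightarrow> bool" where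
  "is_regular_epi C q \<longleftrightarrow> (\<exists>u v. is_coequalizer C u v q)"


section \<open>Internal relations\<close>

text \<open>
  A relation from X to Z is a jointly monic pair of arrows; two generalized elements are related
  when the pair they form factors through it.
\<close>

definition is_relation :: "('o, 'a) cat \<Rightarrow> 'o \<Rightarrow> 'o \<Rightarrow> 'a \<times> 'a \<Rightarrow> bool" where
  "is_relation C X Z R \<longleftrightarrow>
     fst R \<in> hom C (Dom C (fst R)) X \<and> snd R \<in> hom C (Dom C (fst R)) Z \<and>
     (\<forall>U. \<forall>u\<in>hom C U (Dom C (fst R)). \<forall>v\<in>hom C U (Dom C (fst R)).
        fst R \<cdot>\<^bsub>C\<^esub> u = fst R \<cdot>\<^bsub>C\<^esub> v \<and> snd R \<cdot>\<^bsub>C\<^esub> u = snd R \<cdot>\<^bsub>C\<^esub> v \<longrightarrow> u = v)"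

definition related :: "('o, 'a) cat \<Rightarrow> 'a \<times> 'a \<Rightarrow> 'a \<Rightarrow> 'a \<Rightarrow> bool" where
  "related C R x y \<longleftrightarrow>
     (\<exists>h\<in>Arr C. Cod C h = Dom C (fst R) \<and> fst R \<cdot>\<^bsub>C\<^esub> h = x \<and> snd R \<cdot>\<^bsub>C\<^esub> h = y)"

definition is_equivalence :: "('o, 'a) cat \<Rightarrow> 'o \<Rightarrow> 'a \<times> 'a \<Rightarrow> bool" where
  "is_equivalence C X R \<longleftrightarrow> is_relation C X X R \<and>
     (\<forall>U\<in>Obj C. equiv (hom C U X)
        {(x, y). x \<in> hom C U X \<and> y \<in> hom C U X \<and> related C R x y})"

text \<open>The kernel equivalence relation, given by its two projections.\<close>

definition is_kernel_pair :: "('o, 'a) cat \<Rightarrow> 'a \<Rightarrow> 'a \<times> 'a \<Rightarrow> bool" where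
  "is_kernel_pair C f R \<longleftrightarrow> is_pullback C f f (fst R) (snd R)"

definition shifting_lemma :: "('o, 'a) cat \<Rightarrow> bool" where
  "shifting_lemma C \<longleftrightarrow>
     (\<forall>X\<in>Obj C. \<forall>R S T.
        is_equivalence C X R \<longrightarrow> is_equivalence C X S \<longrightarrow> is_equivalence C X T \<longrightarrow>
        (\<forall>U. \<forall>x\<in>hom C U X. \<forall>y\<in>hom C U X.
           related C R x y \<and> related C S x y \<longrightarrow> related C T x y) \<longrightarrow>
        (\<forall>U. \<forall>x\<in>hom C U X. \<forall>y\<in>hom C U X. \<forall>x'\<in>hom C U X. \<forall>y'\<in>hom C U X.
           related C S x y \<longrightarrow> related C S x' y' \<longrightarrow> related C R x x' \<longrightarrow> related C R y y' \<longrightarrow>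
           related C T x x' \<longrightarrow> related C T y y'))"

definition gumm_category :: "('o, 'a) cat \<Rightarrow> bool" where
  "gumm_category C \<longleftrightarrow> finitely_complete C \<and> shifting_lemma C"

definition regular_category :: "('o, 'a) cat \<Rightarrow> bool" where
  "regular_category C \<longleftrightarrow> finitely_complete C \<and>
     (\<forall>f\<in>Arr C. \<forall>R. is_kernel_pair C f R \<longrightarrow> (\<exists>q. is_coequalizer C (fst R) (snd R) q)) \<and>
     (\<forall>f g p q. is_pullback C f g p q \<longrightarrow> is_regular_epi C g \<longrightarrow> is_regular_epi C p)"

text \<open>
  The object of quadruples (x, y, t, z) with x R y, t R z, x T t, y T z, and the object of triples
  (x, y, z) with x R y and y T z, where R and T are relations on W. Both are given by
  their projections to W and the universal property of representing such generalized elements.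
\<close>

definition is_square_object ::
  "('o, 'a) cat \<Rightarrow> 'o \<Rightarrow> 'a \<times> 'a \<Rightarrow> 'a \<times> 'a \<Rightarrow> 'o \<Rightarrow> 'a \<Rightarrow> 'a \<Rightarrow> 'a \<Rightarrow> 'a \<Rightarrow> bool" where
  "is_square_object C W R T Q x y t z \<longleftrightarrow>
     x \<in> hom C Q W \<and> y \<in> hom C Q W \<and> t \<in> hom C Q W \<and> z \<in> hom C Q W \<and>
     related C R x y \<and> related C R t z \<and> related C T x t \<and> related C T y z \<and>
     (\<forall>U. \<forall>x'\<in>hom C U W. \<forall>y'\<in>hom C U W. \<forall>t'\<in>hom C U W. \<forall>z'\<in>hom C U W.
        related C R x' y' \<and> related C R t' z' \<and> related C T x' t' \<and> related C T y' z' \<longrightarrow>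
        (\<exists>!h. h \<in> hom C U Q \<and> x \<cdot>\<^bsub>C\<^esub> h = x' \<and> y \<cdot>\<^bsub>C\<^esub> h = y' \<and> t \<cdot>\<^bsub>C\<^esub> h = t' \<and> z \<cdot>\<^bsub>C\<^esub> h = z'))"

definition is_triple_object ::
  "('o, 'a) cat \<Rightarrow> 'o \<Rightarrow> 'a \<times> 'a \<Rightarrow> 'a \<times> 'a \<Rightarrow> 'o \<Rightarrow> 'a \<Rightarrow> 'a \<Rightarrow> 'a \<Rightarrow> bool" where
  "is_triple_object C W R T P x y z \<longleftrightarrow>
     x \<in> hom C P W \<and> y \<in> hom C P W \<and> z \<in> hom C P W \<and>
     related C R x y \<and> related C T y z \<and>
     (\<forall>U. \<forall>x'\<in>hom C U W. \<forall>y'\<in>hom C U W. \<forall>z'\<in>hom C U W.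
        related C R x' y' \<and> related C T y' z' \<longrightarrow>
        (\<exists>!h. h \<in> hom C U P \<and> x \<cdot>\<^bsub>C\<^esub> h = x' \<and> y \<cdot>\<^bsub>C\<^esub> h = y' \<and> z \<cdot>\<^bsub>C\<^esub> h = z'))"

definition is_zeta :: "('o, 'a) cat \<Rightarrow> 'o \<Rightarrow> 'a \<times> 'a \<Rightarrow> 'a \<times> 'a \<Rightarrow> 'a \<Rightarrow> bool" where
  "is_zeta C W R T \<zeta> \<longleftrightarrow>
     (\<exists>Q x y t z P x' y' z'.
        is_square_object C W R T Q x y t z \<and> is_triple_object C W R T P x' y' z' \<and>
        \<zeta> \<in> hom C Q P \<and> x' \<cdot>\<^bsub>C\<^esub> \<zeta> = x \<and> y' \<cdot>\<^bsub>C\<^esub> \<zeta> = y \<and> z' \<cdot>\<^bsub>C\<^esub> \<zeta> = z)"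

definition is_difunctional :: "('o, 'a) cat \<Rightarrow> 'o \<Rightarrow> 'o \<Rightarrow> 'a \<times> 'a \<Rightarrow> bool" where
  "is_difunctional C X Z W \<longleftrightarrow> is_relation C X Z W \<and>
     (\<exists>R S \<zeta>. is_kernel_pair C (fst W) R \<and> is_kernel_pair C (snd W) S \<and>
        (\<forall>U. \<forall>x\<in>hom C U (Dom C (fst W)). \<forall>y\<in>hom C U (Dom C (fst W)).
           related C R x y \<and> related C S x y \<longleftrightarrow> x = y) \<and>
        is_zeta C (Dom C (fst W)) R S \<zeta> \<and> is_iso C \<zeta>)"


section \<open>Pointed categories and Axiom *\<close>

definition is_zero_object :: "('o, 'a) cat \<Rightarrow> 'o \<Rightarrow> bool" where
  "is_zero_object C N \<longleftrightarrow> is_initial C N \<and> is_terminal C N"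

definition pointed :: "('o, 'a) cat \<Rightarrow> bool" where
  "pointed C \<longleftrightarrow> (\<exists>N. is_zero_object C N)"

definition is_zero_arrow :: "('o, 'a) cat \<Rightarrow> 'a \<Rightarrow> bool" where
  "is_zero_arrow C h \<longleftrightarrow> h \<in> Arr C \<and>
     (\<exists>N. is_zero_object C N \<and> (\<exists>a\<in>hom C (Dom C h) N. \<exists>b\<in>hom C N (Cod C h). h = b \<cdot>\<^bsub>C\<^esub> a))"

definition is_right_punctual :: "('o, 'a) cat \<Rightarrow> 'o \<Rightarrow> 'o \<Rightarrow> 'a \<times> 'a \<Rightarrow> bool" where
  "is_right_punctual C X Z W \<longleftrightarrow> is_relation C X Z W \<and>
     (\<exists>t\<in>hom C Z (Dom C (fst W)). snd W \<cdot>\<^bsub>C\<^esub> t = Id C Z \<and> is_zero_arrow C (fst W \<cdot>\<^bsub>C\<^esub> t))"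

definition axiom_star :: "('o, 'a) cat \<Rightarrow> bool" where
  "axiom_star C \<longleftrightarrow> pointed C \<and>
     (\<forall>X\<in>Obj C. \<forall>Z\<in>Obj C. \<forall>W. is_right_punctual C X Z W \<longrightarrow> is_difunctional C X Z W \<longrightarrow>
        (\<forall>R T \<zeta>. is_kernel_pair C (fst W) R \<longrightarrow> is_equivalence C (Dom C (fst W)) T \<longrightarrow>
           is_zeta C (Dom C (fst W)) R T \<zeta> \<longrightarrow> is_extremal_epi C \<zeta>))"


section \<open>Diagonal punctuations\<close>

text \<open>p0, p1 are the projections of a product of X with itself, s0 its diagonal, t the terminal
  map of X; the pushout of s0 along t is given by its coprojections w and n.\<close>

definition is_diagonal_punctuation ::
  "('o, 'a) cat \<Rightarrow> 'o \<Rightarrow> 'a \<Rightarrow> 'a \<Rightarrow> 'a \<Rightarrow> 'a \<Rightarrow> 'a \<Rightarrow> 'a \<Rightarrow> bool" where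
  "is_diagonal_punctuation C X p0 p1 s0 t w n \<longleftrightarrow>
     is_product C X X p0 p1 \<and>
     s0 \<in> hom C X (Dom C p0) \<and> p0 \<cdot>\<^bsub>C\<^esub> s0 = Id C X \<and> p1 \<cdot>\<^bsub>C\<^esub> s0 = Id C X \<and>
     is_terminal C (Cod C t) \<and> t \<in> hom C X (Cod C t) \<and>
     is_pushout C s0 t w n"

definition has_diagonal_punctuations :: "('o, 'a) cat \<Rightarrow> bool" where
  "has_diagonal_punctuations C \<longleftrightarrow>
     (\<forall>X\<in>Obj C. \<exists>p0 p1 s0 t w n. is_diagonal_punctuation C X p0 p1 s0 t w n)"


section \<open>The fibre of points above an object\<close>

text \<open>An object is a pair (f, s) with section s of f; an arrow is a triple (source, underlying
  arrow, target).\<close>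

definition Pt :: "('o, 'a) cat \<Rightarrow> 'o \<Rightarrow> ('a \<times> 'a, ('a \<times> 'a) \<times> 'a \<times> ('a \<times> 'a)) cat" where
  "Pt C Y =
     (let Ob = {(f, s). f \<in> hom C (Dom C f) Y \<and> s \<in> hom C Y (Dom C f) \<and> f \<cdot>\<^bsub>C\<^esub> s = Id C Y}
      in \<lparr> Obj = Ob,
           Arr = {(p, h, q). p \<in> Ob \<and> q \<in> Ob \<and> h \<in> hom C (Dom C (fst p)) (Dom C (fst q)) \<and>
                    fst q \<cdot>\<^bsub>C\<^esub> h = fst p \<and> h \<cdot>\<^bsub>C\<^esub> snd p = snd q},
           Dom = (\<lambda>(p, h, q). p),
           Cod = (\<lambda>(p, h, q). q),
           Id = (\<lambda>p. (p, Id C (Dom C (fst p)), p)),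
           Comp = (\<lambda>(q, g, r) (p, h, q'). (p, g \<cdot>\<^bsub>C\<^esub> h, r)) \<rparr>)"

lemma category_Pt:
  assumes "category C" and "Y \<in> Obj C"
  shows "category (Pt C Y)"
proof -
  have 1: "\<And>X Y Z f g. f \<in> hom C X Y \<Longrightarrow> g \<in> hom C Y Z \<Longrightarrow> g \<cdot>\<^bsub>C\<^esub> f \<in> hom C X Z"
    and 2: "\<And>X Y f. f \<in> hom C X Y \<Longrightarrow> f \<cdot>\<^bsub>C\<^esub> Id C X = f"
    and 3: "\<And>X Y f. f \<in> hom C X Y \<Longrightarrow> Id C Y \<cdot>\<^bsub>C\<^esub> f = f"
    and 4: "\<And>X Y Z W f g h. f \<in> hom C X Y \<Longrightarrow> g \<in> hom C Y Z \<Longrightarrow> h \<in> hom C Z W \<Longrightarrow>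
        h \<cdot>\<^bsub>C\<^esub> (g \<cdot>\<^bsub>C\<^esub> f) = (h \<cdot>\<^bsub>C\<^esub> g) \<cdot>\<^bsub>C\<^esub> f"
    and 5: "\<And>X. X \<in> Obj C \<Longrightarrow> Id C X \<in> hom C X X"
    and 6: "\<And>X Y f. f \<in> hom C X Y \<Longrightarrow> X \<in> Obj C"
    using assms(1) unfolding category_def by (blast, blast, blast, blast, blast, auto simp: hom_def)
  have 7: "Id C (Dom C f) \<in> hom C (Dom C f) (Dom C f)" if "f \<in> hom C (Dom C f) Y" for f
    using 5 6 that by blast
  show ?thesis
    unfolding category_def hom_def[of "Pt C Y"]
    by (auto simp: Pt_def Let_def 1 2 3 4[symmetric] 7) (auto simp: 4 1 2 3)
qed


section \<open>Abelian split epimorphisms\<close>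

text \<open>A generalized element (x, y) of R[f] is an arrow r into R[f] with components
  x and y obtained by composing r with the two projections.\<close>

definition is_abelian :: "('o, 'a) cat \<Rightarrow> 'o \<Rightarrow> 'a \<times> 'a \<Rightarrow> bool" where
  "is_abelian C Y = (\<lambda>(f, s). (f, s) \<in> Obj (Pt C Y) \<and>
     (\<exists>d0 d1 d. is_kernel_pair C f (d0, d1) \<and>
        d \<in> hom C (Dom C d0) (Dom C f) \<and> f \<cdot>\<^bsub>C\<^esub> d = f \<cdot>\<^bsub>C\<^esub> d0 \<and>
        (\<forall>U. \<forall>r\<in>hom C U (Dom C d0). \<forall>x. d0 \<cdot>\<^bsub>C\<^esub> r = x \<longrightarrow>
           (d1 \<cdot>\<^bsub>C\<^esub> r = x \<longrightarrow> d \<cdot>\<^bsub>C\<^esub> r = s \<cdot>\<^bsub>C\<^esub> f \<cdot>\<^bsub>C\<^esub> x) \<and>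
           (d1 \<cdot>\<^bsub>C\<^esub> r = s \<cdot>\<^bsub>C\<^esub> f \<cdot>\<^bsub>C\<^esub> x \<longrightarrow> d \<cdot>\<^bsub>C\<^esub> r = x))))"

definition is_universal_abelian :: "('o, 'a) cat \<Rightarrow> 'o \<Rightarrow> 'a \<times> 'a \<Rightarrow> 'a \<times> 'a \<Rightarrow> bool" where
  "is_universal_abelian C Y p q \<longleftrightarrow> is_abelian C Y q \<and>
     (\<exists>e\<in>hom (Pt C Y) p q. \<forall>q'. is_abelian C Y q' \<longrightarrow>
        (\<forall>h\<in>hom (Pt C Y) p q'. \<exists>!k. k \<in> hom (Pt C Y) q q' \<and> k \<cdot>\<^bsub>Pt C Y\<^esub> e = h))"

definition abelian_stable_under_monos :: "('o, 'a) cat \<Rightarrow> 'o \<Rightarrow> bool" where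
  "abelian_stable_under_monos C Y \<longleftrightarrow>
     (\<forall>p q. \<forall>m\<in>hom (Pt C Y) p q. is_mono (Pt C Y) m \<longrightarrow> is_abelian C Y q \<longrightarrow> is_abelian C Y p)"

text \<open>The diagonal punctuation of (f, s) in the fibre, presented in the base category:
  (f d0, s0 s) is the square of (f, s) in the fibre, (1, 1) is its terminal object, and f itself
  is the terminal map of (f, s). That psi is a retraction of theta with
  psi omega = f d0 is part of the first coprojection being an arrow of the fibre.\<close>

definition is_fibre_punctuation ::
  "('o, 'a) cat \<Rightarrow> 'o \<Rightarrow> 'a \<Rightarrow> 'a \<Rightarrow> 'a \<Rightarrow> 'a \<Rightarrow> 'a \<Rightarrow> 'a \<Rightarrow> 'a \<Rightarrow> bool" where
  "is_fibre_punctuation C Y f s d0 s0 \<omega> \<theta> \<psi> \<longleftrightarrow>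
     is_pushout (Pt C Y)
       ((f, s), s0, (f \<cdot>\<^bsub>C\<^esub> d0, s0 \<cdot>\<^bsub>C\<^esub> s))
       ((f, s), f, (Id C Y, Id C Y))
       ((f \<cdot>\<^bsub>C\<^esub> d0, s0 \<cdot>\<^bsub>C\<^esub> s), \<omega>, (\<psi>, \<theta>))
       ((Id C Y, Id C Y), \<theta>, (\<psi>, \<theta>))"

end

theory Submission
  imports Defs
begin

text \<open>
  Write (x, y) for the elements of R[f], 0 for sf(x), and e(x) = \<open>\<omega>\<close>(x, 0). Pushing out along f makes
  \<open>\<omega>\<close> an extremal epimorphism. Since R[f] is a square in the fibre, its two projections form a right
  punctual difunctional relation, and Axiom * for the kernel relation of \<open>\<omega>\<close> says that every
  \<open>\<omega>\<close>(x, y) is locally of the form e(u); so e is an extremal, hence regular, epimorphism. By the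
  Shifting Lemma \<open>\<omega>\<close>(x, y) only depends on e(x) and e(y), so \<open>\<omega>\<close> descends to a difference on Dp[f]
  with d(e(x), e(y)) = \<open>\<omega>\<close>(x, y). A morphism h into an abelian split epimorphism extends along e by
  sending \<open>\<omega>\<close>(x, y) to the difference of h(x) and h(y). If h is a monomorphism, so is e; then e is
  an isomorphism and the difference is transported back along it.
\<close>

section \<open>Categories with pullbacks\<close>

text \<open>Regularity and the Shifting Lemma live in the base, Axiom * and the pushout in the
  fibre, so the proof has to cross between the two. Two facts allow this. A base subobject of the
  target of a fibre arrow, through which that arrow factors, inherits a projection and a section;
  hence extremal epimorphisms of the fibre are extremal in the base. Pullbacks in the fibre are
  computed in the base; hence monomorphisms of the fibre are monomorphisms in the base. Axiom *
  speaks about a given \<open>\<zeta>\<close>, so the objects of triples and quadruples must first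
  be built in the fibre. What it yields is a statement about preimages, and these exist only after
  precomposition with a further extremal epimorphism. Regularity turns such local information into
  global arrows: image factorization makes every extremal epimorphism a coequalizer, along which
  maps descend. The Shifting Lemma is only used for kernel relations on an object of pairs such as
  R[f], with two of the three maps jointly monic, so that every application is a rectangle of
  pairs.\<close>

locale category_struct =
  fixes C :: "('o, 'a) cat" (structure)
  assumes category: "category C"
begin

lemma arr_obj [simp]: "f \<in> Arr C \<Longrightarrow> Dom C f \<in> Obj C" "f \<in> Arr C \<Longrightarrow> Cod C f \<in> Obj C"
  using category by (auto simp: category_def)

lemma hom_obj:
  assumes "f \<in> hom C X Y"
  shows "X \<in> Obj C" "Y \<in> Obj C"
  using assms arr_obj[of f] by (auto simp: hom_def)

lemma id_arr [simp]:
  assumes "X \<in> Obj C"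
  shows "Id C X \<in> Arr C" "Dom C (Id C X) = X" "Cod C (Id C X) = X"
  using category assms by (auto simp: category_def hom_def)

lemma comp_arr [simp]:
  assumes "f \<in> Arr C" "g \<in> Arr C" "Dom C g = Cod C f"
  shows "g \<cdot> f \<in> Arr C" "Dom C (g \<cdot> f) = Dom C f" "Cod C (g \<cdot> f) = Cod C g"
proof -
  have "g \<cdot> f \<in> hom C (Dom C f) (Cod C g)"
    using category assms unfolding category_def hom_def by blast
  then show "g \<cdot> f \<in> Arr C" "Dom C (g \<cdot> f) = Dom C f" "Cod C (g \<cdot> f) = Cod C g"
    by (auto simp: hom_def)
qed

lemma comp_id [simp]:
  assumes "f \<in> Arr C"
  shows "Dom C f = X \<Longrightarrow> f \<cdot> Id C X = f" "Cod C f = X \<Longrightarrow> Id C X \<cdot> f = f"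
  using category assms unfolding category_def hom_def by blast+

lemma comp_assoc [simp]:
  assumes "f \<in> Arr C" "g \<in> Arr C" "h \<in> Arr C" "Dom C g = Cod C f" "Dom C h = Cod C g"
  shows "(h \<cdot> g) \<cdot> f = h \<cdot> g \<cdot> f"
proof -
  have "f \<in> hom C (Dom C f) (Cod C f)" "g \<in> hom C (Cod C f) (Cod C g)" "h \<in> hom C (Cod C g) (Cod C h)"
    using assms by (auto simp: hom_def)
  moreover have "\<forall>X Y Z W f g h. f \<in> hom C X Y \<longrightarrow> g \<in> hom C Y Z \<longrightarrow> h \<in> hom C Z W \<longrightarrow>
      h \<cdot> (g \<cdot> f) = (h \<cdot> g) \<cdot> f"
    using category unfolding category_def by blast
  ultimately show ?thesis by metis
qed

text \<open>The simplifier nests compositions to the right, and an equation between composites of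
  two arrows then no longer matches inside a longer chain. This lemma and \<open>comp_extend\<close>
  supply the forms prolonged by \<open>u\<close>.\<close>

lemma comp_eq_extend:
  assumes "g \<cdot> f = k \<cdot> h" "u \<in> Arr C" "f \<in> Arr C" "g \<in> Arr C" "h \<in> Arr C" "k \<in> Arr C"
    "Dom C g = Cod C f" "Dom C k = Cod C h" "Cod C u = Dom C f" "Dom C h = Dom C f"
  shows "g \<cdot> f \<cdot> u = k \<cdot> h \<cdot> u"
  using assms by (metis comp_assoc)

lemma comp_extend:
  assumes "g \<cdot> f = k" "u \<in> Arr C" "f \<in> Arr C" "g \<in> Arr C"
    "Dom C g = Cod C f" "Cod C u = Dom C f"
  shows "g \<cdot> f \<cdot> u = k \<cdot> u"
  using assms by (metis comp_assoc)

section \<open>Pullbacks, products and kernel pairs through generalized elements\<close>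

lemma pullback_arr:
  assumes "is_pullback C f g p q"
  shows "f \<in> Arr C" "g \<in> Arr C" "p \<in> Arr C" "q \<in> Arr C" "Cod C g = Cod C f"
    "Cod C p = Dom C f" "Cod C q = Dom C g" "Dom C q = Dom C p" "f \<cdot> p = g \<cdot> q"
  using assms by (auto simp: is_pullback_def hom_def)

lemma pullback_lift:
  assumes "is_pullback C f g p q" "u \<in> hom C U (Dom C f)" "v \<in> hom C U (Dom C g)"
    "f \<cdot> u = g \<cdot> v"
  obtains h where "h \<in> hom C U (Dom C p)" "p \<cdot> h = u" "q \<cdot> h = v"
  using assms unfolding is_pullback_def by blast

lemma pullback_eqI:
  assumes "is_pullback C f g p q" "h \<in> hom C U (Dom C p)" "k \<in> hom C U (Dom C p)"
    "p \<cdot> h = p \<cdot> k" "q \<cdot> h = q \<cdot> k"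
  shows "h = k"
proof -
  note pb = pullback_arr[OF assms(1)]
  have "p \<cdot> k \<in> hom C U (Dom C f)" "q \<cdot> k \<in> hom C U (Dom C g)" "f \<cdot> p \<cdot> k = g \<cdot> q \<cdot> k"
    using assms(3) pb by (auto simp: hom_def intro: comp_eq_extend)
  then have "\<exists>!h. h \<in> hom C U (Dom C p) \<and> p \<cdot> h = p \<cdot> k \<and> q \<cdot> h = q \<cdot> k"
    using assms(1) unfolding is_pullback_def by blast
  then show ?thesis using assms by blast
qed

lemma pullback_over_terminal:
  assumes "is_pullback C f g p q" "is_terminal C (Cod C f)"
  shows "is_product C (Dom C f) (Dom C g) p q"
  unfolding is_product_def
proof (intro conjI allI ballI)
  note pb = pullback_arr[OF assms(1)]
  show "p \<in> hom C (Dom C p) (Dom C f)" "q \<in> hom C (Dom C p) (Dom C g)"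
    using pb by (auto simp: hom_def)
  fix U u v
  assume uv: "u \<in> hom C U (Dom C f)" "v \<in> hom C U (Dom C g)"
  then have "f \<cdot> u \<in> hom C U (Cod C f)" "g \<cdot> v \<in> hom C U (Cod C f)" "U \<in> Obj C"
    using pb by (auto simp: hom_def)
  then have "f \<cdot> u = g \<cdot> v"
    using assms(2) unfolding is_terminal_def by blast
  then show "\<exists>!h. h \<in> hom C U (Dom C p) \<and> p \<cdot> h = u \<and> q \<cdot> h = v"
    using uv assms(1) unfolding is_pullback_def by blast
qed

lemma product_arr:
  assumes "is_product C X Z p q"
  shows "p \<in> Arr C" "q \<in> Arr C" "Cod C p = X" "Cod C q = Z" "Dom C q = Dom C p"
  using assms by (auto simp: is_product_def hom_def)

lemma product_lift:
  assumes "is_product C X Z p q" "u \<in> hom C U X" "v \<in> hom C U Z"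
  obtains h where "h \<in> hom C U (Dom C p)" "p \<cdot> h = u" "q \<cdot> h = v"
  using assms unfolding is_product_def by blast

lemma product_eqI:
  assumes "is_product C X Z p q" "h \<in> hom C U (Dom C p)" "k \<in> hom C U (Dom C p)"
    "p \<cdot> h = p \<cdot> k" "q \<cdot> h = q \<cdot> k"
  shows "h = k"
proof -
  have "p \<cdot> k \<in> hom C U X" "q \<cdot> k \<in> hom C U Z"
    using assms(3) product_arr[OF assms(1)] by (auto simp: hom_def)
  then have "\<exists>!h. h \<in> hom C U (Dom C p) \<and> p \<cdot> h = p \<cdot> k \<and> q \<cdot> h = q \<cdot> k"
    using assms(1) unfolding is_product_def by blast
  then show ?thesis using assms by blast
qed

lemma product_swap:
  assumes "is_product C X Z p q"
  shows "is_product C Z X q p"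
proof -
  have "Dom C q = Dom C p" using product_arr[OF assms] by simp
  moreover have "p \<cdot> h = v \<and> q \<cdot> h = u \<longleftrightarrow> q \<cdot> h = u \<and> p \<cdot> h = v" for h u v by blast
  ultimately show ?thesis using assms unfolding is_product_def by simp
qed

lemma product_relation:
  assumes "is_product C X Z p q"
  shows "is_relation C X Z (p, q)"
  using product_arr[OF assms] product_eqI[OF assms] unfolding is_relation_def
  by (auto simp: hom_def)

lemma kernel_pair_arr:
  assumes "is_kernel_pair C f R"
  shows "f \<in> Arr C" "fst R \<in> Arr C" "snd R \<in> Arr C" "Cod C (fst R) = Dom C f"
    "Cod C (snd R) = Dom C f" "Dom C (snd R) = Dom C (fst R)" "f \<cdot> fst R = f \<cdot> snd R"
  using assms by (auto simp: is_kernel_pair_def is_pullback_def hom_def)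

text \<open>Replaces the internal relation by an equation; kernel relations are handled in this form
  from here on.\<close>

lemma kernel_pair_related:
  assumes "is_kernel_pair C f R" "x \<in> hom C U (Dom C f)" "y \<in> hom C U (Dom C f)"
  shows "related C R x y \<longleftrightarrow> f \<cdot> x = f \<cdot> y"
proof
  have pb: "is_pullback C f f (fst R) (snd R)"
    using assms(1) by (simp add: is_kernel_pair_def)
  note a = kernel_pair_arr[OF assms(1)]
  show "f \<cdot> x = f \<cdot> y" if r: "related C R x y"
  proof -
    obtain h where h: "h \<in> Arr C" "Cod C h = Dom C (fst R)" "fst R \<cdot> h = x" "snd R \<cdot> h = y"
      using r unfolding related_def by blast
    have "f \<cdot> fst R \<cdot> h = f \<cdot> snd R \<cdot> h"
      by (rule comp_eq_extend[OF a(7)]) (simp_all add: a h)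
    then show ?thesis using h by simp
  qed
  show "related C R x y" if e: "f \<cdot> x = f \<cdot> y"
  proof -
    obtain h where "h \<in> hom C U (Dom C (fst R))" "fst R \<cdot> h = x" "snd R \<cdot> h = y"
      using pullback_lift[OF pb assms(2,3) e] .
    then show ?thesis unfolding related_def hom_def by auto
  qed
qed

lemma kernel_pair_equivalence:
  assumes "is_kernel_pair C f R"
  shows "is_equivalence C (Dom C f) R"
proof -
  have pb: "is_pullback C f f (fst R) (snd R)"
    using assms(1) by (simp add: is_kernel_pair_def)
  have "is_relation C (Dom C f) (Dom C f) R"
    using kernel_pair_arr[OF assms] pullback_eqI[OF pb] unfolding is_relation_def
    by (auto simp: hom_def)
  moreover have "{(x, y). x \<in> hom C U (Dom C f) \<and> y \<in> hom C U (Dom C f) \<and> related C R x y} =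
      {(x, y). x \<in> hom C U (Dom C f) \<and> y \<in> hom C U (Dom C f) \<and> f \<cdot> x = f \<cdot> y}" for U
    using kernel_pair_related[OF assms] by auto
  moreover have "equiv (hom C U (Dom C f))
      {(x, y). x \<in> hom C U (Dom C f) \<and> y \<in> hom C U (Dom C f) \<and> f \<cdot> x = f \<cdot> y}" for U
    by (rule equivI) (auto simp: refl_on_def sym_def trans_def)
  ultimately show ?thesis
    unfolding is_equivalence_def by simp
qed

section \<open>Uniqueness of products and terminal objects, and transport of pushouts\<close>

lemma product_unique:
  assumes pq: "is_product C X Z p q" and pq': "is_product C X Z p' q'"
  obtains i j where "i \<in> hom C (Dom C p) (Dom C p')" "j \<in> hom C (Dom C p') (Dom C p)"
    "i \<cdot> j = Id C (Dom C p')" "j \<cdot> i = Id C (Dom C p)" "p \<cdot> j = p'" "q \<cdot> j = q'"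
proof -
  note a = product_arr[OF pq] and a' = product_arr[OF pq']
  have h: "p \<in> hom C (Dom C p) X" "q \<in> hom C (Dom C p) Z" "p' \<in> hom C (Dom C p') X" "q' \<in> hom C (Dom C p') Z"
    by (simp_all add: hom_def a a')
  obtain i where i: "i \<in> hom C (Dom C p) (Dom C p')" "p' \<cdot> i = p" "q' \<cdot> i = q"
    by (rule product_lift[OF pq' h(1,2)])
  obtain j where j: "j \<in> hom C (Dom C p') (Dom C p)" "p \<cdot> j = p'" "q \<cdot> j = q'"
    by (rule product_lift[OF pq h(3,4)])
  have ar: "i \<in> Arr C" "j \<in> Arr C" "Dom C i = Dom C p" "Cod C i = Dom C p'" "Dom C j = Dom C p'"
    "Cod C j = Dom C p"
    using i j by (simp_all add: hom_def)
  have "i \<cdot> j = Id C (Dom C p')"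
    by (rule product_eqI[OF pq'])
      (simp_all add: hom_def ar a a' comp_extend[OF i(2)] comp_extend[OF i(3)] j)
  moreover have "j \<cdot> i = Id C (Dom C p)"
    by (rule product_eqI[OF pq])
      (simp_all add: hom_def ar a a' comp_extend[OF j(2)] comp_extend[OF j(3)] i)
  ultimately show thesis using that i j by blast
qed

lemma terminal_unique:
  assumes N: "is_terminal C N" and N': "is_terminal C N'"
  obtains i j where "i \<in> hom C N N'" "j \<in> hom C N' N" "i \<cdot> j = Id C N'" "j \<cdot> i = Id C N"
proof -
  have o: "N \<in> Obj C" "N' \<in> Obj C" using assms by (simp_all add: is_terminal_def)
  obtain i j where i: "i \<in> hom C N N'" and j: "j \<in> hom C N' N"
    using assms o unfolding is_terminal_def by blast
  have "i \<cdot> j \<in> hom C N' N'" "Id C N' \<in> hom C N' N'" "j \<cdot> i \<in> hom C N N" "Id C N \<in> hom C N N"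
    using i j o by (simp_all add: hom_def)
  then have "i \<cdot> j = Id C N'" "j \<cdot> i = Id C N"
    using assms o unfolding is_terminal_def by blast+
  then show thesis using that i j by blast
qed

lemma pushout_arr:
  assumes "is_pushout C f g p q"
  shows "f \<in> Arr C" "g \<in> Arr C" "p \<in> Arr C" "q \<in> Arr C" "Dom C g = Dom C f"
    "Dom C p = Cod C f" "Dom C q = Cod C g" "Cod C q = Cod C p" "p \<cdot> f = q \<cdot> g"
  using assms by (auto simp: is_pushout_def hom_def)

lemma pushout_extend:
  assumes "is_pushout C f g p q" "u \<in> hom C (Cod C f) U" "v \<in> hom C (Cod C g) U"
    "u \<cdot> f = v \<cdot> g"
  obtains h where "h \<in> hom C (Cod C p) U" "h \<cdot> p = u" "h \<cdot> q = v"
  using assms unfolding is_pushout_def by blast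

lemma pushout_eqI:
  assumes "is_pushout C f g p q" "h \<in> hom C (Cod C p) U" "k \<in> hom C (Cod C p) U"
    "h \<cdot> p = k \<cdot> p" "h \<cdot> q = k \<cdot> q"
  shows "h = k"
proof -
  note po = pushout_arr[OF assms(1)]
  have "(k \<cdot> p) \<cdot> f = (k \<cdot> q) \<cdot> g"
    using po assms(3) by (auto simp: hom_def)
  moreover have "k \<cdot> p \<in> hom C (Cod C f) U" "k \<cdot> q \<in> hom C (Cod C g) U"
    using assms(3) po by (auto simp: hom_def)
  ultimately have "\<exists>!h. h \<in> hom C (Cod C p) U \<and> h \<cdot> p = k \<cdot> p \<and> h \<cdot> q = k \<cdot> q"
    using assms(1) unfolding is_pushout_def by blast
  then show ?thesis using assms by blast
qed

text \<open>Composition with the isomorphisms \<open>i\<close> and \<open>j\<close> is a bijection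
  between the cocones on the two spans. This later exchanges an arbitrary product and terminal
  object for the standard ones of the fibre.\<close>

lemma pushout_transport:
  assumes po: "is_pushout C f g p q"
    and i: "i \<in> hom C A (Cod C f)" "i' \<in> hom C (Cod C f) A" "i \<cdot> i' = Id C (Cod C f)" "i' \<cdot> i = Id C A"
    and j: "j \<in> hom C B (Cod C g)" "j' \<in> hom C (Cod C g) B" "j \<cdot> j' = Id C (Cod C g)" "j' \<cdot> j = Id C B"
  shows "is_pushout C (i' \<cdot> f) (j' \<cdot> g) (p \<cdot> i) (q \<cdot> j)"
proof -
  note a = pushout_arr[OF po]
  have e: "i \<cdot> i' \<cdot> f = f" "j \<cdot> j' \<cdot> g = g"
    using comp_extend[OF i(3), of f] comp_extend[OF j(3), of g] i j a by (auto simp: hom_def)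
  have u: "\<exists>!h. h \<in> hom C (Cod C p) U \<and> h \<cdot> p \<cdot> i = u \<and> h \<cdot> q \<cdot> j = v"
    if uv: "u \<in> hom C A U" "v \<in> hom C B U" "u \<cdot> i' \<cdot> f = v \<cdot> j' \<cdot> g" for U u v
  proof -
    have "(u \<cdot> i') \<cdot> f = (v \<cdot> j') \<cdot> g" using uv i j a by (auto simp: hom_def)
    moreover have "u \<cdot> i' \<in> hom C (Cod C f) U" "v \<cdot> j' \<in> hom C (Cod C g) U"
      using uv i j by (auto simp: hom_def)
    ultimately have ex: "\<exists>!h. h \<in> hom C (Cod C p) U \<and> h \<cdot> p = u \<cdot> i' \<and> h \<cdot> q = v \<cdot> j'"
      using po unfolding is_pushout_def by blast
    have "h \<cdot> p = u \<cdot> i' \<longleftrightarrow> h \<cdot> p \<cdot> i = u" if h: "h \<in> hom C (Cod C p) U" for h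
    proof
      assume "h \<cdot> p = u \<cdot> i'"
      then have "(h \<cdot> p) \<cdot> i = (u \<cdot> i') \<cdot> i" by simp
      then show "h \<cdot> p \<cdot> i = u" using h uv i a by (auto simp: hom_def)
    next
      assume "h \<cdot> p \<cdot> i = u"
      then have "(h \<cdot> p \<cdot> i) \<cdot> i' = u \<cdot> i'" by simp
      then show "h \<cdot> p = u \<cdot> i'" using h uv i a by (auto simp: hom_def)
    qed
    moreover have "h \<cdot> q = v \<cdot> j' \<longleftrightarrow> h \<cdot> q \<cdot> j = v" if h: "h \<in> hom C (Cod C p) U" for h
    proof
      assume "h \<cdot> q = v \<cdot> j'"
      then have "(h \<cdot> q) \<cdot> j = (v \<cdot> j') \<cdot> j" by simp
      then show "h \<cdot> q \<cdot> j = v" using h uv j a by (auto simp: hom_def)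
    next
      assume "h \<cdot> q \<cdot> j = v"
      then have "(h \<cdot> q \<cdot> j) \<cdot> j' = v \<cdot> j'" by simp
      then show "h \<cdot> q = v \<cdot> j'" using h uv j a by (auto simp: hom_def)
    qed
    ultimately show ?thesis using ex by (metis (no_types, lifting))
  qed
  show ?thesis
    unfolding is_pushout_def using a i j e u by (auto simp: hom_def)
qed

end

text \<open>Interpreted both in the base and in each fibre \<open>Pt C Y\<close>, so that kernel
  pairs and squares are constructed once for both.\<close>

locale pullback_category = category_struct +
  assumes pullbacks: "f \<in> Arr C \<Longrightarrow> g \<in> Arr C \<Longrightarrow> Cod C f = Cod C g \<Longrightarrow> \<exists>p q. is_pullback C f g p q"
begin

lemma kernel_pairs:
  assumes "f \<in> Arr C"
  obtains R where "is_kernel_pair C f R"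
  using pullbacks[OF assms assms] unfolding is_kernel_pair_def by auto

lemma terminal_products:
  assumes "is_terminal C N" "X \<in> Obj C" "Z \<in> Obj C"
  obtains p q where "is_product C X Z p q"
proof -
  obtain f g where "f \<in> hom C X N" "g \<in> hom C Z N"
    using assms unfolding is_terminal_def by blast
  then show ?thesis
    using pullbacks[of f g] pullback_over_terminal[of f g] assms(1) that by (auto simp: hom_def)
qed

text \<open>A triple is a pair (x, y) in R together with some z satisfying b y = b z, hence an
  element of the pullback of \<open>b \<cdot> snd R\<close> along \<open>b\<close>.\<close>

lemma kernel_triple_object:
  assumes R: "is_kernel_pair C a R" and T: "is_kernel_pair C b T"
    and W: "Dom C a = W" "Dom C b = W"
  obtains P x y z where "is_triple_object C W R T P x y z"
proof -
  have pR: "is_pullback C a a (fst R) (snd R)" and pT: "is_pullback C b b (fst T) (snd T)"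
    using R T by (simp_all add: is_kernel_pair_def)
  note aR = kernel_pair_arr[OF R] and aT = kernel_pair_arr[OF T]
  obtain p z where pb: "is_pullback C (b \<cdot> snd R) b p z"
    using pullbacks[of "b \<cdot> snd R" b] aR aT W by auto
  note aP = pullback_arr[OF pb]
  have "is_triple_object C W R T (Dom C p) (fst R \<cdot> p) (snd R \<cdot> p) z"
    unfolding is_triple_object_def
  proof (intro conjI allI ballI impI)
    show h: "fst R \<cdot> p \<in> hom C (Dom C p) W" "snd R \<cdot> p \<in> hom C (Dom C p) W" "z \<in> hom C (Dom C p) W"
      by (auto simp: hom_def aR aT aP W)
    show "related C R (fst R \<cdot> p) (snd R \<cdot> p)"
      unfolding related_def by (rule bexI[of _ p]) (auto simp: aR aT aP W)
    show "related C T (snd R \<cdot> p) z"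
      using kernel_pair_related[OF T, unfolded W(2), OF h(2,3)] aP(9) by (simp add: aR(1-6) aP(1-8) W)
    fix U x y z'
    assume e: "x \<in> hom C U W" "y \<in> hom C U W" "z' \<in> hom C U W" "related C R x y \<and> related C T y z'"
    then have e': "a \<cdot> x = a \<cdot> y" "b \<cdot> y = b \<cdot> z'"
      using kernel_pair_related[OF R] kernel_pair_related[OF T] W by auto
    obtain r where r: "r \<in> hom C U (Dom C (fst R))" "fst R \<cdot> r = x" "snd R \<cdot> r = y"
      using pullback_lift[OF pR _ _ e'(1)] e W by metis
    have r': "r \<in> hom C U (Dom C (b \<cdot> snd R))" "(b \<cdot> snd R) \<cdot> r = b \<cdot> z'"
      using r e' by (auto simp: hom_def aR aT W)
    obtain h where h: "h \<in> hom C U (Dom C p)" "p \<cdot> h = r" "z \<cdot> h = z'"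
      using pullback_lift[OF pb r'(1) _ r'(2)] e W by metis
    have u: "k = h" if k: "k \<in> hom C U (Dom C p)" "(fst R \<cdot> p) \<cdot> k = x" "(snd R \<cdot> p) \<cdot> k = y" "z \<cdot> k = z'" for k
    proof (rule pullback_eqI[OF pb k(1) h(1)])
      show "p \<cdot> k = p \<cdot> h"
        by (rule pullback_eqI[OF pR, of _ U]) (use k h r in \<open>auto simp: hom_def aR aT aP W\<close>)
    qed (use k h in simp)
    have "(fst R \<cdot> p) \<cdot> h = x" "(snd R \<cdot> p) \<cdot> h = y"
      using h r by (auto simp: hom_def aR(1-6) aT(1-6) aP(1-8) W)
    then show "\<exists>!h. h \<in> hom C U (Dom C p) \<and> (fst R \<cdot> p) \<cdot> h = x \<and> (snd R \<cdot> p) \<cdot> h = y \<and> z \<cdot> h = z'"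
      using u h by blast
  qed
  then show thesis by (rule that)
qed

text \<open>For a given triple, the missing corner t is subject to b t = b x and a t = a z. With the
  product of the codomains these become the single equation u t = v (x, y, z), where u = (b, a) and
  v = (b x, a z); the pullback of u and v is the object of quadruples, and its second projection is
  the desired \<open>\<zeta>\<close>.\<close>

lemma kernel_zeta:
  assumes R: "is_kernel_pair C a R" and T: "is_kernel_pair C b T"
    and W: "Dom C a = W" "Dom C b = W"
    and P: "is_triple_object C W R T P x y z"
    and prod: "is_product C (Cod C b) (Cod C a) p q"
  obtains Q t \<zeta> where "is_square_object C W R T Q (x \<cdot> \<zeta>) (y \<cdot> \<zeta>) t (z \<cdot> \<zeta>)" "\<zeta> \<in> hom C Q P"
proof -
  have pR: "is_pullback C a a (fst R) (snd R)" and pT: "is_pullback C b b (fst T) (snd T)"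
    using R T by (simp_all add: is_kernel_pair_def)
  note aR = kernel_pair_arr[OF R] and aT = kernel_pair_arr[OF T]
  note ap = product_arr[OF prod]
  note rel = kernel_pair_related[OF R, unfolded W(1)] kernel_pair_related[OF T, unfolded W(2)]
  have xyz: "x \<in> hom C P W" "y \<in> hom C P W" "z \<in> hom C P W" "a \<cdot> x = a \<cdot> y" "b \<cdot> y = b \<cdot> z"
    using P rel unfolding is_triple_object_def by blast+
  have h: "b \<in> hom C W (Cod C b)" "a \<in> hom C W (Cod C a)" "b \<cdot> x \<in> hom C P (Cod C b)" "a \<cdot> z \<in> hom C P (Cod C a)"
    using xyz(1-3) by (simp_all add: hom_def aR(1-6) aT(1-6) W)
  obtain u where u: "u \<in> hom C W (Dom C p)" "p \<cdot> u = b" "q \<cdot> u = a"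
    by (rule product_lift[OF prod h(1,2)])
  obtain v where v: "v \<in> hom C P (Dom C p)" "p \<cdot> v = b \<cdot> x" "q \<cdot> v = a \<cdot> z"
    by (rule product_lift[OF prod h(3,4)])
  obtain t \<zeta> where pb: "is_pullback C u v t \<zeta>"
    using pullbacks[of u v] u v unfolding hom_def by auto
  note aQ = pullback_arr[OF pb]
  have uv_iff: "u \<cdot> t' = v \<cdot> h \<longleftrightarrow> b \<cdot> t' = b \<cdot> x \<cdot> h \<and> a \<cdot> t' = a \<cdot> z \<cdot> h"
    if "t' \<in> hom C U W" "h \<in> hom C U P" for t' h U
  proof -
    have "p \<cdot> u \<cdot> t' = b \<cdot> t'" "q \<cdot> u \<cdot> t' = a \<cdot> t'" "p \<cdot> v \<cdot> h = b \<cdot> x \<cdot> h" "q \<cdot> v \<cdot> h = a \<cdot> z \<cdot> h"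
      using that u v h xyz(1-3) comp_extend[of p u b t'] comp_extend[of q u a t'] comp_extend[of p v "b \<cdot> x" h] comp_extend[of q v "a \<cdot> z" h] by (simp_all add: hom_def ap)
    moreover have "u \<cdot> t' \<in> hom C U (Dom C p)" "v \<cdot> h \<in> hom C U (Dom C p)"
      using that u v by (simp_all add: hom_def)
    ultimately show ?thesis using product_eqI[OF prod, of "u \<cdot> t'" U "v \<cdot> h"] by metis
  qed
  let ?Q = "Dom C t"
  have t\<zeta>: "t \<in> hom C ?Q W" "\<zeta> \<in> hom C ?Q P" using u v by (simp_all add: hom_def aQ(1-8))
  have E: "b \<cdot> t = b \<cdot> x \<cdot> \<zeta>" "a \<cdot> t = a \<cdot> z \<cdot> \<zeta>" using uv_iff[OF t\<zeta>] aQ by auto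
  have ext: "a \<cdot> x \<cdot> k = a \<cdot> y \<cdot> k" "b \<cdot> y \<cdot> k = b \<cdot> z \<cdot> k" if "k \<in> hom C U P" for k U
    using comp_eq_extend[OF xyz(4)] comp_eq_extend[OF xyz(5)] that xyz(1-3) by (simp_all add: hom_def aR(1-6) aT(1-6) W)
  have c: "x \<cdot> \<zeta> \<in> hom C ?Q W" "y \<cdot> \<zeta> \<in> hom C ?Q W" "z \<cdot> \<zeta> \<in> hom C ?Q W"
    using xyz(1-3) t\<zeta> by (simp_all add: hom_def)
  have "is_square_object C W R T ?Q (x \<cdot> \<zeta>) (y \<cdot> \<zeta>) t (z \<cdot> \<zeta>)"
    unfolding is_square_object_def
  proof (intro conjI allI ballI impI)
    show "related C R (x \<cdot> \<zeta>) (y \<cdot> \<zeta>)" "related C T (y \<cdot> \<zeta>) (z \<cdot> \<zeta>)"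
      "related C R t (z \<cdot> \<zeta>)" "related C T (x \<cdot> \<zeta>) t"
      using rel c t\<zeta> ext[OF t\<zeta>(2)] E by metis+
    fix U x' y' t' z'
    assume e: "x' \<in> hom C U W" "y' \<in> hom C U W" "t' \<in> hom C U W" "z' \<in> hom C U W"
      "related C R x' y' \<and> related C R t' z' \<and> related C T x' t' \<and> related C T y' z'"
    then have e': "a \<cdot> t' = a \<cdot> z'" "b \<cdot> x' = b \<cdot> t'"
      using rel by blast+
    have ex: "\<exists>!h. h \<in> hom C U P \<and> x \<cdot> h = x' \<and> y \<cdot> h = y' \<and> z \<cdot> h = z'"
      using P e unfolding is_triple_object_def by blast
    then obtain h where h: "h \<in> hom C U P" "x \<cdot> h = x'" "y \<cdot> h = y'" "z \<cdot> h = z'" by blast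
    have "u \<cdot> t' = v \<cdot> h" using uv_iff[OF e(3) h(1)] e' h by simp
    moreover have "t' \<in> hom C U (Dom C u)" "h \<in> hom C U (Dom C v)"
      using e(3) h(1) u(1) v(1) by (simp_all add: hom_def)
    ultimately obtain k where k: "k \<in> hom C U ?Q" "t \<cdot> k = t'" "\<zeta> \<cdot> k = h"
      using pullback_lift[OF pb] by blast
    have u: "l = k" if l: "l \<in> hom C U ?Q" "(x \<cdot> \<zeta>) \<cdot> l = x'" "(y \<cdot> \<zeta>) \<cdot> l = y'" "(z \<cdot> \<zeta>) \<cdot> l = z'" "t \<cdot> l = t'" for l
    proof (rule pullback_eqI[OF pb l(1) k(1)])
      have "\<zeta> \<cdot> l \<in> hom C U P" "x \<cdot> \<zeta> \<cdot> l = x'" "y \<cdot> \<zeta> \<cdot> l = y'" "z \<cdot> \<zeta> \<cdot> l = z'"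
        using l t\<zeta> xyz(1-3) by (simp_all add: hom_def)
      then show "\<zeta> \<cdot> l = \<zeta> \<cdot> k" using ex h k by blast
    qed (use l k in simp)
    have "(x \<cdot> \<zeta>) \<cdot> k = x'" "(y \<cdot> \<zeta>) \<cdot> k = y'" "(z \<cdot> \<zeta>) \<cdot> k = z'"
      using k h t\<zeta> xyz(1-3) by (simp_all add: hom_def)
    then show "\<exists>!h. h \<in> hom C U ?Q \<and> (x \<cdot> \<zeta>) \<cdot> h = x' \<and> (y \<cdot> \<zeta>) \<cdot> h = y' \<and> t \<cdot> h = t' \<and> (z \<cdot> \<zeta>) \<cdot> h = z'"
      using u k by blast
  qed (use c t\<zeta> in auto)
  then show thesis using that t\<zeta> by blast
qed

text \<open>In a product the fourth corner of a rectangle is forced, t = (p z, q x). The object of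
  triples therefore also represents the quadruples, and the identity serves as
  \<open>\<zeta>\<close>.\<close>

lemma product_difunctional:
  assumes prod: "is_product C X Z p q"
  shows "is_difunctional C X Z (p, q)"
proof -
  let ?W = "Dom C p"
  note ap = product_arr[OF prod]
  obtain R where R: "is_kernel_pair C p R" using kernel_pairs ap by blast
  obtain S where S: "is_kernel_pair C q S" using kernel_pairs ap by blast
  note rel = kernel_pair_related[OF R] kernel_pair_related[OF S, unfolded ap(5)]
  obtain P x y z where P: "is_triple_object C ?W R S P x y z"
    using kernel_triple_object[OF R S] ap by blast
  have xyz: "x \<in> hom C P ?W" "y \<in> hom C P ?W" "z \<in> hom C P ?W" "p \<cdot> x = p \<cdot> y" "q \<cdot> y = q \<cdot> z"
    using P rel unfolding is_triple_object_def by blast+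
  have "p \<cdot> z \<in> hom C P X" "q \<cdot> x \<in> hom C P Z" using xyz(1-3) by (simp_all add: hom_def ap)
  then obtain t where t: "t \<in> hom C P ?W" "p \<cdot> t = p \<cdot> z" "q \<cdot> t = q \<cdot> x"
    by (rule product_lift[OF prod])
  have sq: "is_square_object C ?W R S P x y t z"
    unfolding is_square_object_def
  proof (intro conjI allI ballI impI)
    show "related C R x y" "related C S y z" "related C R t z" "related C S x t"
      using rel xyz t by metis+
    fix U x' y' t' z'
    assume e: "x' \<in> hom C U ?W" "y' \<in> hom C U ?W" "t' \<in> hom C U ?W" "z' \<in> hom C U ?W"
      "related C R x' y' \<and> related C R t' z' \<and> related C S x' t' \<and> related C S y' z'"
    have ex: "\<exists>!h. h \<in> hom C U P \<and> x \<cdot> h = x' \<and> y \<cdot> h = y' \<and> z \<cdot> h = z'"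
      using P e unfolding is_triple_object_def by blast
    have "t \<cdot> h = t'" if h: "h \<in> hom C U P" "x \<cdot> h = x'" "z \<cdot> h = z'" for h
    proof (rule product_eqI[OF prod _ e(3)])
      show "t \<cdot> h \<in> hom C U ?W" using t h by (simp_all add: hom_def)
      have "p \<cdot> t \<cdot> h = p \<cdot> z \<cdot> h" "q \<cdot> t \<cdot> h = q \<cdot> x \<cdot> h"
        by (rule comp_eq_extend[OF t(2)] comp_eq_extend[OF t(3)];
            use t(1) h(1) xyz(1-3) in \<open>simp add: hom_def ap\<close>)+
      then show "p \<cdot> t \<cdot> h = p \<cdot> t'" "q \<cdot> t \<cdot> h = q \<cdot> t'" using h e rel by metis+
    qed
    then show "\<exists>!h. h \<in> hom C U P \<and> x \<cdot> h = x' \<and> y \<cdot> h = y' \<and> t \<cdot> h = t' \<and> z \<cdot> h = z'"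
      using ex by blast
  qed (use xyz t in auto)
  have PO: "P \<in> Obj C" using hom_obj xyz(1) by blast
  have "is_zeta C ?W R S (Id C P)"
    unfolding is_zeta_def
    by (rule exI[of _ P], rule exI[of _ x], rule exI[of _ y], rule exI[of _ t], rule exI[of _ z],
        rule exI[of _ P], rule exI[of _ x], rule exI[of _ y], rule exI[of _ z])
      (use sq P PO xyz(1-3) in \<open>simp_all add: hom_def\<close>)
  moreover have "is_iso C (Id C P)"
    unfolding is_iso_def using PO by (auto simp: hom_def intro!: bexI[of _ "Id C P"])
  moreover have "related C R x y \<and> related C S x y \<longleftrightarrow> x = y" if "x \<in> hom C U ?W" "y \<in> hom C U ?W" for U x y
    using that rel product_eqI[OF prod that] by metis
  ultimately show ?thesis
    unfolding is_difunctional_def fst_conv snd_conv using R S product_relation[OF prod] by blast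
qed

end


section \<open>Regular categories and the Shifting Lemma\<close>

text \<open>Extremality alone: in the presence of equalizers such an arrow is automatically epic.\<close>

definition is_cover :: "('o, 'a) cat \<Rightarrow> 'a \<Rightarrow> bool" where
  "is_cover C e \<longleftrightarrow> e \<in> Arr C \<and>
     (\<forall>m g. is_mono C m \<longrightarrow> g \<in> hom C (Dom C e) (Dom C m) \<longrightarrow> m \<cdot>\<^bsub>C\<^esub> g = e \<longrightarrow> is_iso C m)"

section \<open>Monomorphisms, isomorphisms and covers\<close>

context pullback_category
begin

lemma monoD:
  assumes "is_mono C m" "u \<in> hom C U (Dom C m)" "v \<in> hom C U (Dom C m)" "m \<cdot> u = m \<cdot> v"
  shows "u = v"
  using assms unfolding is_mono_def by blast

lemma isoE:
  assumes "is_iso C f"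
  obtains g where "f \<in> Arr C" "g \<in> Arr C" "Dom C g = Cod C f" "Cod C g = Dom C f"
    "g \<cdot> f = Id C (Dom C f)" "f \<cdot> g = Id C (Cod C f)"
  using assms unfolding is_iso_def hom_def by auto

lemma isoI:
  assumes "f \<in> Arr C" "g \<in> Arr C" "Dom C g = Cod C f" "Cod C g = Dom C f"
    "g \<cdot> f = Id C (Dom C f)" "f \<cdot> g = Id C (Cod C f)"
  shows "is_iso C f"
  using assms unfolding is_iso_def hom_def by (auto intro!: bexI[of _ g])

lemma split_mono_iso:
  assumes "is_mono C m" "g \<in> Arr C" "Dom C g = Cod C m" "Cod C g = Dom C m" "m \<cdot> g = Id C (Cod C m)"
  shows "is_iso C m"
proof (rule isoI[OF _ assms(2-4) _ assms(5)])
  show m: "m \<in> Arr C" using assms(1) by (simp add: is_mono_def)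
  show "g \<cdot> m = Id C (Dom C m)"
  proof (rule monoD[OF assms(1)])
    have "m \<cdot> g \<cdot> m = (m \<cdot> g) \<cdot> m" using m assms(2-4) by simp
    then show "m \<cdot> g \<cdot> m = m \<cdot> Id C (Dom C m)" using m assms(5) by simp
  qed (use m assms(2-4) in \<open>simp_all add: hom_def\<close>)
qed

lemma coequalizer_arr:
  assumes "is_coequalizer C u v q"
  shows "u \<in> Arr C" "v \<in> Arr C" "q \<in> Arr C" "Dom C v = Dom C u" "Cod C v = Cod C u"
    "Dom C q = Cod C u" "q \<cdot> u = q \<cdot> v"
  using assms by (auto simp: is_coequalizer_def hom_def)

lemma coequalizer_extend:
  assumes "is_coequalizer C u v q" "w \<in> hom C (Cod C u) Z" "w \<cdot> u = w \<cdot> v"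
  obtains h where "h \<in> hom C (Cod C q) Z" "h \<cdot> q = w"
  using assms unfolding is_coequalizer_def by blast

lemma coequalizer_eqI:
  assumes "is_coequalizer C u v q" "h \<in> hom C (Cod C q) Z" "k \<in> hom C (Cod C q) Z" "h \<cdot> q = k \<cdot> q"
  shows "h = k"
proof -
  note a = coequalizer_arr[OF assms(1)]
  have "k \<cdot> q \<in> hom C (Cod C u) Z" "(k \<cdot> q) \<cdot> u = (k \<cdot> q) \<cdot> v"
    using assms(3) by (simp_all add: hom_def a)
  then have "\<exists>!h. h \<in> hom C (Cod C q) Z \<and> h \<cdot> q = k \<cdot> q"
    using assms(1) unfolding is_coequalizer_def by blast
  then show ?thesis using assms by blast
qed

lemma regular_epi_cancel:
  assumes "is_regular_epi C q" "h \<in> hom C (Cod C q) Z" "k \<in> hom C (Cod C q) Z" "h \<cdot> q = k \<cdot> q"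
  shows "h = k"
  using assms coequalizer_eqI unfolding is_regular_epi_def by blast

text \<open>If q = m g with m monic, then g identifies the pair that q coequalizes, so g descends
  along q to a section of m.\<close>

lemma regular_epi_cover:
  assumes "is_regular_epi C q"
  shows "is_cover C q"
  unfolding is_cover_def
proof (intro conjI allI impI)
  obtain u v where co: "is_coequalizer C u v q"
    using assms unfolding is_regular_epi_def by blast
  note a = coequalizer_arr[OF co]
  show "q \<in> Arr C" by (rule a)
  fix m g
  assume m: "is_mono C m" and g: "g \<in> hom C (Dom C q) (Dom C m)" and e: "m \<cdot> g = q"
  have am: "m \<in> Arr C" "g \<in> Arr C" "Dom C g = Cod C u" "Cod C g = Dom C m"
    using m g by (simp_all add: is_mono_def hom_def a)
  have cq: "Cod C q = Cod C m" using am by (simp flip: e)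
  have "g \<cdot> u = g \<cdot> v"
  proof (rule monoD[OF m])
    show "m \<cdot> g \<cdot> u = m \<cdot> g \<cdot> v"
      using a(7) am by (simp add: a(1-6) flip: e)
  qed (use am in \<open>simp_all add: hom_def a\<close>)
  moreover have "g \<in> hom C (Cod C u) (Dom C m)" using am by (simp add: hom_def)
  ultimately obtain h where h: "h \<in> hom C (Cod C q) (Dom C m)" "h \<cdot> q = g"
    using coequalizer_extend[OF co] by blast
  have "m \<cdot> h = Id C (Cod C q)"
  proof (rule coequalizer_eqI[OF co])
    show "m \<cdot> h \<in> hom C (Cod C q) (Cod C q)" "Id C (Cod C q) \<in> hom C (Cod C q) (Cod C q)"
      using h am a by (simp_all add: hom_def cq)
    show "(m \<cdot> h) \<cdot> q = Id C (Cod C q) \<cdot> q"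
      using h am e by (simp add: hom_def a(1-6))
  qed
  then show "is_iso C m"
    using split_mono_iso[OF m, of h] h by (simp add: hom_def cq)
qed

lemma cover_arr: "is_cover C e \<Longrightarrow> e \<in> Arr C"
  by (simp add: is_cover_def)

lemma cover_of_comp:
  assumes "is_cover C (p \<cdot> x)" "p \<in> Arr C" "x \<in> Arr C" "Cod C x = Dom C p"
  shows "is_cover C p"
  unfolding is_cover_def
proof (intro conjI allI impI)
  fix m g
  assume m: "is_mono C m" and g: "g \<in> hom C (Dom C p) (Dom C m)" and e: "m \<cdot> g = p"
  have "m \<in> Arr C" using m by (simp add: is_mono_def)
  then have "m \<cdot> g \<cdot> x = p \<cdot> x" "g \<cdot> x \<in> hom C (Dom C (p \<cdot> x)) (Dom C m)"
    using g assms(2-4) comp_extend[OF e] by (simp_all add: hom_def)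
  then show "is_iso C m"
    using assms(1) m unfolding is_cover_def by blast
qed (rule assms)

lemma mono_of_comp:
  assumes "is_mono C (g \<cdot> f)" "f \<in> Arr C" "g \<in> Arr C" "Dom C g = Cod C f"
  shows "is_mono C f"
  unfolding is_mono_def
proof (intro conjI allI ballI impI)
  fix U u v
  assume u: "u \<in> hom C U (Dom C f)" and v: "v \<in> hom C U (Dom C f)" and e: "f \<cdot> u = f \<cdot> v"
  show "u = v"
    by (rule monoD[OF assms(1), of _ U]) (use u v assms(2-4) e in \<open>simp_all add: hom_def\<close>)
qed (rule assms)

lemma mono_pullback:
  assumes pb: "is_pullback C f m p q" and m: "is_mono C m"
  shows "is_mono C p"
  unfolding is_mono_def
proof (intro conjI allI ballI impI)
  note a = pullback_arr[OF pb]
  show "p \<in> Arr C" by (rule a)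
  fix U u v
  assume u: "u \<in> hom C U (Dom C p)" and v: "v \<in> hom C U (Dom C p)" and e: "p \<cdot> u = p \<cdot> v"
  have "m \<cdot> q \<cdot> u = f \<cdot> p \<cdot> u" "m \<cdot> q \<cdot> v = f \<cdot> p \<cdot> v"
    by (rule comp_eq_extend[OF a(9)[symmetric]]; use u v in \<open>simp add: hom_def a(1-8)\<close>)+
  then have "m \<cdot> q \<cdot> u = m \<cdot> q \<cdot> v" using e by simp
  then have "q \<cdot> u = q \<cdot> v"
    by (rule monoD[OF m, rotated -1]) (use u v in \<open>simp_all add: hom_def a(1-8)\<close>)
  then show "u = v" by (rule pullback_eqI[OF pb u v e])
qed

text \<open>If q p factors through a monomorphism m, then p factors through the pullback n of m
  along q. Hence n is invertible, and q itself factors through m.\<close>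

lemma cover_comp:
  assumes p: "is_cover C p" and q: "is_cover C q" and pq: "Cod C p = Dom C q"
  shows "is_cover C (q \<cdot> p)"
  unfolding is_cover_def
proof (intro conjI allI impI)
  note a = cover_arr[OF p] cover_arr[OF q] pq
  show "q \<cdot> p \<in> Arr C" by (simp add: a)
  fix m g
  assume m: "is_mono C m" and g: "g \<in> hom C (Dom C (q \<cdot> p)) (Dom C m)" and e: "m \<cdot> g = q \<cdot> p"
  have am: "m \<in> Arr C" "g \<in> Arr C" "Dom C g = Dom C p" "Cod C g = Dom C m"
    using m g by (simp_all add: is_mono_def hom_def a)
  have "Cod C (m \<cdot> g) = Cod C (q \<cdot> p)" using e by simp
  then have "Cod C q = Cod C m" using am by (simp add: a)
  then obtain n k where pb: "is_pullback C q m n k"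
    using pullbacks a am by blast
  note ak = pullback_arr[OF pb]
  have "p \<in> hom C (Dom C p) (Dom C q)" "g \<in> hom C (Dom C p) (Dom C m)"
    using am by (simp_all add: hom_def a)
  then obtain l where l: "l \<in> hom C (Dom C p) (Dom C n)" "n \<cdot> l = p"
    using pullback_lift[OF pb] e by metis
  have "is_iso C n"
    using p mono_pullback[OF pb m] l unfolding is_cover_def by blast
  then obtain n' where n': "n' \<in> Arr C" "Dom C n' = Cod C n" "Cod C n' = Dom C n"
      "n \<cdot> n' = Id C (Cod C n)"
    by (rule isoE)
  have "m \<cdot> k \<cdot> n' = q \<cdot> n \<cdot> n'"
    by (rule comp_eq_extend[OF ak(9)[symmetric]]) (simp_all add: n' ak(1-8))
  then have "m \<cdot> k \<cdot> n' = q" "k \<cdot> n' \<in> hom C (Dom C q) (Dom C m)"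
    using n' by (simp_all add: hom_def ak(1-8))
  then show "is_iso C m" using q m unfolding is_cover_def by blast
qed

end

section \<open>Image factorization and covers as coequalizers\<close>

locale regular_cat = pullback_category +
  assumes coequalizers: "is_kernel_pair C f R \<Longrightarrow> \<exists>q. is_coequalizer C (fst R) (snd R) q"
    and regular_epi_stable: "is_pullback C f g p q \<Longrightarrow> is_regular_epi C g \<Longrightarrow> is_regular_epi C p"
begin

text \<open>The image is the coequalizer q of the kernel pair. Two elements of it that m identifies
  lift along q after restriction to covers; the lifts have the same value under f, so they lie in
  the kernel pair and q identifies them.\<close>

lemma image_factorization:
  assumes f: "f \<in> Arr C"
  obtains q m where "is_regular_epi C q" "is_mono C m" "q \<in> Arr C" "m \<in> Arr C" "Dom C q = Dom C f"
    "Dom C m = Cod C q" "Cod C m = Cod C f" "m \<cdot> q = f"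
proof -
  obtain R where R: "is_kernel_pair C f R" by (rule kernel_pairs[OF f])
  note aR = kernel_pair_arr[OF R]
  obtain q where co: "is_coequalizer C (fst R) (snd R) q" using coequalizers[OF R] by blast
  note aq = coequalizer_arr[OF co]
  have reg: "is_regular_epi C q" using co unfolding is_regular_epi_def by blast
  have "f \<in> hom C (Cod C (fst R)) (Cod C f)" by (simp add: hom_def aR(1-6))
  then obtain m where m: "m \<in> hom C (Cod C q) (Cod C f)" "m \<cdot> q = f"
    using coequalizer_extend[OF co] aR(7) by blast
  have am: "m \<in> Arr C" "Dom C m = Cod C q" "Cod C m = Cod C f" "q \<in> Arr C" "Dom C q = Dom C f"
    using m(1) by (simp_all add: hom_def aq(1-6) aR(1-6))
  have "is_mono C m"
    unfolding is_mono_def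
  proof (intro conjI allI ballI impI)
    fix U u v
    assume "u \<in> hom C U (Dom C m)" "v \<in> hom C U (Dom C m)" and e: "m \<cdot> u = m \<cdot> v"
    then have u: "u \<in> Arr C" "Dom C u = U" "Cod C u = Cod C q"
      and v: "v \<in> Arr C" "Dom C v = U" "Cod C v = Cod C q"
      by (simp_all add: hom_def am)
    \<comment> \<open>\<open>x\<close> lifts \<open>u\<close> over \<open>p1\<close>, and
      \<open>y\<close> lifts \<open>v\<close> over the further restriction \<open>p2\<close>; both
      restrictions are pullbacks of q and can be cancelled at the end.\<close>
    obtain p1 x where pb1: "is_pullback C u q p1 x" using pullbacks u am by blast
    note a1 = pullback_arr[OF pb1]
    have vp: "v \<cdot> p1 \<in> Arr C" "Cod C (v \<cdot> p1) = Cod C q" using v a1(3,6) u by simp_all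
    obtain p2 y where pb2: "is_pullback C (v \<cdot> p1) q p2 y" using pullbacks vp am by blast
    note a2 = pullback_arr[OF pb2]
    have p: "p1 \<in> Arr C" "Cod C p1 = U" "p2 \<in> Arr C" "Cod C p2 = Dom C p1" "x \<in> Arr C" "Dom C x = Dom C p1"
      "Cod C x = Dom C f" "y \<in> Arr C" "Dom C y = Dom C p2" "Cod C y = Dom C f"
      using a1(3,4,6-8) a2(3,4,6-8) u v am by simp_all
    have e1: "q \<cdot> x \<cdot> p2 = u \<cdot> p1 \<cdot> p2"
      by (rule comp_eq_extend[OF a1(9)[symmetric]]) (simp_all add: u am p)
    have e2: "q \<cdot> y = v \<cdot> p1 \<cdot> p2"
      using a2(9) by (simp add: u v am p)
    have e3: "m \<cdot> u \<cdot> p1 \<cdot> p2 = m \<cdot> v \<cdot> p1 \<cdot> p2"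
      by (rule comp_eq_extend[OF e]) (simp_all add: u v am p)
    have fq: "f \<cdot> w = m \<cdot> q \<cdot> w" if "w \<in> Arr C" "Cod C w = Dom C f" for w
      using comp_extend[OF m(2), of w] that am by simp
    have "f \<cdot> x \<cdot> p2 = f \<cdot> y" using fq[of "x \<cdot> p2"] fq[of y] e1 e2 e3 by (simp add: p)
    moreover have "x \<cdot> p2 \<in> hom C (Dom C p2) (Dom C f)" "y \<in> hom C (Dom C p2) (Dom C f)"
      by (simp_all add: hom_def p)
    ultimately have "related C R (x \<cdot> p2) y"
      using kernel_pair_related[OF R] by blast
    then obtain k where k: "k \<in> Arr C" "Cod C k = Dom C (fst R)" "fst R \<cdot> k = x \<cdot> p2" "snd R \<cdot> k = y"
      unfolding related_def by blast
    have "q \<cdot> fst R \<cdot> k = q \<cdot> snd R \<cdot> k"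
      by (rule comp_eq_extend[OF aq(7)]) (simp_all add: k am aR(1-6))
    then have "(u \<cdot> p1) \<cdot> p2 = (v \<cdot> p1) \<cdot> p2" using k e1 e2 by (simp add: u v p)
    then have "u \<cdot> p1 = v \<cdot> p1"
      by (rule regular_epi_cancel[OF regular_epi_stable[OF pb2 reg], rotated -1])
        (simp_all add: hom_def u v p)
    then show "u = v"
      by (rule regular_epi_cancel[OF regular_epi_stable[OF pb1 reg], rotated -1])
        (simp_all add: hom_def u v p)
  qed (rule am)
  with reg am m(2) show thesis by (intro that)
qed

text \<open>The monic part of the image factorization of a cover is invertible, so f is a
  coequalizer of the same pair as its image part q.\<close>

lemma cover_regular_epi:
  assumes f: "is_cover C f"
  shows "is_regular_epi C f"
proof -
  obtain q m where q: "is_regular_epi C q" "is_mono C m" "q \<in> Arr C" "m \<in> Arr C" "Dom C q = Dom C f"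
    "Dom C m = Cod C q" "Cod C m = Cod C f" "m \<cdot> q = f"
    by (rule image_factorization[OF cover_arr[OF f]])
  have "q \<in> hom C (Dom C f) (Dom C m)" using q by (simp add: hom_def)
  then have "is_iso C m" using f q(2,8) unfolding is_cover_def by blast
  then obtain n where n: "n \<in> Arr C" "Dom C n = Cod C m" "Cod C n = Dom C m" "n \<cdot> m = Id C (Dom C m)"
      "m \<cdot> n = Id C (Cod C m)"
    by (rule isoE)
  obtain u v where co: "is_coequalizer C u v q" using q(1) unfolding is_regular_epi_def by blast
  note a = coequalizer_arr[OF co]
  have nf: "n \<cdot> f = q" using comp_extend[OF n(4), of q] q n by simp
  have af: "f \<in> Arr C" "Dom C f = Cod C u" using cover_arr[OF f] q a by simp_all
  have fe: "f \<cdot> u = f \<cdot> v"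
    using a(7) q(3-7) by (simp add: a(1-6) flip: q(8))
  have un: "\<exists>!h. h \<in> hom C (Cod C f) Z \<and> h \<cdot> f = w"
    if w: "w \<in> hom C (Cod C u) Z" "w \<cdot> u = w \<cdot> v" for w Z
  proof -
    obtain k where k: "k \<in> hom C (Cod C q) Z" "k \<cdot> q = w"
      by (rule coequalizer_extend[OF co w])
    have "k \<cdot> n \<in> hom C (Cod C f) Z" "(k \<cdot> n) \<cdot> f = w"
      using k n nf q(3-7) af by (simp_all add: hom_def)
    moreover have "h = k \<cdot> n" if h: "h \<in> hom C (Cod C f) Z" "h \<cdot> f = w" for h
    proof -
      have "h \<cdot> m = k"
        by (rule coequalizer_eqI[OF co]) (use h k q(3-7) in \<open>simp_all add: hom_def q(8)\<close>)
      then have "(h \<cdot> m) \<cdot> n = k \<cdot> n" by simp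
      then show ?thesis using h(1) q(3-7) n by (simp add: hom_def)
    qed
    ultimately show ?thesis by blast
  qed
  have "is_coequalizer C u v f"
    unfolding is_coequalizer_def using un fe af a(1-6) by (auto simp: hom_def)
  then show ?thesis unfolding is_regular_epi_def by blast
qed

lemma cover_cancel:
  assumes "is_cover C f" "h \<in> hom C (Cod C f) Z" "k \<in> hom C (Cod C f) Z" "h \<cdot> f = k \<cdot> f"
  shows "h = k"
  using regular_epi_cancel[OF cover_regular_epi] assms by blast

text \<open>A cover is the coequalizer of some pair; demanding compatibility on all generalized
  elements includes this pair without naming it.\<close>

lemma cover_descend:
  assumes "is_cover C f" "w \<in> hom C (Dom C f) Z"
    and "\<And>U u v. u \<in> hom C U (Dom C f) \<Longrightarrow> v \<in> hom C U (Dom C f) \<Longrightarrow> f \<cdot> u = f \<cdot> v \<Longrightarrow> w \<cdot> u = w \<cdot> v"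
  obtains h where "h \<in> hom C (Cod C f) Z" "h \<cdot> f = w"
proof -
  obtain u v where co: "is_coequalizer C u v f"
    using cover_regular_epi[OF assms(1)] unfolding is_regular_epi_def by blast
  note a = coequalizer_arr[OF co]
  have w: "w \<in> hom C (Cod C u) Z" using assms(2) by (simp add: a(6))
  have "u \<in> hom C (Dom C u) (Dom C f)" "v \<in> hom C (Dom C u) (Dom C f)"
    by (simp_all add: hom_def a(1-6))
  then show thesis using coequalizer_extend[OF co w assms(3)[OF _ _ a(7)]] that by blast
qed

text \<open>Surjectivity in local form: u has a preimage under p after precomposition with a cover,
  namely the pullback of p along u.\<close>

lemma cover_lift:
  assumes "is_cover C p" "u \<in> Arr C" "Cod C u = Cod C p"
  obtains c x where "is_cover C c" "c \<in> Arr C" "Cod C c = Dom C u" "x \<in> Arr C" "Dom C x = Dom C c"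
    "Cod C x = Dom C p" "p \<cdot> x = u \<cdot> c"
proof -
  obtain c x where pb: "is_pullback C u p c x"
    using pullbacks assms cover_arr by blast
  have "is_cover C c"
    using regular_epi_cover regular_epi_stable[OF pb] cover_regular_epi assms(1) by blast
  with pullback_arr[OF pb] show thesis by (intro that) auto
qed

lemma cover_mono_iso:
  assumes "is_cover C f" "is_mono C f"
  shows "is_iso C f"
proof -
  have "f \<in> Arr C" by (rule cover_arr[OF assms(1)])
  then have "Id C (Dom C f) \<in> hom C (Dom C f) (Dom C f)" "f \<cdot> Id C (Dom C f) = f"
    by (simp_all add: hom_def)
  then show ?thesis using assms unfolding is_cover_def by blast
qed

end

section \<open>The Shifting Lemma as a rule about equations\<close>

locale regular_gumm_category = regular_cat +
  assumes shifting: "shifting_lemma C"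
begin

text \<open>The kernel relations of a, b and c play the roles of R, S and T. In every application
  below a and b are jointly monic, which gives \<open>le\<close> for any c.\<close>

lemma kernel_shifting:
  assumes ar: "a \<in> Arr C" "b \<in> Arr C" "c \<in> Arr C" "Dom C a = X" "Dom C b = X" "Dom C c = X"
    and le: "\<And>U x y. x \<in> hom C U X \<Longrightarrow> y \<in> hom C U X \<Longrightarrow> a \<cdot> x = a \<cdot> y \<Longrightarrow> b \<cdot> x = b \<cdot> y \<Longrightarrow>
      c \<cdot> x = c \<cdot> y"
    and el: "x \<in> hom C U X" "y \<in> hom C U X" "x' \<in> hom C U X" "y' \<in> hom C U X"
    and h: "b \<cdot> x = b \<cdot> y" "b \<cdot> x' = b \<cdot> y'" "a \<cdot> x = a \<cdot> x'" "a \<cdot> y = a \<cdot> y'" "c \<cdot> x = c \<cdot> x'"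
  shows "c \<cdot> y = c \<cdot> y'"
proof -
  obtain A where A: "is_kernel_pair C a A" by (rule kernel_pairs[OF ar(1)])
  obtain B where B: "is_kernel_pair C b B" by (rule kernel_pairs[OF ar(2)])
  obtain D where D: "is_kernel_pair C c D" by (rule kernel_pairs[OF ar(3)])
  have X: "X \<in> Obj C" using arr_obj(1)[OF ar(1)] ar(4) by simp
  have rA: "related C A u v \<longleftrightarrow> a \<cdot> u = a \<cdot> v" and rB: "related C B u v \<longleftrightarrow> b \<cdot> u = b \<cdot> v"
    and rD: "related C D u v \<longleftrightarrow> c \<cdot> u = c \<cdot> v" if "u \<in> hom C V X" "v \<in> hom C V X" for V u v
    using that kernel_pair_related[OF A] kernel_pair_related[OF B] kernel_pair_related[OF D] ar
    by auto
  have eq: "is_equivalence C X A" "is_equivalence C X B" "is_equivalence C X D"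
    using kernel_pair_equivalence[OF A] kernel_pair_equivalence[OF B] kernel_pair_equivalence[OF D] ar
    by auto
  have "\<forall>U. \<forall>x\<in>hom C U X. \<forall>y\<in>hom C U X. related C A x y \<and> related C B x y \<longrightarrow> related C D x y"
    using le rA rB rD by blast
  then have "related C B x y \<longrightarrow> related C B x' y' \<longrightarrow> related C A x x' \<longrightarrow> related C A y y' \<longrightarrow>
      related C D x x' \<longrightarrow> related C D y y'"
    using shifting[unfolded shifting_lemma_def, rule_format, OF X eq] el by blast
  then show ?thesis using h rA rB rD el by blast
qed

end


section \<open>The fibre of points\<close>

lemma Pt_simps [simp]:
  "Dom (Pt C Y) (p, h, q) = p" "Cod (Pt C Y) (p, h, q) = q"
  "Id (Pt C Y) p = (p, Id C (Dom C (fst p)), p)"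
  "(q, g, r) \<cdot>\<^bsub>Pt C Y\<^esub> (p, h, q') = (p, g \<cdot>\<^bsub>C\<^esub> h, r)"
  by (simp_all add: Pt_def Let_def)

lemma Pt_Obj: "(f, s) \<in> Obj (Pt C Y) \<longleftrightarrow> f \<in> Arr C \<and> s \<in> Arr C \<and> Cod C f = Y \<and> Dom C s = Y \<and>
    Cod C s = Dom C f \<and> f \<cdot>\<^bsub>C\<^esub> s = Id C Y"
  by (auto simp: Pt_def Let_def hom_def)

lemma Pt_Arr: "(p, h, q) \<in> Arr (Pt C Y) \<longleftrightarrow> p \<in> Obj (Pt C Y) \<and> q \<in> Obj (Pt C Y) \<and> h \<in> Arr C \<and>
    Dom C h = Dom C (fst p) \<and> Cod C h = Dom C (fst q) \<and> fst q \<cdot>\<^bsub>C\<^esub> h = fst p \<and> h \<cdot>\<^bsub>C\<^esub> snd p = snd q"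
  by (auto simp: Pt_def Let_def hom_def)

lemma Pt_hom: "(p', h, q') \<in> hom (Pt C Y) p q \<longleftrightarrow> p' = p \<and> q' = q \<and> (p, h, q) \<in> Arr (Pt C Y)"
  by (auto simp: hom_def)

lemma Pt_homE:
  assumes "k \<in> hom (Pt C Y) p q"
  obtains h where "k = (p, h, q)" "(p, h, q) \<in> Arr (Pt C Y)"
  using assms by (cases k) (auto simp: Pt_hom)

context pullback_category
begin

lemma Pt_mono:
  assumes "is_mono C m" "(p, m, q) \<in> Arr (Pt C Y)"
  shows "is_mono (Pt C Y) (p, m, q)"
  unfolding is_mono_def
proof (intro conjI allI ballI impI)
  fix U u v
  assume "u \<in> hom (Pt C Y) U (Dom (Pt C Y) (p, m, q))" "v \<in> hom (Pt C Y) U (Dom (Pt C Y) (p, m, q))"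
  then obtain h k where h: "u = (U, h, p)" "(U, h, p) \<in> Arr (Pt C Y)"
    and k: "v = (U, k, p)" "(U, k, p) \<in> Arr (Pt C Y)"
    by (auto elim!: Pt_homE)
  assume "(p, m, q) \<cdot>\<^bsub>Pt C Y\<^esub> u = (p, m, q) \<cdot>\<^bsub>Pt C Y\<^esub> v"
  then have e: "m \<cdot> h = m \<cdot> k" by (simp add: h k)
  have "h \<in> hom C (Dom C (fst U)) (Dom C m)" "k \<in> hom C (Dom C (fst U)) (Dom C m)"
    using h(2) k(2) assms(2) by (auto simp: Pt_Arr hom_def)
  then show "u = v" using monoD[OF assms(1) _ _ e] by (simp add: h k)
qed (rule assms)

lemma Pt_iso:
  assumes "is_iso (Pt C Y) (p, m, q)"
  shows "is_iso C m"
proof -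
  obtain n where m: "(p, m, q) \<in> Arr (Pt C Y)" and n: "(q, n, p) \<in> Arr (Pt C Y)"
    and e: "n \<cdot> m = Id C (Dom C (fst p))" "m \<cdot> n = Id C (Dom C (fst q))"
    using assms unfolding is_iso_def by (auto elim!: Pt_homE)
  then show ?thesis by (intro isoI[of m n]) (simp_all add: Pt_Arr)
qed

text \<open>A factorization e = m n in the base lifts to the fibre: the domain of m becomes the
  point \<open>(g \<cdot> m, n \<cdot> s)\<close>, for which both m and n are morphisms of
  points.\<close>

lemma Pt_extremal_cover:
  assumes "is_extremal_epi (Pt C Y) (p, e, q)"
  shows "is_cover C e"
  unfolding is_cover_def
proof (intro conjI allI impI)
  have a: "(p, e, q) \<in> Arr (Pt C Y)"
    using assms by (simp add: is_extremal_epi_def is_epi_def)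
  obtain f s g t where pq: "p = (f, s)" "q = (g, t)" by (cases p, cases q)
  note ae = a[unfolded pq Pt_Arr Pt_Obj, simplified]
  show e: "e \<in> Arr C" using ae by simp
  fix m n
  assume m: "is_mono C m" and n: "n \<in> hom C (Dom C e) (Dom C m)" and mn: "m \<cdot> n = e"
  have am: "m \<in> Arr C" "n \<in> Arr C" "Dom C n = Dom C f" "Cod C n = Dom C m"
    using m n ae by (simp_all add: is_mono_def hom_def)
  have "Cod C (m \<cdot> n) = Dom C g" using ae by (simp add: mn)
  then have am': "Cod C m = Dom C g" using am by simp
  have fe: "g \<cdot> m \<cdot> n = f" "m \<cdot> n \<cdot> s = t"
    using ae comp_extend[OF mn, of s] am by (auto simp: mn)
  have gt: "g \<cdot> t = Id C Y" using ae by simp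
  let ?r = "(g \<cdot> m, n \<cdot> s)"
  have r: "?r \<in> Obj (Pt C Y)" using ae am am' fe gt by (simp add: Pt_Obj)
  have 1: "(?r, m, q) \<in> Arr (Pt C Y)" "(p, n, ?r) \<in> Arr (Pt C Y)"
    using r a ae am am' fe by (simp_all add: Pt_Arr pq)
  have "(p, n, ?r) \<in> hom (Pt C Y) (Dom (Pt C Y) (p, e, q)) (Dom (Pt C Y) (?r, m, q))"
    using 1 by (simp add: Pt_hom)
  moreover have "(?r, m, q) \<cdot>\<^bsub>Pt C Y\<^esub> (p, n, ?r) = (p, e, q)" by (simp add: mn)
  ultimately have "is_iso (Pt C Y) (?r, m, q)"
    using assms Pt_mono[OF m 1(1)] unfolding is_extremal_epi_def by blast
  then show "is_iso C m" by (rule Pt_iso)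
qed

text \<open>The two sections agree over the common target and so determine a section of the base
  pullback. It enters as a parameter \<open>\<sigma>\<close> so that a known expression such as
  \<open>s0 \<cdot> s\<close> can be used for it.\<close>

lemma Pt_pullback:
  assumes pb: "is_pullback C a b p q"
    and a: "((f, s), a, (h, r)) \<in> Arr (Pt C Y)" and b: "((g, t), b, (h, r)) \<in> Arr (Pt C Y)"
    and \<sigma>: "\<sigma> \<in> hom C Y (Dom C p)" "p \<cdot> \<sigma> = s" "q \<cdot> \<sigma> = t"
  shows "is_pullback (Pt C Y) ((f, s), a, (h, r)) ((g, t), b, (h, r))
    ((f \<cdot> p, \<sigma>), p, (f, s)) ((f \<cdot> p, \<sigma>), q, (g, t))"
proof -
  note aa = a[unfolded Pt_Arr Pt_Obj, simplified] and bb = b[unfolded Pt_Arr Pt_Obj, simplified]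
  note ap = pullback_arr(3,4,6-8)[OF pb]
  have ab: "a \<cdot> p = b \<cdot> q" by (rule pullback_arr[OF pb])
  have s: "\<sigma> \<in> Arr C" "Dom C \<sigma> = Y" "Cod C \<sigma> = Dom C p" using \<sigma> by (simp_all add: hom_def)
  have "f \<cdot> p = h \<cdot> a \<cdot> p" using comp_extend[of h a f p] aa ap by simp
  also have "\<dots> = g \<cdot> q" using comp_extend[of h b g q] bb ap by (simp add: ab)
  finally have gq: "g \<cdot> q = f \<cdot> p" ..
  have r: "(f \<cdot> p, \<sigma>) \<in> Obj (Pt C Y)" using aa ap s \<sigma> by (simp add: Pt_Obj)
  have P: "((f \<cdot> p, \<sigma>), p, (f, s)) \<in> Arr (Pt C Y)" "((f \<cdot> p, \<sigma>), q, (g, t)) \<in> Arr (Pt C Y)"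
    using r aa bb ap s \<sigma> gq by (simp_all add: Pt_Arr Pt_Obj)
  have "\<exists>!w. w \<in> hom (Pt C Y) U (f \<cdot> p, \<sigma>) \<and> ((f \<cdot> p, \<sigma>), p, (f, s)) \<cdot>\<^bsub>Pt C Y\<^esub> w = u \<and>
      ((f \<cdot> p, \<sigma>), q, (g, t)) \<cdot>\<^bsub>Pt C Y\<^esub> w = v"
    if u: "u \<in> hom (Pt C Y) U (f, s)" and v: "v \<in> hom (Pt C Y) U (g, t)"
      and uv: "((f, s), a, (h, r)) \<cdot>\<^bsub>Pt C Y\<^esub> u = ((g, t), b, (h, r)) \<cdot>\<^bsub>Pt C Y\<^esub> v" for U u v
  proof -
    obtain k l where k: "u = (U, k, (f, s))" "(U, k, (f, s)) \<in> Arr (Pt C Y)"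
      and l: "v = (U, l, (g, t))" "(U, l, (g, t)) \<in> Arr (Pt C Y)"
      using u v by (auto elim!: Pt_homE)
    obtain x y where U: "U = (x, y)" by (cases U)
    note ak = k(2)[unfolded U Pt_Arr Pt_Obj, simplified] and al = l(2)[unfolded U Pt_Arr Pt_Obj, simplified]
    have "k \<in> hom C (Dom C x) (Dom C a)" "l \<in> hom C (Dom C x) (Dom C b)" "a \<cdot> k = b \<cdot> l"
      using ak al aa bb uv by (simp_all add: hom_def k l)
    then obtain w where w: "w \<in> hom C (Dom C x) (Dom C p)" "p \<cdot> w = k" "q \<cdot> w = l"
      by (rule pullback_lift[OF pb])
    have aw: "w \<in> Arr C" "Dom C w = Dom C x" "Cod C w = Dom C p" using w by (simp_all add: hom_def)
    have "w \<cdot> y = \<sigma>"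
    proof (rule pullback_eqI[OF pb])
      show "p \<cdot> w \<cdot> y = p \<cdot> \<sigma>" using comp_extend[OF w(2), of y] aw ak ap by (simp add: \<sigma>)
      show "q \<cdot> w \<cdot> y = q \<cdot> \<sigma>" using comp_extend[OF w(3), of y] aw ak al ap by (simp add: \<sigma>)
    qed (use aw ak s in \<open>simp_all add: hom_def\<close>)
    then have W: "(U, w, (f \<cdot> p, \<sigma>)) \<in> Arr (Pt C Y)"
      using r aw ak ap aa w by (simp add: Pt_Arr Pt_Obj U)
    show ?thesis
    proof (rule ex1I[of _ "(U, w, (f \<cdot> p, \<sigma>))"])
      show "(U, w, (f \<cdot> p, \<sigma>)) \<in> hom (Pt C Y) U (f \<cdot> p, \<sigma>) \<and>
          ((f \<cdot> p, \<sigma>), p, (f, s)) \<cdot>\<^bsub>Pt C Y\<^esub> (U, w, (f \<cdot> p, \<sigma>)) = u \<and>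
          ((f \<cdot> p, \<sigma>), q, (g, t)) \<cdot>\<^bsub>Pt C Y\<^esub> (U, w, (f \<cdot> p, \<sigma>)) = v"
        using W w by (simp add: Pt_hom k l)
      fix z
      assume z: "z \<in> hom (Pt C Y) U (f \<cdot> p, \<sigma>) \<and> ((f \<cdot> p, \<sigma>), p, (f, s)) \<cdot>\<^bsub>Pt C Y\<^esub> z = u \<and>
          ((f \<cdot> p, \<sigma>), q, (g, t)) \<cdot>\<^bsub>Pt C Y\<^esub> z = v"
      then obtain z' where z': "z = (U, z', (f \<cdot> p, \<sigma>))" "(U, z', (f \<cdot> p, \<sigma>)) \<in> Arr (Pt C Y)"
        by (auto elim!: Pt_homE)
      have "z' = w"
      proof (rule pullback_eqI[OF pb _ w(1)])
        show "z' \<in> hom C (Dom C x) (Dom C p)"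
          using z'(2) aa ap by (simp add: Pt_Arr hom_def U)
      qed (use z in \<open>simp_all add: z' k l w\<close>)
      then show "z = (U, w, (f \<cdot> p, \<sigma>))" by (simp add: z')
    qed
  qed
  then show ?thesis
    unfolding is_pullback_def using a b P by (simp add: Pt_hom ab)
qed

lemma pullback_category_Pt:
  assumes Y: "Y \<in> Obj C"
  shows "pullback_category (Pt C Y)"
proof
  show "category (Pt C Y)" by (rule category_Pt[OF category Y])
  fix F G
  assume F: "F \<in> Arr (Pt C Y)" and G: "G \<in> Arr (Pt C Y)" and FG: "Cod (Pt C Y) F = Cod (Pt C Y) G"
  obtain f s a h r where F': "F = ((f, s), a, (h, r))" by (metis prod.exhaust)
  moreover obtain g t b h' r' where "G = ((g, t), b, (h', r'))" by (metis prod.exhaust)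
  ultimately have G': "G = ((g, t), b, (h, r))" using FG by simp
  note aa = F[unfolded F' Pt_Arr Pt_Obj, simplified] and bb = G[unfolded G' Pt_Arr Pt_Obj, simplified]
  obtain p q where pb: "is_pullback C a b p q" using pullbacks[of a b] aa bb by auto
  have "s \<in> hom C Y (Dom C a)" "t \<in> hom C Y (Dom C b)" "a \<cdot> s = b \<cdot> t"
    using aa bb by (simp_all add: hom_def)
  then obtain \<sigma> where "\<sigma> \<in> hom C Y (Dom C p)" "p \<cdot> \<sigma> = s" "q \<cdot> \<sigma> = t"
    by (rule pullback_lift[OF pb])
  then show "\<exists>p q. is_pullback (Pt C Y) F G p q"
    using Pt_pullback[OF pb F[unfolded F'] G[unfolded G']] unfolding F' G' by blast
qed

text \<open>Arbitrary base arrows u and v are not morphisms of points, so the monomorphism property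
  does not apply to them directly. It applies to the projections of the kernel pair of m, which is a
  pullback in the fibre too; the projections coincide, and u and v factor through them.\<close>

lemma Pt_mono_underlying:
  assumes m: "is_mono (Pt C Y) (p, m, q)"
  shows "is_mono C m"
  unfolding is_mono_def
proof (intro conjI allI ballI impI)
  have M: "(p, m, q) \<in> Arr (Pt C Y)" using m by (simp add: is_mono_def)
  obtain f s g t where pq: "p = (f, s)" "q = (g, t)" by (cases p, cases q)
  note am = M[unfolded pq Pt_Arr Pt_Obj, simplified]
  show "m \<in> Arr C" using am by simp
  fix U u v
  assume u: "u \<in> hom C U (Dom C m)" and v: "v \<in> hom C U (Dom C m)" and e: "m \<cdot> u = m \<cdot> v"
  obtain k l where pb: "is_pullback C m m k l" using pullbacks[of m m] am by auto
  note ak = pullback_arr(3,4,6-8)[OF pb]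
  have s: "s \<in> hom C Y (Dom C m)" using am by (simp add: hom_def)
  obtain \<sigma> where \<sigma>: "\<sigma> \<in> hom C Y (Dom C k)" "k \<cdot> \<sigma> = s" "l \<cdot> \<sigma> = s"
    by (rule pullback_lift[OF pb s s refl])
  note pb' = Pt_pullback[OF pb M[unfolded pq] M[unfolded pq] \<sigma>]
  have K: "((f \<cdot> k, \<sigma>), k, (f, s)) \<in> hom (Pt C Y) (f \<cdot> k, \<sigma>) (f, s)"
    "((f \<cdot> k, \<sigma>), l, (f, s)) \<in> hom (Pt C Y) (f \<cdot> k, \<sigma>) (f, s)"
    "(p, m, q) \<cdot>\<^bsub>Pt C Y\<^esub> ((f \<cdot> k, \<sigma>), k, (f, s)) = (p, m, q) \<cdot>\<^bsub>Pt C Y\<^esub> ((f \<cdot> k, \<sigma>), l, (f, s))"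
    using pb' by (simp_all add: is_pullback_def pq)
  then have "((f \<cdot> k, \<sigma>), k, (f, s)) = ((f \<cdot> k, \<sigma>), l, (f, s))"
    using m[unfolded is_mono_def pq Pt_simps(1)] unfolding pq by blast
  then have kl: "k = l" by simp
  obtain h where "k \<cdot> h = u" "l \<cdot> h = v" by (rule pullback_lift[OF pb u v e])
  then show "u = v" by (simp add: kl)
qed

text \<open>The only arrow of points from (f, s) to the identity point is f, and the only one back
  is s.\<close>

lemma Pt_zero:
  assumes Y: "Y \<in> Obj C"
  shows "is_zero_object (Pt C Y) (Id C Y, Id C Y)"
proof -
  have N: "(Id C Y, Id C Y) \<in> Obj (Pt C Y)" using Y by (simp add: Pt_Obj)
  have "\<exists>!t. t \<in> hom (Pt C Y) X (Id C Y, Id C Y)" if X: "X \<in> Obj (Pt C Y)" for X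
  proof -
    obtain f s where fs: "X = (f, s)" by (cases X)
    note a = X[unfolded fs Pt_Obj]
    show ?thesis unfolding fs
    proof (rule ex1I[of _ "((f, s), f, (Id C Y, Id C Y))"])
      show "((f, s), f, (Id C Y, Id C Y)) \<in> hom (Pt C Y) (f, s) (Id C Y, Id C Y)"
        using a N X fs Y by (simp add: Pt_hom Pt_Arr)
    qed (use Y in \<open>auto elim!: Pt_homE simp: Pt_Arr\<close>)
  qed
  moreover have "\<exists>!t. t \<in> hom (Pt C Y) (Id C Y, Id C Y) X" if X: "X \<in> Obj (Pt C Y)" for X
  proof -
    obtain f s where fs: "X = (f, s)" by (cases X)
    note a = X[unfolded fs Pt_Obj]
    show ?thesis unfolding fs
    proof (rule ex1I[of _ "((Id C Y, Id C Y), s, (f, s))"])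
      show "((Id C Y, Id C Y), s, (f, s)) \<in> hom (Pt C Y) (Id C Y, Id C Y) (f, s)"
        using a N X fs Y by (simp add: Pt_hom Pt_Arr)
    qed (use Y in \<open>auto elim!: Pt_homE simp: Pt_Arr\<close>)
  qed
  ultimately show ?thesis
    using N unfolding is_zero_object_def is_initial_def is_terminal_def by blast
qed

end


section \<open>Differences on a split epimorphism\<close>

text \<open>In terms of generalized elements, s0 and j are the maps x \<open>\<mapsto>\<close> (x, x) and x \<open>\<mapsto>\<close> (x, sf(x)).\<close>

locale point_kernel = regular_gumm_category +
  fixes Y :: 'a and f s d0 d1 s0 j :: 'b
  assumes point: "(f, s) \<in> Obj (Pt C Y)"
    and kernel_pair: "is_kernel_pair C f (d0, d1)"
    and s0: "s0 \<in> hom C (Dom C f) (Dom C d0)" "d0 \<cdot> s0 = Id C (Dom C f)" "d1 \<cdot> s0 = Id C (Dom C f)"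
    and j: "j \<in> hom C (Dom C f) (Dom C d0)" "d0 \<cdot> j = Id C (Dom C f)" "d1 \<cdot> j = s \<cdot> f"
begin

lemma arrows [simp]:
  "f \<in> Arr C" "s \<in> Arr C" "d0 \<in> Arr C" "d1 \<in> Arr C" "s0 \<in> Arr C" "j \<in> Arr C"
  "Cod C f = Y" "Dom C s = Y" "Cod C s = Dom C f" "Cod C d0 = Dom C f" "Cod C d1 = Dom C f"
  "Dom C d1 = Dom C d0" "Dom C s0 = Dom C f" "Cod C s0 = Dom C d0" "Dom C j = Dom C f"
  "Cod C j = Dom C d0"
  using point s0(1) j(1) kernel_pair_arr[OF kernel_pair] by (simp_all add: Pt_Obj hom_def)

lemma base [simp]: "Y \<in> Obj C"
  using arr_obj(2)[of f] by simp

lemma equations [simp]: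
  "f \<cdot> s = Id C Y" "f \<cdot> d1 = f \<cdot> d0" "d0 \<cdot> s0 = Id C (Dom C f)" "d1 \<cdot> s0 = Id C (Dom C f)"
  "d0 \<cdot> j = Id C (Dom C f)" "d1 \<cdot> j = s \<cdot> f"
  using point s0 j kernel_pair_arr(7)[OF kernel_pair] by (simp_all add: Pt_Obj)

lemma equations_comp [simp]:
  assumes "u \<in> Arr C"
  shows "Cod C u = Y \<Longrightarrow> f \<cdot> s \<cdot> u = u"
    "Cod C u = Dom C d0 \<Longrightarrow> f \<cdot> d1 \<cdot> u = f \<cdot> d0 \<cdot> u"
    "Cod C u = Dom C f \<Longrightarrow> d0 \<cdot> s0 \<cdot> u = u"
    "Cod C u = Dom C f \<Longrightarrow> d1 \<cdot> s0 \<cdot> u = u"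
    "Cod C u = Dom C f \<Longrightarrow> d0 \<cdot> j \<cdot> u = u"
    "Cod C u = Dom C f \<Longrightarrow> d1 \<cdot> j \<cdot> u = s \<cdot> f \<cdot> u"
  using assms by (simp_all add: comp_extend[OF equations(1)] comp_extend[OF equations(2)]
    comp_extend[OF equations(3)] comp_extend[OF equations(4)] comp_extend[OF equations(5)]
    comp_extend[OF equations(6)])

lemma pair_eqI:
  assumes "u \<in> Arr C" "v \<in> Arr C" "Dom C u = Dom C v" "Cod C u = Dom C d0" "Cod C v = Dom C d0"
    "d0 \<cdot> u = d0 \<cdot> v" "d1 \<cdot> u = d1 \<cdot> v"
  shows "u = v"
  by (rule pullback_eqI[OF kernel_pair[unfolded is_kernel_pair_def fst_conv snd_conv]])
    (use assms in \<open>auto simp: hom_def\<close>)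

lemma pair:
  assumes "u \<in> Arr C" "v \<in> Arr C" "Dom C v = Dom C u" "Cod C u = Dom C f" "Cod C v = Dom C f"
    "f \<cdot> u = f \<cdot> v"
  obtains h where "h \<in> Arr C" "Dom C h = Dom C u" "Cod C h = Dom C d0" "d0 \<cdot> h = u" "d1 \<cdot> h = v"
proof -
  have "u \<in> hom C (Dom C u) (Dom C f)" "v \<in> hom C (Dom C u) (Dom C f)"
    using assms by (simp_all add: hom_def)
  then obtain h where "h \<in> hom C (Dom C u) (Dom C d0)" "d0 \<cdot> h = u" "d1 \<cdot> h = v"
    using pullback_lift[OF kernel_pair[unfolded is_kernel_pair_def fst_conv snd_conv] _ _ assms(6)]
    by blast
  then show thesis using that unfolding hom_def by blast
qed

lemma j_s [simp]: "j \<cdot> s = s0 \<cdot> s"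
  by (rule pair_eqI) simp_all

text \<open>R[f] is the pullback of f with itself, and f is the map to the terminal object of the
  fibre.\<close>

lemma square_product:
  "is_product (Pt C Y) (f, s) (f, s) ((f \<cdot> d0, s0 \<cdot> s), d0, (f, s)) ((f \<cdot> d0, s0 \<cdot> s), d1, (f, s))"
proof -
  interpret P: pullback_category "Pt C Y" by (rule pullback_category_Pt) simp
  define N where "N = (Id C Y, Id C Y)"
  have "((f, s), f, N) \<in> Arr (Pt C Y)" by (simp add: Pt_Arr Pt_Obj N_def)
  then have "is_pullback (Pt C Y) ((f, s), f, N) ((f, s), f, N)
      ((f \<cdot> d0, s0 \<cdot> s), d0, (f, s)) ((f \<cdot> d0, s0 \<cdot> s), d1, (f, s))"
    unfolding N_def
    by (intro Pt_pullback[OF kernel_pair[unfolded is_kernel_pair_def fst_conv snd_conv]])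
      (simp_all add: hom_def)
  moreover have "is_terminal (Pt C Y) N"
    using Pt_zero[of Y] by (simp add: is_zero_object_def N_def)
  ultimately show ?thesis using P.pullback_over_terminal by fastforce
qed

text \<open>Every generalized element of the form (x, x) factors through \<open>s0\<close>, and
  every one of the form (x, 0) through \<open>j\<close>, so the two laws need checking on these
  arrows alone.\<close>

lemma abelianI:
  assumes d: "d \<in> hom C (Dom C d0) (Dom C f)" "f \<cdot> d = f \<cdot> d0" "d \<cdot> s0 = s \<cdot> f" "d \<cdot> j = Id C (Dom C f)"
  shows "is_abelian C Y (f, s)"
proof -
  have ad: "d \<in> Arr C" "Dom C d = Dom C d0" "Cod C d = Dom C f" using d(1) by (simp_all add: hom_def)
  have 1: "d \<cdot> r = s \<cdot> f \<cdot> d0 \<cdot> r" if r: "r \<in> hom C U (Dom C d0)" "d1 \<cdot> r = d0 \<cdot> r" for U r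
  proof -
    have ar: "r \<in> Arr C" "Dom C r = U" "Cod C r = Dom C d0" using r by (simp_all add: hom_def)
    have "r = s0 \<cdot> d0 \<cdot> r" by (rule pair_eqI) (use ar r(2) in simp_all)
    then have "d \<cdot> r = d \<cdot> s0 \<cdot> d0 \<cdot> r" by (rule arg_cong)
    also have "\<dots> = (s \<cdot> f) \<cdot> d0 \<cdot> r" using ar ad by (simp add: comp_extend[OF d(3)])
    finally show ?thesis using ar by simp
  qed
  have 2: "d \<cdot> r = d0 \<cdot> r" if r: "r \<in> hom C U (Dom C d0)" "d1 \<cdot> r = s \<cdot> f \<cdot> d0 \<cdot> r" for U r
  proof -
    have ar: "r \<in> Arr C" "Dom C r = U" "Cod C r = Dom C d0" using r by (simp_all add: hom_def)
    have "r = j \<cdot> d0 \<cdot> r" by (rule pair_eqI) (use ar r(2) in simp_all)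
    then have "d \<cdot> r = d \<cdot> j \<cdot> d0 \<cdot> r" by (rule arg_cong)
    also have "\<dots> = Id C (Dom C f) \<cdot> d0 \<cdot> r" using ar ad by (simp add: comp_extend[OF d(4)])
    finally show ?thesis using ar by simp
  qed
  show ?thesis
    unfolding is_abelian_def prod.case
    by (intro conjI point exI[of _ d0] exI[of _ d1] exI[of _ d] kernel_pair d(1,2)) (use 1 2 in auto)
qed

text \<open>Shifting shows first that d is cancellable in x, so that the kernel relation of d meets the
  relation (x, y) ~ (x', y) trivially, and then that \<open>\<phi>\<close>(0, 0) = \<open>\<phi>\<close>(y, y) implies
  \<open>\<phi>\<close>(d(x, y), 0) = \<open>\<phi>\<close>(x, y).\<close>

lemma difference_factor:
  assumes d: "d \<in> hom C (Dom C d0) (Dom C f)" "f \<cdot> d = f \<cdot> d0" "d \<cdot> s0 = s \<cdot> f" "d \<cdot> j = Id C (Dom C f)"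
    and \<phi>: "\<phi> \<in> hom C (Dom C d0) B" "\<phi> \<cdot> s0 = \<phi> \<cdot> s0 \<cdot> s \<cdot> f"
  shows "\<phi> = \<phi> \<cdot> j \<cdot> d"
proof -
  have ad [simp]: "d \<in> Arr C" "Dom C d = Dom C d0" "Cod C d = Dom C f" using d(1) by (simp_all add: hom_def)
  have a\<phi> [simp]: "\<phi> \<in> Arr C" "Dom C \<phi> = Dom C d0" "Cod C \<phi> = B" using \<phi>(1) by (simp_all add: hom_def)
  have de [simp]: "Cod C w = Dom C d0 \<Longrightarrow> f \<cdot> d \<cdot> w = f \<cdot> d0 \<cdot> w" "Cod C w = Dom C f \<Longrightarrow> d \<cdot> s0 \<cdot> w = s \<cdot> f \<cdot> w"
      "Cod C w = Dom C f \<Longrightarrow> d \<cdot> j \<cdot> w = w"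
    if "w \<in> Arr C" for w
    using that by (simp_all add: comp_extend[OF d(2)] comp_extend[OF d(3)] comp_extend[OF d(4)])
  \<comment> \<open>With u = (x, y) and v = (x', y), the rectangle with corners (x, y), (x, 0), (x',
    y), (x', 0) shifts d(x, y) = d(x', y) to d(x, 0) = d(x', 0), which is x = x'.\<close>
  have cancel: "d0 \<cdot> u = d0 \<cdot> v"
    if uv: "u \<in> hom C U (Dom C d0)" "v \<in> hom C U (Dom C d0)" "d \<cdot> u = d \<cdot> v" "d1 \<cdot> u = d1 \<cdot> v" for U u v
  proof -
    have a [simp]: "u \<in> Arr C" "Dom C u = U" "Cod C u = Dom C d0" "v \<in> Arr C" "Dom C v = U" "Cod C v = Dom C d0"
      using uv by (simp_all add: hom_def)
    have "f \<cdot> d0 \<cdot> u = f \<cdot> d1 \<cdot> u" "f \<cdot> d0 \<cdot> v = f \<cdot> d1 \<cdot> v" by (simp_all del: equations(2) equations_comp(2) add: equations_comp(2)[symmetric])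
    then have e: "f \<cdot> d0 \<cdot> u = f \<cdot> d0 \<cdot> v" using uv(4) by metis
    have "d \<cdot> j \<cdot> d0 \<cdot> u = d \<cdot> j \<cdot> d0 \<cdot> v"
    proof (rule kernel_shifting[of d1 d0 d "Dom C d0" u U _ v])
      show "d \<cdot> x = d \<cdot> y" if "x \<in> hom C V (Dom C d0)" "y \<in> hom C V (Dom C d0)" "d1 \<cdot> x = d1 \<cdot> y" "d0 \<cdot> x = d0 \<cdot> y"
        for V x y
        using pair_eqI[of x y] that by (simp add: hom_def)
    qed (use uv e in \<open>simp_all add: hom_def\<close>)
    then show ?thesis by simp
  qed
  \<comment> \<open>Rectangle with corners (0, 0), (d(x, y), 0), (y, y), (x, y): horizontally the
    second components agree, vertically the values of d, which are 0 and d(x, y).\<close>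
  have "\<phi> \<cdot> j \<cdot> d = \<phi> \<cdot> Id C (Dom C d0)"
  proof (rule kernel_shifting[of d d1 \<phi> "Dom C d0" "s0 \<cdot> s \<cdot> f \<cdot> d0" "Dom C d0" _ "s0 \<cdot> d1"])
    show "\<phi> \<cdot> x = \<phi> \<cdot> y" if "x \<in> hom C V (Dom C d0)" "y \<in> hom C V (Dom C d0)" "d \<cdot> x = d \<cdot> y" "d1 \<cdot> x = d1 \<cdot> y"
      for V x y
      using pair_eqI[of x y] cancel[OF that] that by (simp add: hom_def)
    have "\<phi> \<cdot> s0 \<cdot> d1 = (\<phi> \<cdot> s0 \<cdot> s \<cdot> f) \<cdot> d1"
      by (rule comp_extend[OF \<phi>(2)]) simp_all
    then show "\<phi> \<cdot> s0 \<cdot> s \<cdot> f \<cdot> d0 = \<phi> \<cdot> s0 \<cdot> d1" by simp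
  qed (use d in \<open>simp_all add: hom_def\<close>)
  then show ?thesis by simp
qed

end

context regular_gumm_category
begin

lemma point_kernelI:
  assumes p: "(f, s) \<in> Obj (Pt C Y)" and k: "is_kernel_pair C f (d0, d1)"
    and s0: "s0 \<in> hom C (Dom C f) (Dom C d0)" "d0 \<cdot> s0 = Id C (Dom C f)" "d1 \<cdot> s0 = Id C (Dom C f)"
  obtains j where "point_kernel C Y f s d0 d1 s0 j"
proof -
  note a = p[unfolded Pt_Obj]
  have "Id C (Dom C f) \<in> hom C (Dom C f) (Dom C f)" "s \<cdot> f \<in> hom C (Dom C f) (Dom C f)"
    "f \<cdot> Id C (Dom C f) = f \<cdot> s \<cdot> f"
    using a comp_extend[of f s "Id C Y" f] by (simp_all add: hom_def)
  then obtain j where "j \<in> hom C (Dom C f) (Dom C d0)" "d0 \<cdot> j = Id C (Dom C f)" "d1 \<cdot> j = s \<cdot> f"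
    by (rule pullback_lift[OF k[unfolded is_kernel_pair_def fst_conv snd_conv]])
  then have "point_kernel C Y f s d0 d1 s0 j"
    by unfold_locales (rule p k s0 | assumption)+
  then show thesis by (rule that)
qed

lemma kernel_diagonal:
  assumes k: "is_kernel_pair C f (d0, d1)"
  obtains s0 where "s0 \<in> hom C (Dom C f) (Dom C d0)" "d0 \<cdot> s0 = Id C (Dom C f)" "d1 \<cdot> s0 = Id C (Dom C f)"
proof -
  have i: "Id C (Dom C f) \<in> hom C (Dom C f) (Dom C f)"
    using kernel_pair_arr[OF k] by (simp add: hom_def)
  show thesis
    by (rule pullback_lift[OF k[unfolded is_kernel_pair_def fst_conv snd_conv] i i refl]) (rule that)
qed

text \<open>The two laws are evaluated at the generic elements \<open>s0\<close> and
  \<open>j\<close>, which gives them as equations of arrows.\<close>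

lemma abelianE:
  assumes "is_abelian C Y (f, s)"
  obtains d0 d1 s0 j d where "point_kernel C Y f s d0 d1 s0 j" "d \<in> hom C (Dom C d0) (Dom C f)"
    "f \<cdot> d = f \<cdot> d0" "d \<cdot> s0 = s \<cdot> f" "d \<cdot> j = Id C (Dom C f)"
proof -
  obtain d0 d1 d where p: "(f, s) \<in> Obj (Pt C Y)" and k: "is_kernel_pair C f (d0, d1)"
    and d: "d \<in> hom C (Dom C d0) (Dom C f)" "f \<cdot> d = f \<cdot> d0"
    and e: "\<forall>U. \<forall>r\<in>hom C U (Dom C d0). \<forall>x. d0 \<cdot> r = x \<longrightarrow> (d1 \<cdot> r = x \<longrightarrow> d \<cdot> r = s \<cdot> f \<cdot> x) \<and>
           (d1 \<cdot> r = s \<cdot> f \<cdot> x \<longrightarrow> d \<cdot> r = x)"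
    using assms unfolding is_abelian_def prod.case by blast
  obtain s0 where diag: "s0 \<in> hom C (Dom C f) (Dom C d0)" "d0 \<cdot> s0 = Id C (Dom C f)" "d1 \<cdot> s0 = Id C (Dom C f)"
    by (rule kernel_diagonal[OF k])
  obtain j where pk: "point_kernel C Y f s d0 d1 s0 j" by (rule point_kernelI[OF p k diag])
  then interpret point_kernel C Y f s d0 d1 s0 j .
  have "d \<cdot> s0 = s \<cdot> f \<cdot> Id C (Dom C f)" "d \<cdot> j = Id C (Dom C f)"
    using e[rule_format, of s0 "Dom C f" "Id C (Dom C f)"] e[rule_format, of j "Dom C f" "Id C (Dom C f)"]
    by (simp_all add: hom_def)
  then show thesis using that[OF pk d] by simp
qed

end


section \<open>The punctuation of the diagonal\<close>

locale fibre_punctuation = point_kernel +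
  fixes \<omega> \<theta> \<psi> :: 'b
  assumes punctuation: "is_fibre_punctuation C Y f s d0 s0 \<omega> \<theta> \<psi>"
    and star: "axiom_star (Pt C Y)"
begin

lemma punctuation_pushout:
  "is_pushout (Pt C Y) ((f, s), s0, (f \<cdot> d0, s0 \<cdot> s)) ((f, s), f, (Id C Y, Id C Y))
     ((f \<cdot> d0, s0 \<cdot> s), \<omega>, (\<psi>, \<theta>)) ((Id C Y, Id C Y), \<theta>, (\<psi>, \<theta>))"
  using punctuation by (simp add: is_fibre_punctuation_def)

lemma square_point: "(f \<cdot> d0, s0 \<cdot> s) \<in> Obj (Pt C Y)"
  by (simp add: Pt_Obj)

lemma punctuation_Pt_arr: "((f \<cdot> d0, s0 \<cdot> s), \<omega>, (\<psi>, \<theta>)) \<in> Arr (Pt C Y)"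
  using punctuation_pushout by (simp add: is_pushout_def Pt_hom)

lemma punctuation_arrows [simp]:
  "\<omega> \<in> Arr C" "\<theta> \<in> Arr C" "\<psi> \<in> Arr C" "Dom C \<omega> = Dom C d0" "Cod C \<omega> = Dom C \<psi>"
  "Dom C \<theta> = Y" "Cod C \<theta> = Dom C \<psi>" "Cod C \<psi> = Y"
  using punctuation_Pt_arr by (simp_all add: Pt_Arr Pt_Obj)

lemma punctuation_equations [simp]:
  "\<psi> \<cdot> \<theta> = Id C Y" "\<psi> \<cdot> \<omega> = f \<cdot> d0" "\<omega> \<cdot> s0 = \<theta> \<cdot> f"
  using punctuation_Pt_arr punctuation_pushout by (simp_all add: Pt_Arr Pt_Obj is_pushout_def)

lemma punctuation_equations_comp [simp]:
  assumes "u \<in> Arr C"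
  shows "Cod C u = Y \<Longrightarrow> \<psi> \<cdot> \<theta> \<cdot> u = u"
    "Cod C u = Dom C d0 \<Longrightarrow> \<psi> \<cdot> \<omega> \<cdot> u = f \<cdot> d0 \<cdot> u"
    "Cod C u = Dom C f \<Longrightarrow> \<omega> \<cdot> s0 \<cdot> u = \<theta> \<cdot> f \<cdot> u"
  using assms by (simp_all add: comp_extend[OF punctuation_equations(1)]
    comp_extend[OF punctuation_equations(2)] comp_extend[OF punctuation_equations(3)])

lemma punctuation_point: "(\<psi>, \<theta>) \<in> Obj (Pt C Y)"
  by (simp add: Pt_Obj)

text \<open>The other leg of a cocone leaves the zero object (1, 1), so it can only be the section
  t. The cocone condition thus reduces to u being constant on the diagonal, and preservation of
  sections by u follows from it.\<close>

lemma punctuation_extend: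
  assumes g: "(g, t) \<in> Obj (Pt C Y)"
    and u: "u \<in> hom C (Dom C d0) (Dom C g)" "g \<cdot> u = f \<cdot> d0" "u \<cdot> s0 = t \<cdot> f"
  obtains k where "k \<in> hom C (Dom C \<psi>) (Dom C g)" "k \<cdot> \<omega> = u" "g \<cdot> k = \<psi>" "k \<cdot> \<theta> = t"
proof -
  interpret P: pullback_category "Pt C Y" by (rule pullback_category_Pt) simp
  note ag = g[unfolded Pt_Obj]
  have au: "u \<in> Arr C" "Dom C u = Dom C d0" "Cod C u = Dom C g" using u(1) by (simp_all add: hom_def)
  have us: "u \<cdot> s0 \<cdot> s = t" using comp_extend[OF u(3), of s] ag au by simp
  have N: "(Id C Y, Id C Y) \<in> Obj (Pt C Y)" by (simp add: Pt_Obj)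
  have U: "((f \<cdot> d0, s0 \<cdot> s), u, (g, t)) \<in> hom (Pt C Y) (Cod (Pt C Y) ((f, s), s0, (f \<cdot> d0, s0 \<cdot> s))) (g, t)"
    using g square_point u us au by (simp add: Pt_hom Pt_Arr)
  have T: "((Id C Y, Id C Y), t, (g, t)) \<in> hom (Pt C Y) (Cod (Pt C Y) ((f, s), f, (Id C Y, Id C Y))) (g, t)"
    using g N ag by (simp add: Pt_hom Pt_Arr)
  obtain K where K: "K \<in> hom (Pt C Y) (\<psi>, \<theta>) (g, t)"
    "K \<cdot>\<^bsub>Pt C Y\<^esub> ((f \<cdot> d0, s0 \<cdot> s), \<omega>, (\<psi>, \<theta>)) = ((f \<cdot> d0, s0 \<cdot> s), u, (g, t))"
    by (rule P.pushout_extend[OF punctuation_pushout U T]) (use u in simp_all)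
  then obtain k where "K = ((\<psi>, \<theta>), k, (g, t))" "((\<psi>, \<theta>), k, (g, t)) \<in> Arr (Pt C Y)"
    by (auto elim: Pt_homE)
  with K show thesis by (intro that[of k]) (simp_all add: Pt_Arr hom_def)
qed

lemma punctuation_endo_id:
  assumes k: "k \<in> hom C (Dom C \<psi>) (Dom C \<psi>)" "k \<cdot> \<omega> = \<omega>" "\<psi> \<cdot> k = \<psi>" "k \<cdot> \<theta> = \<theta>"
  shows "k = Id C (Dom C \<psi>)"
proof -
  interpret P: pullback_category "Pt C Y" by (rule pullback_category_Pt) simp
  have ak: "k \<in> Arr C" "Dom C k = Dom C \<psi>" "Cod C k = Dom C \<psi>" using k(1) by (simp_all add: hom_def)
  have "((\<psi>, \<theta>), k, (\<psi>, \<theta>)) = ((\<psi>, \<theta>), Id C (Dom C \<psi>), (\<psi>, \<theta>))"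
    by (rule P.pushout_eqI[OF punctuation_pushout, where U = "(\<psi>, \<theta>)"])
      (use k ak punctuation_point in \<open>simp_all add: Pt_hom Pt_Arr\<close>)
  then show ?thesis by simp
qed

text \<open>A subobject m through which \<omega> factors carries a structure of point. The factor g
  extends along the pushout to some k, and m k is the identity because it is an endomorphism
  compatible with \<omega> and \<theta>.\<close>

lemma punctuation_cover: "is_cover C \<omega>"
  unfolding is_cover_def
proof (intro conjI allI impI)
  fix m g
  assume m: "is_mono C m" and g: "g \<in> hom C (Dom C \<omega>) (Dom C m)" and mg: "m \<cdot> g = \<omega>"
  have a [simp]: "m \<in> Arr C" "g \<in> Arr C" "Dom C g = Dom C d0" "Cod C g = Dom C m"
    using m g by (simp_all add: is_mono_def hom_def)
  have "Cod C (m \<cdot> g) = Dom C \<psi>" by (simp add: mg)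
  then have a' [simp]: "Cod C m = Dom C \<psi>" by simp
  have mg' [simp]: "m \<cdot> g = \<omega>" "\<And>u. u \<in> Arr C \<Longrightarrow> Cod C u = Dom C d0 \<Longrightarrow> m \<cdot> g \<cdot> u = \<omega> \<cdot> u"
    by (simp_all add: mg comp_extend[OF mg])
  have pt: "(\<psi> \<cdot> m, g \<cdot> s0 \<cdot> s) \<in> Obj (Pt C Y)" by (simp add: Pt_Obj)
  \<comment> \<open>Both sides become \<open>\<theta> \<cdot> f\<close> after composition with the
    monomorphism m.\<close>
  have gs: "g \<cdot> s0 = (g \<cdot> s0 \<cdot> s) \<cdot> f"
    by (rule monoD[OF m]) (simp_all add: hom_def)
  obtain k where k: "k \<in> hom C (Dom C \<psi>) (Dom C m)" "k \<cdot> \<omega> = g" "k \<cdot> \<theta> = g \<cdot> s0 \<cdot> s"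
      "(\<psi> \<cdot> m) \<cdot> k = \<psi>"
    by (rule punctuation_extend[OF pt _ _ gs]) (simp_all add: hom_def)
  have ak: "k \<in> Arr C" "Dom C k = Dom C \<psi>" "Cod C k = Dom C m" using k(1) by (simp_all add: hom_def)
  have "m \<cdot> k = Id C (Dom C \<psi>)"
    by (rule punctuation_endo_id) (use k(2-4) ak in \<open>simp_all add: hom_def\<close>)
  then show "is_iso C m" using split_mono_iso[OF m] ak by simp
qed simp

text \<open>This is the arrow e of the overview, the future universal arrow from (f, s) to its
  punctuation.\<close>

definition unit :: 'b where "unit = \<omega> \<cdot> j"

lemma unit_arrow [simp]: "unit \<in> Arr C" "Dom C unit = Dom C f" "Cod C unit = Dom C \<psi>"
  by (simp_all add: unit_def)

lemma unit_equations [simp]: "\<psi> \<cdot> unit = f" "unit \<cdot> s = \<theta>"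
  by (simp_all add: unit_def)

lemma unit_equations_comp [simp]:
  assumes "u \<in> Arr C"
  shows "Cod C u = Dom C f \<Longrightarrow> \<psi> \<cdot> unit \<cdot> u = f \<cdot> u" "Cod C u = Y \<Longrightarrow> unit \<cdot> s \<cdot> u = \<theta> \<cdot> u"
  using assms by (simp_all add: comp_extend[OF unit_equations(1)] comp_extend[OF unit_equations(2)])

text \<open>Axiom * for the relation (d1, d0) and the kernel relation of \<open>\<omega>\<close>, applied to the triples
  ((x, y), (y, y), (0, 0)), yields locally some (u, 0) with \<open>\<omega>\<close>(u, 0) = \<open>\<omega>\<close>(x, y).\<close>

lemma unit_cover: "is_cover C unit"
proof -
  interpret P: pullback_category "Pt C Y" by (rule pullback_category_Pt) simp
  define X W N D where "X = (f, s)" and "W = (f \<cdot> d0, s0 \<cdot> s)" and "N = (Id C Y, Id C Y)"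
    and "D = (\<psi>, \<theta>)"
  note defs = X_def W_def N_def D_def
  have o: "X \<in> Obj (Pt C Y)" "W \<in> Obj (Pt C Y)" "N \<in> Obj (Pt C Y)" "D \<in> Obj (Pt C Y)"
    by (simp_all add: defs Pt_Obj)
  have zero: "is_zero_object (Pt C Y) N" unfolding N_def by (rule Pt_zero) simp
  then have terminal: "is_terminal (Pt C Y) N" by (simp add: is_zero_object_def)
  have F: "(X, f, N) \<in> Arr (Pt C Y)" using o by (simp add: Pt_Arr) (simp add: defs)
  have prod: "is_product (Pt C Y) X X (W, d1, X) (W, d0, X)"
    unfolding defs by (rule P.product_swap[OF square_product])
  \<comment> \<open>The projections are swapped because the axiom completes squares for the kernel
    relation of the first leg, and second components are what must be kept. The section of
    \<open>d0\<close> is j, and \<open>d1 \<cdot> j\<close> is zero since it equals s f.\<close>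
  have "is_right_punctual (Pt C Y) X X ((W, d1, X), (W, d0, X))"
    unfolding is_right_punctual_def fst_conv snd_conv
  proof (intro conjI bexI)
    show "is_relation (Pt C Y) X X ((W, d1, X), (W, d0, X))" by (rule P.product_relation[OF prod])
    show "(X, j, W) \<in> hom (Pt C Y) X (Dom (Pt C Y) (W, d1, X))"
      using o by (simp add: Pt_hom Pt_Arr) (simp add: defs)
    show "(W, d0, X) \<cdot>\<^bsub>Pt C Y\<^esub> (X, j, W) = Id (Pt C Y) X" by (simp add: defs)
    have 1: "(X, f, N) \<in> hom (Pt C Y) X N" using F by (simp add: Pt_hom)
    have 2: "(X, s \<cdot> f, X) \<in> Arr (Pt C Y)" "(N, s, X) \<in> hom (Pt C Y) N X"
      using o by (simp_all add: Pt_hom Pt_Arr) (simp_all add: defs)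
    show "is_zero_arrow (Pt C Y) ((W, d1, X) \<cdot>\<^bsub>Pt C Y\<^esub> (X, j, W))"
      unfolding is_zero_arrow_def
      by (intro conjI exI[of _ N] bexI[of _ "(X, f, N)"] bexI[of _ "(N, s, X)"]) (use zero 1 2 in simp_all)
  qed
  moreover have "is_difunctional (Pt C Y) X X ((W, d1, X), (W, d0, X))"
    by (rule P.product_difunctional[OF prod])
  ultimately have ax: "is_extremal_epi (Pt C Y) \<zeta>"
    if "is_kernel_pair (Pt C Y) (W, d1, X) R" "is_equivalence (Pt C Y) W T" "is_zeta (Pt C Y) W R T \<zeta>"
    for R T \<zeta>
    using star[unfolded axiom_star_def, THEN conjunct2, rule_format, OF o(1) o(1),
      of "((W, d1, X), (W, d0, X))" R T \<zeta>, unfolded fst_conv Pt_simps] that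
    by blast
  have Om: "(W, \<omega>, D) \<in> Arr (Pt C Y)" and D1: "(W, d1, X) \<in> Arr (Pt C Y)"
    using o by (simp_all add: Pt_Arr) (simp_all add: defs)
  obtain R where R: "is_kernel_pair (Pt C Y) (W, d1, X) R" by (rule P.kernel_pairs[OF D1])
  obtain T where T: "is_kernel_pair (Pt C Y) (W, \<omega>, D) T" by (rule P.kernel_pairs[OF Om])
  note rel = P.kernel_pair_related[OF R, unfolded Pt_simps] P.kernel_pair_related[OF T, unfolded Pt_simps]
  obtain A x y z where A: "is_triple_object (Pt C Y) W R T A x y z"
    by (rule P.kernel_triple_object[OF R T]) simp_all
  obtain p q where pq: "is_product (Pt C Y) (Cod (Pt C Y) (W, \<omega>, D)) (Cod (Pt C Y) (W, d1, X)) p q"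
    using P.terminal_products[OF terminal] o by (metis Pt_simps(2))
  obtain Q t \<zeta> where sq: "is_square_object (Pt C Y) W R T Q (x \<cdot>\<^bsub>Pt C Y\<^esub> \<zeta>) (y \<cdot>\<^bsub>Pt C Y\<^esub> \<zeta>) t (z \<cdot>\<^bsub>Pt C Y\<^esub> \<zeta>)"
    and \<zeta>: "\<zeta> \<in> hom (Pt C Y) Q A"
    by (rule P.kernel_zeta[OF R T _ _ A pq]) simp_all
  have ext: "is_extremal_epi (Pt C Y) \<zeta>"
  proof (rule ax[OF R])
    show "is_equivalence (Pt C Y) W T" using P.kernel_pair_equivalence[OF T] by simp
    show "is_zeta (Pt C Y) W R T \<zeta>" unfolding is_zeta_def using sq A \<zeta> by blast
  qed
  have xyz: "x \<in> hom (Pt C Y) A W" "y \<in> hom (Pt C Y) A W" "z \<in> hom (Pt C Y) A W"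
    using A unfolding is_triple_object_def by blast+
  have t: "t \<in> hom (Pt C Y) Q W" and Rt: "related (Pt C Y) R t (z \<cdot>\<^bsub>Pt C Y\<^esub> \<zeta>)"
    and Tt: "related (Pt C Y) T (x \<cdot>\<^bsub>Pt C Y\<^esub> \<zeta>) t"
    and x\<zeta>: "x \<cdot>\<^bsub>Pt C Y\<^esub> \<zeta> \<in> hom (Pt C Y) Q W" and z\<zeta>: "z \<cdot>\<^bsub>Pt C Y\<^esub> \<zeta> \<in> hom (Pt C Y) Q W"
    using sq unfolding is_square_object_def by blast+
  have sym: "(W, d1, X) \<cdot>\<^bsub>Pt C Y\<^esub> t = (W, d1, X) \<cdot>\<^bsub>Pt C Y\<^esub> z \<cdot>\<^bsub>Pt C Y\<^esub> \<zeta>"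
    "(W, \<omega>, D) \<cdot>\<^bsub>Pt C Y\<^esub> x \<cdot>\<^bsub>Pt C Y\<^esub> \<zeta> = (W, \<omega>, D) \<cdot>\<^bsub>Pt C Y\<^esub> t"
    using rel t x\<zeta> z\<zeta> Rt Tt by blast+
  \<comment> \<open>The generic triple, indexed by R[f] itself: (x, y), (y, y) and (0, 0) as
    endomorphisms of the point W. The first two share the second component, and \<omega> identifies
    the last two since it is constant along the diagonal over f.\<close>
  have el: "(W, Id C (Dom C d0), W) \<in> hom (Pt C Y) W W" "(W, s0 \<cdot> d1, W) \<in> hom (Pt C Y) W W"
    "(W, s0 \<cdot> s \<cdot> f \<cdot> d0, W) \<in> hom (Pt C Y) W W"
    using o by (simp_all add: Pt_hom Pt_Arr) (simp_all add: defs)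
  have "related (Pt C Y) R (W, Id C (Dom C d0), W) (W, s0 \<cdot> d1, W) \<and>
      related (Pt C Y) T (W, s0 \<cdot> d1, W) (W, s0 \<cdot> s \<cdot> f \<cdot> d0, W)"
    using rel(1)[OF el(1,2)] rel(2)[OF el(2,3)] by simp
  then obtain \<tau> where \<tau>: "\<tau> \<in> hom (Pt C Y) W A" "x \<cdot>\<^bsub>Pt C Y\<^esub> \<tau> = (W, Id C (Dom C d0), W)"
      "z \<cdot>\<^bsub>Pt C Y\<^esub> \<tau> = (W, s0 \<cdot> s \<cdot> f \<cdot> d0, W)"
    using A el unfolding is_triple_object_def by blast
  obtain x' z' where x': "x = (A, x', W)" "(A, x', W) \<in> Arr (Pt C Y)"
    and z': "z = (A, z', W)" "(A, z', W) \<in> Arr (Pt C Y)"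
    using xyz by (auto elim!: Pt_homE)
  obtain t' \<zeta>' where t': "t = (Q, t', W)" "(Q, t', W) \<in> Arr (Pt C Y)"
    and \<zeta>': "\<zeta> = (Q, \<zeta>', A)" "(Q, \<zeta>', A) \<in> Arr (Pt C Y)"
    using t \<zeta> by (auto elim!: Pt_homE)
  obtain \<tau>' where \<tau>': "\<tau> = (W, \<tau>', A)" "(W, \<tau>', A) \<in> Arr (Pt C Y)"
    using \<tau>(1) by (auto elim!: Pt_homE)
  have W0: "Dom C (fst W) = Dom C d0" by (simp add: W_def)
  have a [simp]: "x' \<in> Arr C" "z' \<in> Arr C" "t' \<in> Arr C" "\<zeta>' \<in> Arr C" "\<tau>' \<in> Arr C"
    "Dom C x' = Dom C (fst A)" "Dom C z' = Dom C (fst A)" "Cod C x' = Dom C d0" "Cod C z' = Dom C d0"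
    "Dom C t' = Dom C (fst Q)" "Cod C t' = Dom C d0" "Dom C \<zeta>' = Dom C (fst Q)" "Cod C \<zeta>' = Dom C (fst A)"
    "Dom C \<tau>' = Dom C d0" "Cod C \<tau>' = Dom C (fst A)"
    using x' z' t' \<zeta>' \<tau>' W0 by (simp_all add: Pt_Arr)
  have e: "d1 \<cdot> t' = d1 \<cdot> z' \<cdot> \<zeta>'" "\<omega> \<cdot> x' \<cdot> \<zeta>' = \<omega> \<cdot> t'"
    "x' \<cdot> \<tau>' = Id C (Dom C d0)" "z' \<cdot> \<tau>' = s0 \<cdot> s \<cdot> f \<cdot> d0"
    using sym \<tau> by (simp_all add: x' z' t' \<zeta>' \<tau>')
  have "is_cover C \<zeta>'" using Pt_extremal_cover ext \<zeta>' by simp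
  \<comment> \<open>The classifying arrow \<open>\<tau>'\<close> of the generic triple lifts along
    \<open>\<zeta>'\<close> after restriction to a cover c; the corner \<open>t' \<cdot> v\<close>
    is the wanted local element.\<close>
  then obtain c v where c: "is_cover C c" and [simp]: "c \<in> Arr C" "Cod C c = Dom C d0" "v \<in> Arr C"
    "Dom C v = Dom C c" "Cod C v = Dom C (fst Q)" and vc: "\<zeta>' \<cdot> v = \<tau>' \<cdot> c"
    by (rule cover_lift[of \<zeta>' \<tau>']) simp_all
  have "\<omega> \<cdot> t' \<cdot> v = \<omega> \<cdot> x' \<cdot> \<zeta>' \<cdot> v"
    using comp_extend[OF e(2), of v] by simp
  also have "\<dots> = \<omega> \<cdot> c"
    using comp_extend[OF e(3), of c] by (simp add: vc)
  finally have 1: "\<omega> \<cdot> t' \<cdot> v = \<omega> \<cdot> c" .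
  have "d1 \<cdot> t' \<cdot> v = d1 \<cdot> z' \<cdot> \<zeta>' \<cdot> v"
    using comp_extend[OF e(1), of v] by simp
  also have "\<dots> = s \<cdot> f \<cdot> d0 \<cdot> c"
    using comp_extend[OF e(4), of c] by (simp add: vc)
  finally have 2: "d1 \<cdot> t' \<cdot> v = s \<cdot> f \<cdot> d0 \<cdot> c" .
  have "f \<cdot> d0 \<cdot> t' \<cdot> v = f \<cdot> d1 \<cdot> t' \<cdot> v" by simp
  also have "\<dots> = f \<cdot> d0 \<cdot> c" unfolding 2 by simp
  finally have b: "f \<cdot> d0 \<cdot> t' \<cdot> v = f \<cdot> d0 \<cdot> c" .
  \<comment> \<open>The corner has second component 0, hence is of the form (u, 0) with u its first
    component.\<close>
  have "t' \<cdot> v = j \<cdot> d0 \<cdot> t' \<cdot> v"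
    by (rule pair_eqI) (simp_all add: 2 b)
  then have "\<omega> \<cdot> t' \<cdot> v = \<omega> \<cdot> j \<cdot> d0 \<cdot> t' \<cdot> v" by (rule arg_cong)
  then have "unit \<cdot> d0 \<cdot> t' \<cdot> v = \<omega> \<cdot> c"
    by (simp add: unit_def 1)
  \<comment> \<open>The cover \<open>\<omega> \<cdot> c\<close> factors through \<open>unit\<close>
    on the left, which forces \<open>unit\<close> to be a cover.\<close>
  moreover have "is_cover C (\<omega> \<cdot> c)" by (rule cover_comp[OF c punctuation_cover]) simp
  ultimately show ?thesis
    using cover_of_comp[of unit "d0 \<cdot> t' \<cdot> v"] by simp
qed

text \<open>With u = (x, y) and v = (x', y'), the value of \<omega> is moved from (x, y) to (x', y)
  and then to (x', y'). The change in the second place cannot start from the pairs (x, 0) and needs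
  the detour through (y', y).\<close>

lemma punctuation_kernel:
  assumes uv: "u \<in> hom C U (Dom C d0)" "v \<in> hom C U (Dom C d0)"
    and e: "unit \<cdot> d0 \<cdot> u = unit \<cdot> d0 \<cdot> v" "unit \<cdot> d1 \<cdot> u = unit \<cdot> d1 \<cdot> v"
  shows "\<omega> \<cdot> u = \<omega> \<cdot> v"
proof -
  have a [simp]: "u \<in> Arr C" "Dom C u = U" "Cod C u = Dom C d0" "v \<in> Arr C" "Dom C v = U" "Cod C v = Dom C d0"
    using uv by (simp_all add: hom_def)
  have "\<psi> \<cdot> unit \<cdot> d0 \<cdot> u = \<psi> \<cdot> unit \<cdot> d0 \<cdot> v" using e(1) by simp
  then have b: "f \<cdot> d0 \<cdot> u = f \<cdot> d0 \<cdot> v" by simp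
  \<comment> \<open>m = (x', y) and n = (y', y); both lie in R[f] because
    \<open>\<psi> \<cdot> unit\<close> is f, so x and x' have the same image under f.\<close>
  obtain m where m [simp]: "m \<in> Arr C" "Dom C m = U" "Cod C m = Dom C d0" "d0 \<cdot> m = d0 \<cdot> v" "d1 \<cdot> m = d1 \<cdot> u"
    by (rule pair[of "d0 \<cdot> v" "d1 \<cdot> u"]) (simp_all add: b)
  obtain n where n [simp]: "n \<in> Arr C" "Dom C n = U" "Cod C n = Dom C d0" "d0 \<cdot> n = d1 \<cdot> v" "d1 \<cdot> n = d1 \<cdot> u"
    by (rule pair[of "d1 \<cdot> v" "d1 \<cdot> u"]) (simp_all add: b)
  have le: "\<omega> \<cdot> x = \<omega> \<cdot> y"
    if "x \<in> hom C V (Dom C d0)" "y \<in> hom C V (Dom C d0)" "d1 \<cdot> x = d1 \<cdot> y" "d0 \<cdot> x = d0 \<cdot> y" for V x y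
    using pair_eqI[of x y] that by (simp add: hom_def)
  have le': "\<omega> \<cdot> x = \<omega> \<cdot> y"
    if "x \<in> hom C V (Dom C d0)" "y \<in> hom C V (Dom C d0)" "d0 \<cdot> x = d0 \<cdot> y" "d1 \<cdot> x = d1 \<cdot> y" for V x y
    using le that by blast
  have e': "\<omega> \<cdot> j \<cdot> d0 \<cdot> u = \<omega> \<cdot> j \<cdot> d0 \<cdot> v" "\<omega> \<cdot> j \<cdot> d1 \<cdot> u = \<omega> \<cdot> j \<cdot> d1 \<cdot> v"
    using e by (simp_all add: unit_def)
  \<comment> \<open>Shifts \<omega>(x, 0) = \<omega>(x', 0) from second component 0 to second
    component y.\<close>
  have 1: "\<omega> \<cdot> u = \<omega> \<cdot> m"
    by (rule kernel_shifting[of d1 d0 \<omega> "Dom C d0" "j \<cdot> d0 \<cdot> u" U _ "j \<cdot> d0 \<cdot> v", OF _ _ _ _ _ _ le])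
      (simp_all add: hom_def b e')
  \<comment> \<open>The same shift for \<omega>(y, 0) = \<omega>(y', 0), giving \<omega>(y, y) =
    \<omega>(y', y).\<close>
  have 2: "\<omega> \<cdot> s0 \<cdot> d1 \<cdot> u = \<omega> \<cdot> n"
    by (rule kernel_shifting[of d1 d0 \<omega> "Dom C d0" "j \<cdot> d1 \<cdot> u" U _ "j \<cdot> d1 \<cdot> v", OF _ _ _ _ _ _ le])
      (simp_all add: hom_def b e')
  \<comment> \<open>Since \<omega>(y, y) = \<omega>(y', y'), the previous equation reads
    \<omega>(y', y) = \<omega>(y', y'); it is shifted from first component y' to first component
    x'.\<close>
  have 3: "\<omega> \<cdot> m = \<omega> \<cdot> v"
    by (rule kernel_shifting[of d0 d1 \<omega> "Dom C d0" n U _ "s0 \<cdot> d1 \<cdot> v", OF _ _ _ _ _ _ le'])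
      (use b 2 in \<open>simp_all add: hom_def\<close>)
  show ?thesis using 1 3 by simp
qed

text \<open>The difference of the punctuation is \<open>\<omega>\<close> itself, descended along unit \<open>\<times>\<close> unit.\<close>

lemma punctuation_difference:
  obtains c0 c1 t0 i \<epsilon> d where "point_kernel C Y \<psi> \<theta> c0 c1 t0 i"
    "\<epsilon> \<in> hom C (Dom C d0) (Dom C c0)" "c0 \<cdot> \<epsilon> = unit \<cdot> d0" "c1 \<cdot> \<epsilon> = unit \<cdot> d1"
    "d \<in> hom C (Dom C c0) (Dom C \<psi>)" "\<psi> \<cdot> d = \<psi> \<cdot> c0" "d \<cdot> t0 = \<theta> \<cdot> \<psi>" "d \<cdot> i = Id C (Dom C \<psi>)"
    "d \<cdot> \<epsilon> = \<omega>"
proof -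
  obtain R where "is_kernel_pair C \<psi> R" by (rule kernel_pairs[OF punctuation_arrows(3)])
  then obtain c0 c1 where k: "is_kernel_pair C \<psi> (c0, c1)" by (cases R) blast
  obtain t0 where diag: "t0 \<in> hom C (Dom C \<psi>) (Dom C c0)" "c0 \<cdot> t0 = Id C (Dom C \<psi>)" "c1 \<cdot> t0 = Id C (Dom C \<psi>)"
    by (rule kernel_diagonal[OF k])
  obtain i where pk: "point_kernel C Y \<psi> \<theta> c0 c1 t0 i"
    by (rule point_kernelI[OF punctuation_point k diag])
  interpret D: point_kernel C Y \<psi> \<theta> c0 c1 t0 i by (rule pk)
  obtain \<epsilon> where \<epsilon> [simp]: "\<epsilon> \<in> Arr C" "Dom C \<epsilon> = Dom C d0" "Cod C \<epsilon> = Dom C c0"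
    "c0 \<cdot> \<epsilon> = unit \<cdot> d0" "c1 \<cdot> \<epsilon> = unit \<cdot> d1"
    by (rule D.pair[of "unit \<cdot> d0" "unit \<cdot> d1"]) simp_all
  have \<epsilon>' [simp]: "c0 \<cdot> \<epsilon> \<cdot> u = unit \<cdot> d0 \<cdot> u" "c1 \<cdot> \<epsilon> \<cdot> u = unit \<cdot> d1 \<cdot> u"
    if "u \<in> Arr C" "Cod C u = Dom C d0" for u
    using that by (simp_all add: comp_extend[OF \<epsilon>(4)] comp_extend[OF \<epsilon>(5)])
  \<comment> \<open>The coordinates of a pair in R[\<psi>] are lifted along \<open>unit\<close> one
    after the other, each on a further cover. The two lifts form a pair in R[f] because
    \<open>\<psi> \<cdot> unit\<close> is f.\<close>
  have cover: "is_cover C \<epsilon>"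
  proof -
    obtain c x where c: "is_cover C c" and cx [simp]: "c \<in> Arr C" "Cod C c = Dom C c0" "x \<in> Arr C" "Dom C x = Dom C c"
      "Cod C x = Dom C f" and ux: "unit \<cdot> x = c0 \<cdot> c"
      by (rule cover_lift[OF unit_cover, of c0]) simp_all
    obtain b y where b: "is_cover C b" and yb [simp]: "b \<in> Arr C" "Cod C b = Dom C c" "y \<in> Arr C" "Dom C y = Dom C b"
      "Cod C y = Dom C f" and uy: "unit \<cdot> y = (c1 \<cdot> c) \<cdot> b"
      by (rule cover_lift[OF unit_cover, of "c1 \<cdot> c"]) simp_all
    have ux': "unit \<cdot> x \<cdot> b = c0 \<cdot> c \<cdot> b" using comp_extend[OF ux, of b] by simp
    have "f \<cdot> x \<cdot> b = \<psi> \<cdot> unit \<cdot> x \<cdot> b" by simp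
    also have "\<dots> = \<psi> \<cdot> unit \<cdot> y" unfolding ux' uy by simp
    finally have "f \<cdot> x \<cdot> b = f \<cdot> y" by simp
    then obtain h where h: "h \<in> Arr C" "Dom C h = Dom C b" "Cod C h = Dom C d0" "d0 \<cdot> h = x \<cdot> b" "d1 \<cdot> h = y"
      using pair[of "x \<cdot> b" y] by auto
    have "\<epsilon> \<cdot> h = c \<cdot> b"
      by (rule D.pair_eqI) (simp_all add: h ux' uy)
    moreover have "is_cover C (c \<cdot> b)" by (rule cover_comp[OF b c]) simp
    ultimately show ?thesis using cover_of_comp[of \<epsilon> h] h by simp
  qed
  obtain d where d: "d \<in> hom C (Cod C \<epsilon>) (Dom C \<psi>)" and d\<epsilon>: "d \<cdot> \<epsilon> = \<omega>"
  proof (rule cover_descend[OF cover])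
    show "\<omega> \<in> hom C (Dom C \<epsilon>) (Dom C \<psi>)" by (simp add: hom_def)
    fix U u v
    assume "u \<in> hom C U (Dom C \<epsilon>)" "v \<in> hom C U (Dom C \<epsilon>)" and e: "\<epsilon> \<cdot> u = \<epsilon> \<cdot> v"
    then have uv: "u \<in> hom C U (Dom C d0)" "v \<in> hom C U (Dom C d0)" by simp_all
    then have "c0 \<cdot> \<epsilon> \<cdot> u = unit \<cdot> d0 \<cdot> u" "c0 \<cdot> \<epsilon> \<cdot> v = unit \<cdot> d0 \<cdot> v"
      "c1 \<cdot> \<epsilon> \<cdot> u = unit \<cdot> d1 \<cdot> u" "c1 \<cdot> \<epsilon> \<cdot> v = unit \<cdot> d1 \<cdot> v"
      by (simp_all add: hom_def)
    then have "unit \<cdot> d0 \<cdot> u = unit \<cdot> d0 \<cdot> v" "unit \<cdot> d1 \<cdot> u = unit \<cdot> d1 \<cdot> v"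
      unfolding e by metis+
    then show "\<omega> \<cdot> u = \<omega> \<cdot> v" by (rule punctuation_kernel[OF uv])
  qed
  have ad [simp]: "d \<in> Arr C" "Dom C d = Dom C c0" "Cod C d = Dom C \<psi>" using d by (simp_all add: hom_def)
  have d' [simp]: "d \<cdot> \<epsilon> \<cdot> u = \<omega> \<cdot> u" if "u \<in> Arr C" "Cod C u = Dom C d0" for u
    using that by (simp add: comp_extend[OF d\<epsilon>])
  have 1: "\<psi> \<cdot> d = \<psi> \<cdot> c0"
    by (rule cover_cancel[OF cover]) (simp_all add: hom_def d\<epsilon>)
  \<comment> \<open>The laws of a difference are tested after the cover \<open>unit\<close>, where
    they become the values of \<omega> on (x, x) and on (x, 0).\<close>
  have tu: "t0 \<cdot> unit = \<epsilon> \<cdot> s0" by (rule D.pair_eqI) simp_all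
  have 2: "d \<cdot> t0 = \<theta> \<cdot> \<psi>"
    by (rule cover_cancel[OF unit_cover, of _ "Dom C \<psi>"]) (simp_all add: hom_def tu)
  have iu: "i \<cdot> unit = \<epsilon> \<cdot> j" by (rule D.pair_eqI) simp_all
  have 3: "d \<cdot> i = Id C (Dom C \<psi>)"
    by (rule cover_cancel[OF unit_cover, of _ "Dom C \<psi>"])
      (simp_all add: hom_def iu, simp_all add: unit_def)
  show thesis
    by (rule that[OF pk _ _ _ _ 1 2 3 d\<epsilon>]) (simp_all add: hom_def)
qed

section \<open>Abelianness and universality of the punctuation\<close>

lemma unit_Pt_hom: "((f, s), unit, (\<psi>, \<theta>)) \<in> hom (Pt C Y) (f, s) (\<psi>, \<theta>)"
  using point punctuation_point by (simp add: Pt_hom Pt_Arr)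

lemma punctuation_abelian: "is_abelian C Y (\<psi>, \<theta>)"
proof -
  obtain c0 c1 t0 i \<epsilon> d where "point_kernel C Y \<psi> \<theta> c0 c1 t0 i"
    "d \<in> hom C (Dom C c0) (Dom C \<psi>)" "\<psi> \<cdot> d = \<psi> \<cdot> c0" "d \<cdot> t0 = \<theta> \<cdot> \<psi>" "d \<cdot> i = Id C (Dom C \<psi>)"
    by (rule punctuation_difference)
  then show ?thesis by (rule point_kernel.abelianI)
qed

text \<open>The extension exists by the pushout, because the difference e of the target makes (x, y)
  \<mapsto> e(h x, h y) constant on the diagonal. For uniqueness, any morphism extending h preserves
  differences by the Shifting Lemma, so its composite with \<omega> is this same map, and \<omega>
  can be cancelled.\<close>

lemma unit_universal:
  assumes q: "is_abelian C Y q" and H: "H \<in> hom (Pt C Y) (f, s) q"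
  shows "\<exists>!k. k \<in> hom (Pt C Y) (\<psi>, \<theta>) q \<and> k \<cdot>\<^bsub>Pt C Y\<^esub> ((f, s), unit, (\<psi>, \<theta>)) = H"
proof -
  obtain c0 c1 t0 i \<epsilon> d where pk: "point_kernel C Y \<psi> \<theta> c0 c1 t0 i"
    and \<epsilon>: "\<epsilon> \<in> hom C (Dom C d0) (Dom C c0)" "c0 \<cdot> \<epsilon> = unit \<cdot> d0" "c1 \<cdot> \<epsilon> = unit \<cdot> d1"
    and d: "d \<in> hom C (Dom C c0) (Dom C \<psi>)" "\<psi> \<cdot> d = \<psi> \<cdot> c0" "d \<cdot> t0 = \<theta> \<cdot> \<psi>" "d \<cdot> i = Id C (Dom C \<psi>)"
    and d\<epsilon>: "d \<cdot> \<epsilon> = \<omega>"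
    by (rule punctuation_difference)
  interpret D: point_kernel C Y \<psi> \<theta> c0 c1 t0 i by (rule pk)
  have a [simp]: "\<epsilon> \<in> Arr C" "Dom C \<epsilon> = Dom C d0" "Cod C \<epsilon> = Dom C c0"
    "d \<in> Arr C" "Dom C d = Dom C c0" "Cod C d = Dom C \<psi>"
    using \<epsilon>(1) d(1) by (simp_all add: hom_def)
  obtain g t where q': "q = (g, t)" by (cases q)
  obtain b0 b1 r0 l e where bk: "point_kernel C Y g t b0 b1 r0 l"
    and e: "e \<in> hom C (Dom C b0) (Dom C g)" "g \<cdot> e = g \<cdot> b0" "e \<cdot> r0 = t \<cdot> g" "e \<cdot> l = Id C (Dom C g)"
    by (rule abelianE[OF q[unfolded q']])
  interpret B: point_kernel C Y g t b0 b1 r0 l by (rule bk)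
  obtain h where h': "H = ((f, s), h, (g, t))" "((f, s), h, (g, t)) \<in> Arr (Pt C Y)"
    using H unfolding q' by (rule Pt_homE)
  have h [simp]: "h \<in> Arr C" "Dom C h = Dom C f" "Cod C h = Dom C g" "g \<cdot> h = f" "h \<cdot> s = t"
    using h'(2) by (simp_all add: Pt_Arr)
  have hc [simp]: "u \<in> Arr C \<Longrightarrow> Cod C u = Dom C f \<Longrightarrow> g \<cdot> h \<cdot> u = f \<cdot> u"
    "u \<in> Arr C \<Longrightarrow> Cod C u = Y \<Longrightarrow> h \<cdot> s \<cdot> u = t \<cdot> u" for u
    by (simp_all add: comp_extend[OF h(4)] comp_extend[OF h(5)])
  have ae [simp]: "e \<in> Arr C" "Dom C e = Dom C b0" "Cod C e = Dom C g" using e(1) by (simp_all add: hom_def)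
  have ec [simp]: "u \<in> Arr C \<Longrightarrow> Cod C u = Dom C b0 \<Longrightarrow> g \<cdot> e \<cdot> u = g \<cdot> b0 \<cdot> u"
    "u \<in> Arr C \<Longrightarrow> Cod C u = Dom C g \<Longrightarrow> e \<cdot> r0 \<cdot> u = t \<cdot> g \<cdot> u"
    "u \<in> Arr C \<Longrightarrow> Cod C u = Dom C g \<Longrightarrow> e \<cdot> l \<cdot> u = u" for u
    by (simp_all add: comp_extend[OF e(2)] comp_extend[OF e(3)] comp_extend[OF e(4)])
  \<comment> \<open>\<eta> is h applied to both components of a pair.\<close>
  obtain \<eta> where \<eta> [simp]: "\<eta> \<in> Arr C" "Dom C \<eta> = Dom C d0" "Cod C \<eta> = Dom C b0" "b0 \<cdot> \<eta> = h \<cdot> d0" "b1 \<cdot> \<eta> = h \<cdot> d1"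
    by (rule B.pair[of "h \<cdot> d0" "h \<cdot> d1"]) simp_all
  have \<eta>c [simp]: "u \<in> Arr C \<Longrightarrow> Cod C u = Dom C d0 \<Longrightarrow> b0 \<cdot> \<eta> \<cdot> u = h \<cdot> d0 \<cdot> u"
    "u \<in> Arr C \<Longrightarrow> Cod C u = Dom C d0 \<Longrightarrow> b1 \<cdot> \<eta> \<cdot> u = h \<cdot> d1 \<cdot> u" for u
    by (simp_all add: comp_extend[OF \<eta>(4)] comp_extend[OF \<eta>(5)])
  have \<eta>s: "\<eta> \<cdot> s0 = r0 \<cdot> h" by (rule B.pair_eqI) simp_all
  have \<eta>j: "\<eta> \<cdot> j = l \<cdot> h" by (rule B.pair_eqI) simp_all
  obtain k where k: "k \<in> hom C (Dom C \<psi>) (Dom C g)" "k \<cdot> \<omega> = e \<cdot> \<eta>" "g \<cdot> k = \<psi>" "k \<cdot> \<theta> = t"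
    by (rule punctuation_extend[OF B.point, of "e \<cdot> \<eta>"]) (simp_all add: hom_def \<eta>s)
  have ak [simp]: "k \<in> Arr C" "Dom C k = Dom C \<psi>" "Cod C k = Dom C g" using k(1) by (simp_all add: hom_def)
  have "k \<cdot> \<omega> \<cdot> j = h" using comp_extend[OF k(2), of j] by (simp add: \<eta>j)
  then have ku: "k \<cdot> unit = h" by (simp add: unit_def)
  have unique: "m \<cdot> \<omega> = e \<cdot> \<eta>"
    if m: "m \<in> Arr C" "Dom C m = Dom C \<psi>" "Cod C m = Dom C g" "g \<cdot> m = \<psi>" "m \<cdot> unit = h" "m \<cdot> \<theta> = t" for m
  proof -
    note am [simp] = m(1-3)
    have mc [simp]: "u \<in> Arr C \<Longrightarrow> Cod C u = Dom C \<psi> \<Longrightarrow> g \<cdot> m \<cdot> u = \<psi> \<cdot> u"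
      "u \<in> Arr C \<Longrightarrow> Cod C u = Dom C f \<Longrightarrow> m \<cdot> unit \<cdot> u = h \<cdot> u"
      "u \<in> Arr C \<Longrightarrow> Cod C u = Y \<Longrightarrow> m \<cdot> \<theta> \<cdot> u = t \<cdot> u" for u
      by (simp_all add: comp_extend[OF m(4)] comp_extend[OF m(5)] comp_extend[OF m(6)])
    \<comment> \<open>\<kappa> is m applied to both components of a pair in R[\<psi>], so that
      \<kappa> after \<epsilon> is \<eta>.\<close>
    obtain \<kappa> where \<kappa> [simp]: "\<kappa> \<in> Arr C" "Dom C \<kappa> = Dom C c0" "Cod C \<kappa> = Dom C b0"
      "b0 \<cdot> \<kappa> = m \<cdot> c0" "b1 \<cdot> \<kappa> = m \<cdot> c1"
      by (rule B.pair[of "m \<cdot> c0" "m \<cdot> c1"]) simp_all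
    have \<kappa>c [simp]: "u \<in> Arr C \<Longrightarrow> Cod C u = Dom C c0 \<Longrightarrow> b0 \<cdot> \<kappa> \<cdot> u = m \<cdot> c0 \<cdot> u"
      "u \<in> Arr C \<Longrightarrow> Cod C u = Dom C c0 \<Longrightarrow> b1 \<cdot> \<kappa> \<cdot> u = m \<cdot> c1 \<cdot> u" for u
      by (simp_all add: comp_extend[OF \<kappa>(4)] comp_extend[OF \<kappa>(5)])
    have \<kappa>t: "\<kappa> \<cdot> t0 = r0 \<cdot> m" by (rule B.pair_eqI) simp_all
    have \<kappa>i: "\<kappa> \<cdot> i = l \<cdot> m" by (rule B.pair_eqI) (simp_all add: m(4))
    have \<kappa>\<epsilon>: "\<kappa> \<cdot> \<epsilon> = \<eta>" by (rule B.pair_eqI) (simp_all add: \<epsilon>)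
    \<comment> \<open>The map sending (a, b) to e(m a, m b) has the same value at (a, a) as at (0,
      0), so \<open>difference_factor\<close> applies to it. Its value is therefore that at (d(a,
      b), 0), namely m(d(a, b)).\<close>
    have "e \<cdot> \<kappa> \<cdot> t0 = t \<cdot> \<psi>" by (simp add: \<kappa>t m(4))
    moreover have "e \<cdot> \<kappa> \<cdot> t0 \<cdot> \<theta> \<cdot> \<psi> = t \<cdot> \<psi>"
      using comp_extend[OF \<kappa>t, of "\<theta> \<cdot> \<psi>"] by simp
    ultimately have "(e \<cdot> \<kappa>) \<cdot> t0 = (e \<cdot> \<kappa>) \<cdot> t0 \<cdot> \<theta> \<cdot> \<psi>" by simp
    then have "e \<cdot> \<kappa> = (e \<cdot> \<kappa>) \<cdot> i \<cdot> d"
      by (rule D.difference_factor[OF d, rotated -1]) (simp add: hom_def)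
    also have "\<dots> = m \<cdot> d" using comp_extend[OF \<kappa>i, of d] by simp
    finally have "e \<cdot> \<kappa> = m \<cdot> d" .
    then have "(e \<cdot> \<kappa>) \<cdot> \<epsilon> = (m \<cdot> d) \<cdot> \<epsilon>" by simp
    then show ?thesis by (simp add: \<kappa>\<epsilon> d\<epsilon>)
  qed
  show ?thesis
  proof (rule ex1I[of _ "((\<psi>, \<theta>), k, q)"])
    show "((\<psi>, \<theta>), k, q) \<in> hom (Pt C Y) (\<psi>, \<theta>) q \<and>
        ((\<psi>, \<theta>), k, q) \<cdot>\<^bsub>Pt C Y\<^esub> ((f, s), unit, (\<psi>, \<theta>)) = H"
      using punctuation_point B.point k ku by (simp add: q' h'(1) Pt_hom Pt_Arr)
    fix K
    assume K: "K \<in> hom (Pt C Y) (\<psi>, \<theta>) q \<and> K \<cdot>\<^bsub>Pt C Y\<^esub> ((f, s), unit, (\<psi>, \<theta>)) = H"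
    then obtain m where m: "K = ((\<psi>, \<theta>), m, q)" "((\<psi>, \<theta>), m, q) \<in> Arr (Pt C Y)"
      by (blast elim: Pt_homE)
    have "m \<in> Arr C" "Dom C m = Dom C \<psi>" "Cod C m = Dom C g" "g \<cdot> m = \<psi>" "m \<cdot> unit = h" "m \<cdot> \<theta> = t"
      using m(2) K by (simp_all add: Pt_Arr m(1) q' h'(1))
    then have "m \<cdot> \<omega> = k \<cdot> \<omega>" "m \<in> hom C (Cod C \<omega>) (Dom C g)" "k \<in> hom C (Cod C \<omega>) (Dom C g)"
      using unique[of m] by (simp_all add: hom_def k(2))
    then have "m = k" using cover_cancel[OF punctuation_cover] by blast
    then show "K = ((\<psi>, \<theta>), k, q)" by (simp add: m)
  qed
qed

lemma punctuation_universal: "is_universal_abelian C Y (f, s) (\<psi>, \<theta>)"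
  unfolding is_universal_abelian_def using punctuation_abelian unit_Pt_hom unit_universal by blast

text \<open>A monic cover is invertible, and \<omega> followed by the inverse v of
  \<open>unit\<close> satisfies the laws of a difference on (f, s).\<close>

lemma abelian_if_unit_mono:
  assumes "is_mono C unit"
  shows "is_abelian C Y (f, s)"
proof -
  have "is_iso C unit" by (rule cover_mono_iso[OF unit_cover assms])
  then obtain v where [simp]: "v \<in> Arr C" "Dom C v = Dom C \<psi>" "Cod C v = Dom C f"
    and v: "v \<cdot> unit = Id C (Dom C f)" "unit \<cdot> v = Id C (Dom C \<psi>)"
    by (rule isoE) simp_all
  have "v \<cdot> \<theta> = v \<cdot> unit \<cdot> s" by simp
  then have v\<theta>: "v \<cdot> \<theta> = s" using comp_extend[OF v(1), of s] by simp
  have "f \<cdot> v = \<psi> \<cdot> unit \<cdot> v" by simp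
  then have fv: "f \<cdot> v = \<psi>" unfolding v by simp
  show ?thesis
  proof (rule abelianI)
    show "v \<cdot> \<omega> \<in> hom C (Dom C d0) (Dom C f)" by (simp add: hom_def)
    show "f \<cdot> v \<cdot> \<omega> = f \<cdot> d0" using comp_extend[OF fv, of \<omega>] by simp
    show "(v \<cdot> \<omega>) \<cdot> s0 = s \<cdot> f" using comp_extend[OF v\<theta>, of f] by simp
    show "(v \<cdot> \<omega>) \<cdot> j = Id C (Dom C f)" using v(1) by (simp add: unit_def)
  qed
qed

end

section \<open>Existence of punctuations in standard form and passage from the hypotheses\<close>

context regular_gumm_category
begin

text \<open>The hypothesis provides a pushout for some product and some terminal object of the
  fibre. Both are isomorphic to the standard choices R[f] and (1, 1), and under these isomorphisms
  the span becomes that of \<open>s0\<close> and f.\<close>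

lemma fibre_punctuation_exists:
  assumes point: "(f, s) \<in> Obj (Pt C Y)" and k: "is_kernel_pair C f (d0, d1)"
    and s0: "s0 \<in> hom C (Dom C f) (Dom C d0)" "d0 \<cdot> s0 = Id C (Dom C f)" "d1 \<cdot> s0 = Id C (Dom C f)"
    and dp: "has_diagonal_punctuations (Pt C Y)"
  obtains \<omega> \<theta> \<psi> where "is_fibre_punctuation C Y f s d0 s0 \<omega> \<theta> \<psi>"
proof -
  obtain j where "point_kernel C Y f s d0 d1 s0 j" by (rule point_kernelI[OF point k s0])
  then interpret point_kernel C Y f s d0 d1 s0 j .
  interpret P: pullback_category "Pt C Y" by (rule pullback_category_Pt) simp
  define X W N where "X = (f, s)" and "W = (f \<cdot> d0, s0 \<cdot> s)" and "N = (Id C Y, Id C Y)"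
  note defs = X_def W_def N_def
  have o: "X \<in> Obj (Pt C Y)" "W \<in> Obj (Pt C Y)" "N \<in> Obj (Pt C Y)"
    by (simp_all add: defs Pt_Obj)
  have terminal: "is_terminal (Pt C Y) N"
    using Pt_zero[of Y] by (simp add: is_zero_object_def N_def)
  have F: "(X, f, N) \<in> Arr (Pt C Y)" using o by (simp add: Pt_Arr) (simp add: defs)
  have prod: "is_product (Pt C Y) X X (W, d0, X) (W, d1, X)"
    unfolding defs by (rule square_product)
  obtain p0 p1 s' t w n where dp': "is_diagonal_punctuation (Pt C Y) X p0 p1 s' t w n"
    using dp o(1) unfolding has_diagonal_punctuations_def by blast
  have pp: "is_product (Pt C Y) X X p0 p1" and s': "s' \<in> hom (Pt C Y) X (Dom (Pt C Y) p0)"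
    "p0 \<cdot>\<^bsub>Pt C Y\<^esub> s' = Id (Pt C Y) X" "p1 \<cdot>\<^bsub>Pt C Y\<^esub> s' = Id (Pt C Y) X"
    and t: "is_terminal (Pt C Y) (Cod (Pt C Y) t)" "t \<in> hom (Pt C Y) X (Cod (Pt C Y) t)"
    and po: "is_pushout (Pt C Y) s' t w n"
    using dp' unfolding is_diagonal_punctuation_def by auto
  have cs: "Cod (Pt C Y) s' = Dom (Pt C Y) p0" using s'(1) by (simp add: hom_def)
  obtain i i' where i: "i \<in> hom (Pt C Y) W (Cod (Pt C Y) s')" "i' \<in> hom (Pt C Y) (Cod (Pt C Y) s') W"
    "i \<cdot>\<^bsub>Pt C Y\<^esub> i' = Id (Pt C Y) (Cod (Pt C Y) s')" "i' \<cdot>\<^bsub>Pt C Y\<^esub> i = Id (Pt C Y) W"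
    and pi: "(W, d0, X) \<cdot>\<^bsub>Pt C Y\<^esub> i' = p0" "(W, d1, X) \<cdot>\<^bsub>Pt C Y\<^esub> i' = p1"
    by (rule P.product_unique[OF prod pp]) (simp add: cs)
  obtain l l' where l: "l \<in> hom (Pt C Y) N (Cod (Pt C Y) t)" "l' \<in> hom (Pt C Y) (Cod (Pt C Y) t) N"
    "l \<cdot>\<^bsub>Pt C Y\<^esub> l' = Id (Pt C Y) (Cod (Pt C Y) t)" "l' \<cdot>\<^bsub>Pt C Y\<^esub> l = Id (Pt C Y) N"
    by (rule P.terminal_unique[OF terminal t(1)])
  have S: "(X, s0, W) \<in> hom (Pt C Y) X W"
    using o by (simp add: Pt_hom Pt_Arr) (simp add: defs)
  have aw: "(W, d0, X) \<in> Arr (Pt C Y)" "(W, d1, X) \<in> Arr (Pt C Y)"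
    using P.product_arr[OF prod] by simp_all
  have "i' \<cdot>\<^bsub>Pt C Y\<^esub> s' = (X, s0, W)"
  proof (rule P.product_eqI[OF prod])
    have ar: "i' \<in> Arr (Pt C Y)" "s' \<in> Arr (Pt C Y)" "Dom (Pt C Y) i' = Cod (Pt C Y) s'" "Cod (Pt C Y) i' = W"
      "Dom (Pt C Y) s' = X"
      using i(2) s'(1) by (simp_all add: hom_def)
    show "i' \<cdot>\<^bsub>Pt C Y\<^esub> s' \<in> hom (Pt C Y) X (Dom (Pt C Y) (W, d0, X))"
      using ar by (simp add: hom_def)
    show "(X, s0, W) \<in> hom (Pt C Y) X (Dom (Pt C Y) (W, d0, X))" using S by simp
    show "(W, d0, X) \<cdot>\<^bsub>Pt C Y\<^esub> i' \<cdot>\<^bsub>Pt C Y\<^esub> s' = (W, d0, X) \<cdot>\<^bsub>Pt C Y\<^esub> (X, s0, W)"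
      using P.comp_extend[OF pi(1), of s'] ar aw s'(2) by (simp add: X_def)
    show "(W, d1, X) \<cdot>\<^bsub>Pt C Y\<^esub> i' \<cdot>\<^bsub>Pt C Y\<^esub> s' = (W, d1, X) \<cdot>\<^bsub>Pt C Y\<^esub> (X, s0, W)"
      using P.comp_extend[OF pi(2), of s'] ar aw s'(3) by (simp add: X_def)
  qed
  moreover have "l' \<cdot>\<^bsub>Pt C Y\<^esub> t = (X, f, N)"
  proof -
    have "l' \<cdot>\<^bsub>Pt C Y\<^esub> t \<in> hom (Pt C Y) X N" "(X, f, N) \<in> hom (Pt C Y) X N"
      using l(2) t(2) F by (simp_all add: hom_def)
    then show ?thesis using terminal o(1) unfolding is_terminal_def by blast
  qed
  ultimately have po': "is_pushout (Pt C Y) (X, s0, W) (X, f, N) (w \<cdot>\<^bsub>Pt C Y\<^esub> i) (n \<cdot>\<^bsub>Pt C Y\<^esub> l)"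
    using P.pushout_transport[OF po i l] by simp
  obtain A \<omega> \<psi> \<theta> where w: "w \<cdot>\<^bsub>Pt C Y\<^esub> i = (A, \<omega>, (\<psi>, \<theta>))" by (metis prod.exhaust)
  obtain B \<theta>' D where n: "n \<cdot>\<^bsub>Pt C Y\<^esub> l = (B, \<theta>', D)" by (metis prod.exhaust)
  have eq: "A = W" "B = N" "D = (\<psi>, \<theta>)" and \<theta>: "(N, \<theta>', (\<psi>, \<theta>)) \<in> Arr (Pt C Y)"
    using P.pushout_arr[OF po'] by (auto simp: w n)
  \<comment> \<open>An arrow of points that leaves the identity point (1, 1) is the section of its
    target.\<close>
  have "\<theta>' = \<theta>" using \<theta> by (auto simp: Pt_Arr N_def)
  then have "is_fibre_punctuation C Y f s d0 s0 \<omega> \<theta> \<psi>"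
    using po' unfolding w n eq is_fibre_punctuation_def defs by simp
  then show thesis by (rule that)
qed

end

text \<open>A pullback is the limit of the graph with vertices 0, 1, 2 and one edge from each of 0
  and 1 to 2.\<close>

lemma finitely_complete_pullback_category:
  fixes C :: "('a, 'b) cat"
  assumes C: "finitely_complete C"
  shows "pullback_category C"
proof
  show "category C" using C by (simp add: finitely_complete_def)
  then interpret category_struct C by unfold_locales
  fix f g
  assume f: "f \<in> Arr C" and g: "g \<in> Arr C" and fg: "Cod C f = Cod C g"
  \<comment> \<open>Edges carry the number of their source, so the source map is \<open>id\<close>
    and the target map is constantly 2.\<close>
  define D where "D n = (if n = 0 then Dom C f else if n = 1 then Dom C g else Cod C f)" for n :: nat
  define F where "F n = (if n = 0 then f else g)" for n :: nat
  have diag: "is_diagram C {0, 1, 2} {0, 1} id (\<lambda>_. 2) D F"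
    using f g fg by (simp add: is_diagram_def D_def F_def hom_def)
  then obtain L p where lim: "is_limit C {0, 1, 2} {0, 1} id (\<lambda>_. 2) D F L p"
    using C unfolding finitely_complete_def by (metis finite.emptyI finite_insert)
  \<comment> \<open>The leg of a cone at vertex 2 is determined by the leg at 0, so a cone amounts
    to a commuting pair.\<close>
  have apex: "q 2 \<in> hom C U (Cod C f)" if "q 0 \<in> hom C U (Dom C f)" "f \<cdot>\<^bsub>C\<^esub> q 0 = q 2" for U and q :: "nat \<Rightarrow> 'b"
    using comp_arr[of "q 0" f] that f by (simp add: hom_def)
  have cone: "is_cone C {0, 1, 2} {0, 1} id (\<lambda>_. 2) D F U q \<longleftrightarrow>
      q 0 \<in> hom C U (Dom C f) \<and> q 1 \<in> hom C U (Dom C g) \<and> f \<cdot>\<^bsub>C\<^esub> q 0 = q 2 \<and> g \<cdot>\<^bsub>C\<^esub> q 1 = q 2" for U q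
    using apex[of q U] hom_obj(1)[of "q 0" U "Dom C f"] by (auto simp: is_cone_def D_def F_def)
  have p: "p 0 \<in> hom C L (Dom C f)" "p 1 \<in> hom C L (Dom C g)" "f \<cdot>\<^bsub>C\<^esub> p 0 = p 2" "g \<cdot>\<^bsub>C\<^esub> p 1 = p 2"
    using lim unfolding is_limit_def cone by auto
  have un: "\<exists>!h. h \<in> hom C U L \<and> p 0 \<cdot>\<^bsub>C\<^esub> h = u \<and> p 1 \<cdot>\<^bsub>C\<^esub> h = v"
    if uv: "u \<in> hom C U (Dom C f)" "v \<in> hom C U (Dom C g)" "f \<cdot>\<^bsub>C\<^esub> u = g \<cdot>\<^bsub>C\<^esub> v" for U u v
  proof -
    define q where "q n = (if n = 0 then u else if n = 1 then v else f \<cdot>\<^bsub>C\<^esub> u)" for n :: nat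
    have "is_cone C {0, 1, 2} {0, 1} id (\<lambda>_. 2) D F U q"
      unfolding cone using uv by (simp add: q_def)
    then have "\<exists>!h. h \<in> hom C U L \<and> (\<forall>v\<in>{0, 1, 2}. p v \<cdot>\<^bsub>C\<^esub> h = q v)"
      using lim unfolding is_limit_def by blast
    moreover have "(\<forall>v\<in>{0, 1, 2}. p v \<cdot>\<^bsub>C\<^esub> h = q v) \<longleftrightarrow> p 0 \<cdot>\<^bsub>C\<^esub> h = u \<and> p 1 \<cdot>\<^bsub>C\<^esub> h = v"
      if h: "h \<in> hom C U L" for h
    proof -
      have "f \<cdot>\<^bsub>C\<^esub> p 0 \<cdot>\<^bsub>C\<^esub> h = p 2 \<cdot>\<^bsub>C\<^esub> h"
        by (rule comp_extend[OF p(3)]) (use p(1,2) h f in \<open>simp_all add: hom_def\<close>)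
      then show ?thesis by (auto simp: q_def)
    qed
    ultimately show ?thesis by (metis (no_types, lifting))
  qed
  have "is_pullback C f g (p 0) (p 1)"
    unfolding is_pullback_def using f g fg p un by (simp add: hom_def)
  then show "\<exists>p q. is_pullback C f g p q" by blast
qed

lemma regular_gumm_categoryI:
  assumes "regular_category C" "gumm_category C"
  shows "regular_gumm_category C"
proof -
  interpret pullback_category C
    using assms(1) by (intro finitely_complete_pullback_category) (simp add: regular_category_def)
  show ?thesis
  proof
    fix f R
    assume "is_kernel_pair C f R"
    then show "\<exists>q. is_coequalizer C (fst R) (snd R) q"
      using assms(1) kernel_pair_arr(1) unfolding regular_category_def by blast
  next
    fix f g p q
    assume "is_pullback C f g p q" "is_regular_epi C g"
    then show "is_regular_epi C p"
      using assms(1) unfolding regular_category_def by blast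
  next
    show "shifting_lemma C" using assms(2) by (simp add: gumm_category_def)
  qed
qed

theorem theorem5p1:
  fixes E :: "('o, 'a) cat"
  assumes "regular_category E" and "gumm_category E"
    and "\<forall>Y\<in>Obj E. axiom_star (Pt E Y)"
    and "\<forall>Y\<in>Obj E. has_diagonal_punctuations (Pt E Y)"
  shows "\<forall>Y\<in>Obj E.
     (\<forall>f s d0 d1 s0.
        (f, s) \<in> Obj (Pt E Y) \<longrightarrow>
        is_kernel_pair E f (d0, d1) \<longrightarrow>
        s0 \<in> hom E (Dom E f) (Dom E d0) \<longrightarrow>
        d0 \<cdot>\<^bsub>E\<^esub> s0 = Id E (Dom E f) \<longrightarrow> d1 \<cdot>\<^bsub>E\<^esub> s0 = Id E (Dom E f) \<longrightarrow>
        (\<exists>\<omega> \<theta> \<psi>. is_fibre_punctuation E Y f s d0 s0 \<omega> \<theta> \<psi>) \<and>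
        (\<forall>\<omega> \<theta> \<psi>. is_fibre_punctuation E Y f s d0 s0 \<omega> \<theta> \<psi> \<longrightarrow>
           is_universal_abelian E Y (f, s) (\<psi>, \<theta>))) \<and>
     abelian_stable_under_monos E Y"
proof
  interpret regular_gumm_category E by (rule regular_gumm_categoryI[OF assms(1,2)])
  fix Y
  assume Y: "Y \<in> Obj E"
  then have star: "axiom_star (Pt E Y)" and dp: "has_diagonal_punctuations (Pt E Y)"
    using assms(3,4) by blast+
  have fp: "\<exists>j. fibre_punctuation E Y f s d0 d1 s0 j \<omega> \<theta> \<psi>"
    if h: "(f, s) \<in> Obj (Pt E Y)" "is_kernel_pair E f (d0, d1)" "s0 \<in> hom E (Dom E f) (Dom E d0)"
      "d0 \<cdot>\<^bsub>E\<^esub> s0 = Id E (Dom E f)" "d1 \<cdot>\<^bsub>E\<^esub> s0 = Id E (Dom E f)"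
      "is_fibre_punctuation E Y f s d0 s0 \<omega> \<theta> \<psi>" for f s d0 d1 s0 \<omega> \<theta> \<psi>
  proof -
    obtain j where "point_kernel E Y f s d0 d1 s0 j" by (rule point_kernelI[OF h(1-5)])
    then interpret point_kernel E Y f s d0 d1 s0 j .
    have "fibre_punctuation E Y f s d0 d1 s0 j \<omega> \<theta> \<psi>" by unfold_locales (rule h(6) star)+
    then show ?thesis by blast
  qed
  have "abelian_stable_under_monos E Y"
    unfolding abelian_stable_under_monos_def
  proof (intro allI ballI impI)
    fix p q m
    assume m: "m \<in> hom (Pt E Y) p q" "is_mono (Pt E Y) m" and q: "is_abelian E Y q"
    obtain f s where p: "p = (f, s)" by (cases p)
    obtain m' where m': "m = (p, m', q)" "(p, m', q) \<in> Arr (Pt E Y)" using m(1) by (rule Pt_homE)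
    have point: "(f, s) \<in> Obj (Pt E Y)" using m'(2) by (simp add: Pt_Arr p)
    obtain R where "is_kernel_pair E f R" using kernel_pairs[of f] point by (auto simp: Pt_Obj)
    then obtain d0 d1 where k: "is_kernel_pair E f (d0, d1)" by (cases R) blast
    obtain s0 where s0: "s0 \<in> hom E (Dom E f) (Dom E d0)" "d0 \<cdot>\<^bsub>E\<^esub> s0 = Id E (Dom E f)" "d1 \<cdot>\<^bsub>E\<^esub> s0 = Id E (Dom E f)"
      by (rule kernel_diagonal[OF k])
    obtain \<omega> \<theta> \<psi> where "is_fibre_punctuation E Y f s d0 s0 \<omega> \<theta> \<psi>"
      by (rule fibre_punctuation_exists[OF point k s0 dp])
    then obtain j where "fibre_punctuation E Y f s d0 d1 s0 j \<omega> \<theta> \<psi>"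
      using fp[OF point k s0] by blast
    then interpret fibre_punctuation E Y f s d0 d1 s0 j \<omega> \<theta> \<psi> .
    show "is_abelian E Y p"
      unfolding p
    proof (rule abelian_if_unit_mono)
      \<comment> \<open>The given monomorphism into an abelian point factors through
        \<open>unit\<close>, and the first factor of a monomorphism is monic.\<close>
      obtain K where "K \<in> hom (Pt E Y) (\<psi>, \<theta>) q" "K \<cdot>\<^bsub>Pt E Y\<^esub> ((f, s), unit, (\<psi>, \<theta>)) = m"
        using unit_universal[OF q m(1)[unfolded p]] by blast
      then obtain k where "((\<psi>, \<theta>), k, q) \<in> Arr (Pt E Y)" "k \<cdot>\<^bsub>E\<^esub> unit = m'"
        by (auto simp: m' elim!: Pt_homE)
      moreover have "is_mono E m'" by (rule Pt_mono_underlying) (use m in \<open>simp add: m'\<close>)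
      ultimately show "is_mono E unit" by (intro mono_of_comp[of k unit]) (simp_all add: Pt_Arr)
    qed
  qed
  moreover have "is_universal_abelian E Y (f, s) (\<psi>, \<theta>)"
    if h: "(f, s) \<in> Obj (Pt E Y)" "is_kernel_pair E f (d0, d1)" "s0 \<in> hom E (Dom E f) (Dom E d0)"
      "d0 \<cdot>\<^bsub>E\<^esub> s0 = Id E (Dom E f)" "d1 \<cdot>\<^bsub>E\<^esub> s0 = Id E (Dom E f)"
      "is_fibre_punctuation E Y f s d0 s0 \<omega> \<theta> \<psi>" for f s d0 d1 s0 \<omega> \<theta> \<psi>
  proof -
    obtain j where "fibre_punctuation E Y f s d0 d1 s0 j \<omega> \<theta> \<psi>" using fp[OF h] by blast
    then show ?thesis by (rule fibre_punctuation.punctuation_universal)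
  qed
  moreover have "\<exists>\<omega> \<theta> \<psi>. is_fibre_punctuation E Y f s d0 s0 \<omega> \<theta> \<psi>"
    if h: "(f, s) \<in> Obj (Pt E Y)" "is_kernel_pair E f (d0, d1)" "s0 \<in> hom E (Dom E f) (Dom E d0)"
      "d0 \<cdot>\<^bsub>E\<^esub> s0 = Id E (Dom E f)" "d1 \<cdot>\<^bsub>E\<^esub> s0 = Id E (Dom E f)" for f s d0 d1 s0
    by (rule fibre_punctuation_exists[OF h dp]) blast
  ultimately show "(\<forall>f s d0 d1 s0.
        (f, s) \<in> Obj (Pt E Y) \<longrightarrow>
        is_kernel_pair E f (d0, d1) \<longrightarrow>
        s0 \<in> hom E (Dom E f) (Dom E d0) \<longrightarrow>
        d0 \<cdot>\<^bsub>E\<^esub> s0 = Id E (Dom E f) \<longrightarrow> d1 \<cdot>\<^bsub>E\<^esub> s0 = Id E (Dom E f) \<longrightarrow>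
        (\<exists>\<omega> \<theta> \<psi>. is_fibre_punctuation E Y f s d0 s0 \<omega> \<theta> \<psi>) \<and>
        (\<forall>\<omega> \<theta> \<psi>. is_fibre_punctuation E Y f s d0 s0 \<omega> \<theta> \<psi> \<longrightarrow>
           is_universal_abelian E Y (f, s) (\<psi>, \<theta>))) \<and>
     abelian_stable_under_monos E Y"
    by (intro conjI allI impI)
qed

end
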